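(* Let $k$ be an infinite field, let $q\in k^\times$, and let $m,n$ be positive integers. Let $\mathcal{I}_1$ be the ideal of $\mathcal{O}_q(M_{m,n}(k))$ generated by all $2\times2$ quantum minors, and let $\mathcal{H}=(k^\times)^m\times(k^\times)^n$ act on $\mathcal{O}_q(M_{m,n}(k))/\mathcal{I}_1$ by the $k$-algebra automorphisms induced from $(\alpha_1,\dots,\alpha_m,\beta_1,\dots,\beta_n)\cdot X_{ij}=\alpha_i\beta_jX_{ij}$. Then $\mathcal{O}_q(M_{m,n}(k))/\mathcal{I}_1$ has precisely $(2^m-1)(2^n-1)+1$ distinct $\mathcal{H}$-prime ideals, all of which are completely prime. Further, each $\mathcal{H}$-stratum of $\operatorname{spec}\bigl(\mathcal{O}_q(M_{m,n}(k))/\mathcal{I}_1\bigr)$ is homeomorphic to the prime spectrum of a Laurent polynomial ring over an algebraic field extension of $k$.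
   Context: The coordinate ring of quantum $m\times n$ matrices $\mathcal{O}_q(M_{m,n}(k))$ is the $k$-algebra generated by $X_{ij}$ ($1\le i\le m$, $1\le j\le n$) subject to the relations: $X_{ij}X_{lj}=qX_{lj}X_{ij}$ when $i<l$; $X_{ij}X_{is}=qX_{is}X_{ij}$ when $j<s$; $X_{is}X_{lj}=X_{lj}X_{is}$ when $i<l$ and $j<s$; $X_{ij}X_{ls}-X_{ls}X_{ij}=(q-q^{-1})X_{is}X_{lj}$ when $i<l$ and $j<s$. The $2\times 2$ quantum minors are the elements $X_{ij}X_{ls}-qX_{is}X_{lj}$ for $1\le i<l\le m$ and $1\le j<s\le n$. The ideal $\mathcal{I}_1$ is $\mathcal{H}$-invariant, so $\mathcal{H}$ acts on the quotient. Let a group $H$ act by automorphisms on a ring $A$. An $H$-prime ideal of $A$ is a proper $H$-invariant (two-sided) ideal $P$ such that whenever $K,L$ are $H$-invariant ideals with $KL\subseteq P$, then $K\subseteq P$ or $L\subseteq P$. For an ideal $P$, $(P:H)=\bigcap_{h\in H}h(P)$. The $H$-stratum of $\operatorname{spec}A$ corresponding to an $H$-prime ideal $J$ is $\operatorname{spec}_JA=\{P\in\operatorname{spec}A\mid (P:H)=J\}$, where $\operatorname{spec}A$ is the set of prime ideals of $A$ with the Zariski topology and strata carry the subspace topology. An ideal $P$ of $A$ is completely prime if $A/P$ is a (not necessarily commutative) integral domain. Laurent polynomial rings here are commutative, in finitely many (possibly zero) variables. *)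

theory Defs
  imports "HOL-Algebra.Algebra" "HOL-Analysis.Abstract_Topology"
begin

section \<open>Prime spectra of not necessarily commutative rings\<close>

text \<open>The library locale \<^locale>\<open>primeideal\<close> is restricted to commutative rings.  The following is
  the usual ideal-theoretic notion for arbitrary rings; \<^const>\<open>ideal\<close> is always two-sided.\<close>

definition prime_ideal :: "('a, 'b) ring_scheme \<Rightarrow> 'a set \<Rightarrow> bool" where
  "prime_ideal R P \<longleftrightarrow> ideal P R \<and> P \<noteq> carrier R \<and>
     (\<forall>I J. ideal I R \<and> ideal J R \<and> ideal_prod R I J \<subseteq> P \<longrightarrow> I \<subseteq> P \<or> J \<subseteq> P)"

definition completely_prime :: "('a, 'b) ring_scheme \<Rightarrow> 'a set \<Rightarrow> bool" where
  "completely_prime R P \<longleftrightarrow> ideal P R \<and> \<one>\<^bsub>R Quot P\<^esub> \<noteq> \<zero>\<^bsub>R Quot P\<^esub> \<and>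
     (\<forall>a\<in>carrier (R Quot P). \<forall>b\<in>carrier (R Quot P).
        a \<otimes>\<^bsub>R Quot P\<^esub> b = \<zero>\<^bsub>R Quot P\<^esub> \<longrightarrow> a = \<zero>\<^bsub>R Quot P\<^esub> \<or> b = \<zero>\<^bsub>R Quot P\<^esub>)"

definition Spec :: "('a, 'b) ring_scheme \<Rightarrow> 'a set set" where
  "Spec R = {P. prime_ideal R P}"

definition zariski :: "('a, 'b) ring_scheme \<Rightarrow> 'a set topology" where
  "zariski R = topology (\<lambda>U. \<exists>I. ideal I R \<and> U = Spec R - {P \<in> Spec R. I \<subseteq> P})"

lemma openin_zariski:
  assumes "ring R"
  shows "openin (zariski R) U \<longleftrightarrow> (\<exists>I. ideal I R \<and> U = Spec R - {P \<in> Spec R. I \<subseteq> P})"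
proof -
  interpret ring R by fact
  let ?D = "\<lambda>I. Spec R - {P \<in> Spec R. I \<subseteq> P}"
  have prime: "I \<subseteq> P \<or> J \<subseteq> P"
    if "P \<in> Spec R" "ideal I R" "ideal J R" "ideal_prod R I J \<subseteq> P" for P I J
    using that unfolding Spec_def prime_ideal_def by blast
  have "istopology (\<lambda>U. \<exists>I. ideal I R \<and> U = ?D I)"
    unfolding istopology_def
  proof (intro conjI allI impI)
    fix S T assume "\<exists>I. ideal I R \<and> S = ?D I" "\<exists>I. ideal I R \<and> T = ?D I"
    then obtain I J where I: "ideal I R" "S = ?D I" and J: "ideal J R" "T = ?D J" by blast
    have "S \<inter> T = ?D (ideal_prod R I J)"
      using prime[OF _ I(1) J(1)] ideal_prod_inter[OF I(1) J(1)] unfolding I(2) J(2) by blast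
    then show "\<exists>I. ideal I R \<and> S \<inter> T = ?D I"
      using ideal_prod_is_ideal[OF I(1) J(1)] by blast
  next
    fix \<U> assume U: "\<forall>K\<in>\<U>. \<exists>I. ideal I R \<and> K = ?D I"
    then obtain f where f: "\<And>K. K \<in> \<U> \<Longrightarrow> ideal (f K) R \<and> K = ?D (f K)" by metis
    let ?S = "\<Union>K\<in>\<U>. f K"
    have S: "?S \<subseteq> carrier R"
      using f by (meson UN_least additive_subgroup.a_subset ideal.axioms(1))
    have gen: "Idl\<^bsub>R\<^esub> ?S \<subseteq> P \<longleftrightarrow> (\<forall>K\<in>\<U>. f K \<subseteq> P)" if "P \<in> Spec R" for P
    proof
      show "\<forall>K\<in>\<U>. f K \<subseteq> P" if "Idl\<^bsub>R\<^esub> ?S \<subseteq> P" using that genideal_self[OF S] by blast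
      show "Idl\<^bsub>R\<^esub> ?S \<subseteq> P" if "\<forall>K\<in>\<U>. f K \<subseteq> P"
        using that \<open>P \<in> Spec R\<close> unfolding Spec_def prime_ideal_def
        by (intro genideal_minimal) auto
    qed
    have "\<Union>\<U> = (\<Union>K\<in>\<U>. ?D (f K))" using f by auto
    also have "\<dots> = ?D (Idl\<^bsub>R\<^esub> ?S)" using gen by auto
    finally show "\<exists>I. ideal I R \<and> \<Union>\<U> = ?D I" using genideal_ideal[OF S] by blast
  qed
  then show ?thesis unfolding zariski_def by (simp add: topology_inverse')
qed


section \<open>Group actions on rings\<close>

text \<open>An action of \<open>H\<close> on \<open>R\<close> is given by a function \<open>\<phi>\<close> with \<open>\<phi> h\<close> the automorphism
  by which \<open>h\<close> acts.\<close>

definition H_invariant :: "('h, 'c) monoid_scheme \<Rightarrow> ('h \<Rightarrow> 'a \<Rightarrow> 'a) \<Rightarrow> 'a set \<Rightarrow> bool" where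
  "H_invariant H \<phi> I \<longleftrightarrow> (\<forall>h\<in>carrier H. \<phi> h ` I = I)"

definition H_prime ::
  "('h, 'c) monoid_scheme \<Rightarrow> ('h \<Rightarrow> 'a \<Rightarrow> 'a) \<Rightarrow> ('a, 'b) ring_scheme \<Rightarrow> 'a set \<Rightarrow> bool" where
  "H_prime H \<phi> R P \<longleftrightarrow> ideal P R \<and> P \<noteq> carrier R \<and> H_invariant H \<phi> P \<and>
     (\<forall>I J. ideal I R \<and> H_invariant H \<phi> I \<and> ideal J R \<and> H_invariant H \<phi> J \<and>
        ideal_prod R I J \<subseteq> P \<longrightarrow> I \<subseteq> P \<or> J \<subseteq> P)"

definition H_stratum ::
  "('h, 'c) monoid_scheme \<Rightarrow> ('h \<Rightarrow> 'a \<Rightarrow> 'a) \<Rightarrow> ('a, 'b) ring_scheme \<Rightarrow> 'a set \<Rightarrow> 'a set set" where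
  "H_stratum H \<phi> R J = {P \<in> Spec R. (\<Inter>h\<in>carrier H. \<phi> h ` P) = J}"


section \<open>Monoid rings: free algebras and Laurent polynomial rings\<close>

definition monomial ::
  "('a, 'b) ring_scheme \<Rightarrow> 'a \<Rightarrow> 'w \<Rightarrow> 'w \<Rightarrow> 'a" where
  "monomial R c w = (\<lambda>v. if v = w then c else \<zero>\<^bsub>R\<^esub>)"

text \<open>Elements are finitely supported functions on \<^term>\<open>carrier M\<close>, extended by zero to the
  whole type; multiplication is convolution.\<close>

definition monoid_ring ::
  "('a, 'b) ring_scheme \<Rightarrow> ('w, 'c) monoid_scheme \<Rightarrow> ('w \<Rightarrow> 'a) ring" where
  "monoid_ring R M = \<lparr>
     carrier = {f. (\<forall>w. f w \<in> carrier R) \<and> finite {w. f w \<noteq> \<zero>\<^bsub>R\<^esub>} \<and> {w. f w \<noteq> \<zero>\<^bsub>R\<^esub>} \<subseteq> carrier M},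
     monoid.mult = (\<lambda>f g w. finsum R (\<lambda>(u, v). f u \<otimes>\<^bsub>R\<^esub> g v)
        {(u, v). f u \<noteq> \<zero>\<^bsub>R\<^esub> \<and> g v \<noteq> \<zero>\<^bsub>R\<^esub> \<and> u \<otimes>\<^bsub>M\<^esub> v = w}),
     monoid.one = monomial R \<one>\<^bsub>R\<^esub> \<one>\<^bsub>M\<^esub>,
     ring.zero = (\<lambda>w. \<zero>\<^bsub>R\<^esub>),
     ring.add = (\<lambda>f g w. f w \<oplus>\<^bsub>R\<^esub> g w)\<rparr>"

definition free_monoid :: "'x set \<Rightarrow> 'x list monoid" where
  "free_monoid S = \<lparr>carrier = lists S, monoid.mult = (@), one = []\<rparr>"

definition free_algebra :: "('a, 'b) ring_scheme \<Rightarrow> 'x set \<Rightarrow> ('x list \<Rightarrow> 'a) ring" where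
  "free_algebra R S = monoid_ring R (free_monoid S)"

definition laurent_ring :: "('a, 'b) ring_scheme \<Rightarrow> nat \<Rightarrow> ((nat \<Rightarrow>\<^sub>0 int) \<Rightarrow> 'a) ring" where
  "laurent_ring R r = monoid_ring R (free_Abelian_group {..<r})"

text \<open>An algebraic extension of an infinite field has the same cardinality as that field. Hence,
  for infinite \<open>K\<close>, quantifying over extensions \<open>L\<close> whose elements have the same type as
  those of \<open>K\<close> covers every algebraic extension up to isomorphism: the embedding \<open>\<iota>\<close> is
  not required to be an inclusion.\<close>

definition algebraic_field_extension ::
  "('a, 'b) ring_scheme \<Rightarrow> ('l, 'c) ring_scheme \<Rightarrow> ('a \<Rightarrow> 'l) \<Rightarrow> bool" where
  "algebraic_field_extension K L \<iota> \<longleftrightarrow> field K \<and> field L \<and> \<iota> \<in> ring_hom K L \<and>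
     (\<forall>x\<in>carrier L. (ring.algebraic L over (\<iota> ` carrier K)) x)"


section \<open>Quantum matrices\<close>

definition qmat_free :: "('a, 'b) ring_scheme \<Rightarrow> nat \<Rightarrow> nat \<Rightarrow> ((nat \<times> nat) list \<Rightarrow> 'a) ring" where
  "qmat_free K m n = free_algebra K ({1..m} \<times> {1..n})"

text \<open>The defining relations, each written as left-hand side minus right-hand side. The elements
  \<open>s c\<close> are the scalars of the free algebra.\<close>

definition qmat_relators ::
  "('a, 'b) ring_scheme \<Rightarrow> 'a \<Rightarrow> nat \<Rightarrow> nat \<Rightarrow> ((nat \<times> nat) list \<Rightarrow> 'a) set" where
  "qmat_relators K q m n =
    (let F = qmat_free K m n;
         x = (\<lambda>i j. monomial K \<one>\<^bsub>K\<^esub> [(i, j)]);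
         s = (\<lambda>c. monomial K c [])
     in {x i j \<otimes>\<^bsub>F\<^esub> x l j \<ominus>\<^bsub>F\<^esub> s q \<otimes>\<^bsub>F\<^esub> x l j \<otimes>\<^bsub>F\<^esub> x i j | i l j.
           1 \<le> i \<and> i < l \<and> l \<le> m \<and> 1 \<le> j \<and> j \<le> n}
      \<union> {x i j \<otimes>\<^bsub>F\<^esub> x i t \<ominus>\<^bsub>F\<^esub> s q \<otimes>\<^bsub>F\<^esub> x i t \<otimes>\<^bsub>F\<^esub> x i j | i j t.
           1 \<le> i \<and> i \<le> m \<and> 1 \<le> j \<and> j < t \<and> t \<le> n}
      \<union> {x i t \<otimes>\<^bsub>F\<^esub> x l j \<ominus>\<^bsub>F\<^esub> x l j \<otimes>\<^bsub>F\<^esub> x i t | i l j t.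
           1 \<le> i \<and> i < l \<and> l \<le> m \<and> 1 \<le> j \<and> j < t \<and> t \<le> n}
      \<union> {(x i j \<otimes>\<^bsub>F\<^esub> x l t \<ominus>\<^bsub>F\<^esub> x l t \<otimes>\<^bsub>F\<^esub> x i j)
           \<ominus>\<^bsub>F\<^esub> s (q \<ominus>\<^bsub>K\<^esub> inv\<^bsub>K\<^esub> q) \<otimes>\<^bsub>F\<^esub> x i t \<otimes>\<^bsub>F\<^esub> x l j | i l j t.
           1 \<le> i \<and> i < l \<and> l \<le> m \<and> 1 \<le> j \<and> j < t \<and> t \<le> n})"

definition qmat_rel_ideal ::
  "('a, 'b) ring_scheme \<Rightarrow> 'a \<Rightarrow> nat \<Rightarrow> nat \<Rightarrow> ((nat \<times> nat) list \<Rightarrow> 'a) set" where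
  "qmat_rel_ideal K q m n = Idl\<^bsub>qmat_free K m n\<^esub> (qmat_relators K q m n)"

definition qmat ::
  "('a, 'b) ring_scheme \<Rightarrow> 'a \<Rightarrow> nat \<Rightarrow> nat \<Rightarrow> ((nat \<times> nat) list \<Rightarrow> 'a) set ring" where
  "qmat K q m n = qmat_free K m n Quot qmat_rel_ideal K q m n"

definition qmat_gen ::
  "('a, 'b) ring_scheme \<Rightarrow> 'a \<Rightarrow> nat \<Rightarrow> nat \<Rightarrow> nat \<Rightarrow> nat \<Rightarrow> ((nat \<times> nat) list \<Rightarrow> 'a) set" where
  "qmat_gen K q m n i j =
     qmat_rel_ideal K q m n +>\<^bsub>qmat_free K m n\<^esub> monomial K \<one>\<^bsub>K\<^esub> [(i, j)]"

definition qmat_scalar ::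
  "('a, 'b) ring_scheme \<Rightarrow> 'a \<Rightarrow> nat \<Rightarrow> nat \<Rightarrow> 'a \<Rightarrow> ((nat \<times> nat) list \<Rightarrow> 'a) set" where
  "qmat_scalar K q m n c = qmat_rel_ideal K q m n +>\<^bsub>qmat_free K m n\<^esub> monomial K c []"

definition quantum_minors ::
  "('a, 'b) ring_scheme \<Rightarrow> 'a \<Rightarrow> nat \<Rightarrow> nat \<Rightarrow> ((nat \<times> nat) list \<Rightarrow> 'a) set set" where
  "quantum_minors K q m n =
    (let A = qmat K q m n; x = qmat_gen K q m n; s = qmat_scalar K q m n
     in {x i j \<otimes>\<^bsub>A\<^esub> x l t \<ominus>\<^bsub>A\<^esub> s q \<otimes>\<^bsub>A\<^esub> x i t \<otimes>\<^bsub>A\<^esub> x l j | i l j t.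
           1 \<le> i \<and> i < l \<and> l \<le> m \<and> 1 \<le> j \<and> j < t \<and> t \<le> n})"

definition qmat_mod_minors ::
  "('a, 'b) ring_scheme \<Rightarrow> 'a \<Rightarrow> nat \<Rightarrow> nat \<Rightarrow> ((nat \<times> nat) list \<Rightarrow> 'a) set set ring" where
  "qmat_mod_minors K q m n =
     qmat K q m n Quot (Idl\<^bsub>qmat K q m n\<^esub> (quantum_minors K q m n))"


section \<open>The torus action\<close>

definition torus ::
  "('a, 'b) ring_scheme \<Rightarrow> nat \<Rightarrow> nat \<Rightarrow> ((nat \<Rightarrow> 'a) \<times> (nat \<Rightarrow> 'a)) monoid" where
  "torus K m n =
     product_group {1..m} (\<lambda>_. units_of K) \<times>\<times> product_group {1..n} (\<lambda>_. units_of K)"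

text \<open>The automorphism of the free algebra with
  \<open>X\<^sub>i\<^sub>j \<mapsto> \<alpha>\<^sub>i \<beta>\<^sub>j X\<^sub>i\<^sub>j\<close> multiplies the coefficient of a word by the
  product of the \<open>\<alpha>\<^sub>i \<beta>\<^sub>j\<close> over its letters.  Off the support nothing is multiplied, because
  \<open>\<alpha>\<close> and \<open>\<beta>\<close> are arbitrary outside their index sets.\<close>

definition torus_act_free ::
  "('a, 'b) ring_scheme \<Rightarrow> (nat \<Rightarrow> 'a) \<times> (nat \<Rightarrow> 'a)
     \<Rightarrow> ((nat \<times> nat) list \<Rightarrow> 'a) \<Rightarrow> ((nat \<times> nat) list \<Rightarrow> 'a)" where
  "torus_act_free K h f = (\<lambda>w. if f w = \<zero>\<^bsub>K\<^esub> then \<zero>\<^bsub>K\<^esub>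
     else foldr (\<lambda>(i, j) c. fst h i \<otimes>\<^bsub>K\<^esub> snd h j \<otimes>\<^bsub>K\<^esub> c) w \<one>\<^bsub>K\<^esub> \<otimes>\<^bsub>K\<^esub> f w)"

text \<open>An automorphism preserving an ideal acts on the cosets of that ideal by direct image; here
  this is done twice, for the relations and then for the minors.\<close>

definition torus_act ::
  "('a, 'b) ring_scheme \<Rightarrow> (nat \<Rightarrow> 'a) \<times> (nat \<Rightarrow> 'a)
     \<Rightarrow> ((nat \<times> nat) list \<Rightarrow> 'a) set set \<Rightarrow> ((nat \<times> nat) list \<Rightarrow> 'a) set set" where
  "torus_act K h = image (image (torus_act_free K h))"

end

theory Submission
  imports Defs
begin

text \<open>Sending \<open>X\<^sub>i\<^sub>j\<close> to \<open>y\<^sub>i z\<^sub>j\<close>, where the \<open>y\<^sub>i\<close> and the \<open>z\<^sub>j\<close> generate two commuting quantum affine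
  spaces, identifies the quotient with the monoid algebra of \<open>S = {(a, b) \<in> \<nat>\<^sup>m \<times> \<nat>\<^sup>n. |a| = |b|}\<close>
  twisted by a bicharacter, with basis \<open>u\<^sub>s\<close>: modulo the relations and the minors, two words with the
  same row and column degrees differ by a power of \<open>q\<close>.  As \<open>k\<close> is infinite, the torus separates the
  elements of \<open>S\<close>, so invariant ideals are spanned by monomials and the \<open>H\<close>-primes are the
  complements of the faces of \<open>S\<close>; their quotients are domains because \<open>S\<close> embeds in an ordered
  group.  A nonzero face is given by nonempty sets of rows and columns.

  Let \<open>F\<close> be a face, \<open>G = F - F\<close>, and let \<open>Z \<subseteq> G\<close> consist of the degrees of the central monomials of
  the twisted group algebra of \<open>G\<close>.  Commutation with monomials separates the cosets of \<open>Z\<close>, so the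
  primes of the stratum of \<open>F\<close> correspond to the primes of the group algebra of the free abelian group
  \<open>Z\<close>, a Laurent polynomial ring over \<open>k\<close> itself.\<close>

text \<open>The parameter \<open>q\<close> may be a root of unity, so commutation cannot be read off
  the integer form \<open>\<beta>\<close>: comparisons are made after applying
  \<open>\<chi>\<close>, and the lattice \<open>Z\<close> depends on the order of \<open>q\<close>.
  On \<open>Z\<close> the cocycle is symmetric after \<open>\<chi>\<close> but in general not
  trivial, so the monomials with degree in \<open>Z\<close> need not multiply like Laurent
  monomials. As \<open>Z\<close> is free, they can be rescaled by powers of \<open>q\<close> until
  they do; the exponents form the function \<open>\<delta>\<close>. This is why no extension of the
  base field arises. The localization of the face quotient at the monomials of \<open>F\<close> is
  never built: \<open>coef\<close> reads Laurent coefficients directly off an element of the monoid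
  algebra, and denominators are cleared by shifting by a degree of \<open>F\<close>. For the
  quotient by the minors no basis is constructed in advance. Proportionality of words of equal
  degree bounds the quotient from above, and the homomorphism onto the twisted algebra, where
  distinct degrees are independent, bounds it from below.\<close>

section \<open>Ideals and primes tested on elements\<close>

lemma (in ring) ideal_prod_subset_iff:
  assumes "ideal P R"
  shows "ideal_prod R I J \<subseteq> P \<longleftrightarrow> (\<forall>i\<in>I. \<forall>j\<in>J. i \<otimes> j \<in> P)"
proof
  show "\<forall>i\<in>I. \<forall>j\<in>J. i \<otimes> j \<in> P" if "ideal_prod R I J \<subseteq> P"
    using that by (meson ideal_prod.prod subsetD)
next
  assume prod: "\<forall>i\<in>I. \<forall>j\<in>J. i \<otimes> j \<in> P"
  show "ideal_prod R I J \<subseteq> P"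
  proof
    fix s assume "s \<in> ideal_prod R I J"
    then show "s \<in> P"
      by induction (use prod assms in \<open>auto simp: additive_subgroup.a_closed ideal.axioms(1)\<close>)
  qed
qed

lemma ideal_subset_carrier: "ideal I R \<Longrightarrow> I \<subseteq> carrier R"
  by (meson additive_subgroup.a_subset ideal.axioms(1))

lemma (in ring) ideal_I:
  assumes "I \<subseteq> carrier R" "\<zero> \<in> I"
    and "\<And>a b. a \<in> I \<Longrightarrow> b \<in> I \<Longrightarrow> a \<oplus> b \<in> I"
    and "\<And>a. a \<in> I \<Longrightarrow> \<ominus> a \<in> I"
    and "\<And>a x. a \<in> I \<Longrightarrow> x \<in> carrier R \<Longrightarrow> x \<otimes> a \<in> I"
    and "\<And>a x. a \<in> I \<Longrightarrow> x \<in> carrier R \<Longrightarrow> a \<otimes> x \<in> I"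
  shows "ideal I R"
proof (rule idealI)
  show "subgroup I (add_monoid R)"
    by (rule add.subgroupI) (use assms in auto)
qed (use assms ring_axioms in auto)

lemma (in ring) ideal_a_inv_closed: "ideal I R \<Longrightarrow> a \<in> I \<Longrightarrow> \<ominus> a \<in> I"
  by (simp add: additive_subgroup.a_inv_closed ideal.axioms(1))

lemma (in ring) ideal_a_closed: "ideal I R \<Longrightarrow> a \<in> I \<Longrightarrow> b \<in> I \<Longrightarrow> a \<oplus> b \<in> I"
  by (simp add: additive_subgroup.a_closed ideal.axioms(1))

text \<open>Instead of the principal ideals of \<open>a\<close> and \<open>b\<close>, whose elements
  are sums, the forward direction uses two annihilators: \<open>I\<close> consists of all
  \<open>x\<close> with \<open>x R b\<close> inside \<open>P\<close>, and \<open>J\<close> of all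
  \<open>y\<close> with \<open>I R y\<close> inside \<open>P\<close>. They contain \<open>a\<close>
  and \<open>b\<close>, and their product lies in \<open>P\<close> by taking the middle factor
  \<open>\<one>\<close>.\<close>

lemma (in ring) prime_ideal_iff_elements:
  "prime_ideal R P \<longleftrightarrow> ideal P R \<and> P \<noteq> carrier R \<and>
     (\<forall>a\<in>carrier R. \<forall>b\<in>carrier R. (\<forall>t\<in>carrier R. a \<otimes> t \<otimes> b \<in> P) \<longrightarrow> a \<in> P \<or> b \<in> P)"
    (is "_ \<longleftrightarrow> _ \<and> _ \<and> ?E")
proof (intro iffI conjI)
  assume "prime_ideal R P"
  then have P: "ideal P R" "P \<noteq> carrier R"
    and prime: "\<And>I J. ideal I R \<Longrightarrow> ideal J R \<Longrightarrow> (\<forall>i\<in>I. \<forall>j\<in>J. i \<otimes> j \<in> P) \<Longrightarrow> I \<subseteq> P \<or> J \<subseteq> P"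
    by (auto simp: prime_ideal_def ideal_prod_subset_iff)
  show "ideal P R" "P \<noteq> carrier R" by fact+
  interpret P: ideal P R by fact
  show ?E
  proof (intro ballI impI)
    fix a b assume a: "a \<in> carrier R" and b: "b \<in> carrier R" and ab: "\<forall>t\<in>carrier R. a \<otimes> t \<otimes> b \<in> P"
    define I where "I = {x \<in> carrier R. \<forall>t\<in>carrier R. x \<otimes> t \<otimes> b \<in> P}"
    define J where "J = {y \<in> carrier R. \<forall>x\<in>I. \<forall>t\<in>carrier R. x \<otimes> t \<otimes> y \<in> P}"
    have IR: "x \<in> carrier R" if "x \<in> I" for x using that by (simp add: I_def)
    have I: "ideal I R"
    proof (rule ideal_I)
      fix x y assume "x \<in> I" "y \<in> I" then show "x \<oplus> y \<in> I"
        using b by (simp add: I_def l_distr)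
    next
      fix x assume "x \<in> I" then show "\<ominus> x \<in> I"
        using b by (simp add: I_def l_minus)
    next
      fix x y assume "x \<in> I" "y \<in> carrier R" then show "y \<otimes> x \<in> I"
        using b P.I_l_closed by (simp add: I_def) (metis m_assoc m_closed)
    next
      fix x y assume x: "x \<in> I" "y \<in> carrier R"
      have "x \<otimes> y \<otimes> t \<otimes> b \<in> P" if "t \<in> carrier R" for t
      proof -
        have "x \<otimes> (y \<otimes> t) \<otimes> b \<in> P" using that x by (auto simp: I_def)
        then show ?thesis using that x b by (simp add: m_assoc I_def)
      qed
      then show "x \<otimes> y \<in> I" using x by (auto simp: I_def)
    qed (use b in \<open>auto simp: I_def\<close>)
    have J: "ideal J R"
    proof (rule ideal_I)
      fix x y assume "x \<in> J" "y \<in> J" then show "x \<oplus> y \<in> J"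
        by (simp add: J_def r_distr IR)
    next
      fix x assume "x \<in> J" then show "\<ominus> x \<in> J"
        by (simp add: J_def r_minus IR)
    next
      fix x y assume x: "x \<in> J" "y \<in> carrier R"
      have "z \<otimes> t \<otimes> (y \<otimes> x) \<in> P" if "t \<in> carrier R" "z \<in> I" for t z
      proof -
        have "z \<otimes> (t \<otimes> y) \<otimes> x \<in> P" using that x by (auto simp: J_def)
        moreover have "x \<in> carrier R" using x by (simp add: J_def)
        ultimately show ?thesis using that x(2) IR by (simp add: m_assoc)
      qed
      then show "y \<otimes> x \<in> J" using x by (auto simp: J_def)
    next
      fix x y assume x: "x \<in> J" "y \<in> carrier R"
      have "z \<otimes> t \<otimes> (x \<otimes> y) \<in> P" if "t \<in> carrier R" "z \<in> I" for t z
      proof -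
        have "z \<otimes> t \<otimes> x \<otimes> y \<in> P" using that x by (auto simp: J_def P.I_r_closed)
        moreover have "x \<in> carrier R" using x by (simp add: J_def)
        ultimately show ?thesis using that x(2) IR by (simp add: m_assoc)
      qed
      then show "x \<otimes> y \<in> J" using x by (auto simp: J_def)
    qed (auto simp: J_def IR)
    have "\<forall>i\<in>I. \<forall>j\<in>J. i \<otimes> j \<in> P"
    proof (intro ballI)
      fix i j assume "i \<in> I" "j \<in> J"
      then have "i \<otimes> \<one> \<otimes> j \<in> P" unfolding J_def by blast
      then show "i \<otimes> j \<in> P" using IR[OF \<open>i \<in> I\<close>] by simp
    qed
    then have "I \<subseteq> P \<or> J \<subseteq> P" by (rule prime[OF I J])
    moreover have "a \<in> I" using a ab by (simp add: I_def)
    moreover have "b \<in> J" using b by (simp add: J_def I_def)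
    ultimately show "a \<in> P \<or> b \<in> P" by blast
  qed
next
  assume asm: "ideal P R \<and> P \<noteq> carrier R \<and> ?E"
  have "I \<subseteq> P \<or> J \<subseteq> P" if I: "ideal I R" and J: "ideal J R" and IJ: "\<forall>i\<in>I. \<forall>j\<in>J. i \<otimes> j \<in> P" for I J
  proof (rule ccontr)
    assume "\<not> ?thesis"
    then obtain i j where ij: "i \<in> I" "i \<notin> P" "j \<in> J" "j \<notin> P" by blast
    then have "i \<in> carrier R" "j \<in> carrier R" using ideal_subset_carrier I J by blast+
    moreover have "i \<otimes> t \<otimes> j \<in> P" if "t \<in> carrier R" for t
      using that ij I IJ by (simp add: ideal.I_r_closed)
    ultimately show False using asm ij by blast
  qed
  then show "prime_ideal R P" using asm by (auto simp: prime_ideal_def ideal_prod_subset_iff)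
qed

lemma (in ring) completely_prime_iff_elements:
  "completely_prime R P \<longleftrightarrow> ideal P R \<and> \<one> \<notin> P \<and>
     (\<forall>a\<in>carrier R. \<forall>b\<in>carrier R. a \<otimes> b \<in> P \<longrightarrow> a \<in> P \<or> b \<in> P)"
proof (cases "ideal P R")
  case True
  interpret P: ideal P R by fact
  have coset: "P +> a = P \<longleftrightarrow> a \<in> P" if "a \<in> carrier R" for a
    using that P.rcos_const_imp_mem P.a_rcos_const by blast
  have carrier: "carrier (R Quot P) = (+>) P ` carrier R"
    by (auto simp: FactRing_def A_RCOSETS_def')
  have "\<zero>\<^bsub>R Quot P\<^esub> = P" "\<one>\<^bsub>R Quot P\<^esub> = P +> \<one>"
    and "\<And>a b. a \<in> carrier R \<Longrightarrow> b \<in> carrier R \<Longrightarrow> (P +> a) \<otimes>\<^bsub>R Quot P\<^esub> (P +> b) = P +> (a \<otimes> b)"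
    by (auto simp: FactRing_def P.rcoset_mult_add)
  with True show ?thesis unfolding completely_prime_def carrier by (auto simp: coset)
qed (simp add: completely_prime_def)

lemma (in ring) H_prime_iff_elements:
  "H_prime H \<phi> R P \<longleftrightarrow> ideal P R \<and> P \<noteq> carrier R \<and> H_invariant H \<phi> P \<and>
     (\<forall>I J. ideal I R \<and> H_invariant H \<phi> I \<and> ideal J R \<and> H_invariant H \<phi> J \<and>
        (\<forall>i\<in>I. \<forall>j\<in>J. i \<otimes> j \<in> P) \<longrightarrow> I \<subseteq> P \<or> J \<subseteq> P)"
  unfolding H_prime_def using ideal_prod_subset_iff by blast

section \<open>The Zariski topology on subsets of a spectrum\<close>

lemma topspace_zariski:
  assumes "ring R"
  shows "topspace (zariski R) = Spec R"
proof
  show "topspace (zariski R) \<subseteq> Spec R"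
    using openin_topspace[of "zariski R"] unfolding openin_zariski[OF assms] by blast
  have "Spec R = Spec R - {P \<in> Spec R. carrier R \<subseteq> P}"
    unfolding Spec_def prime_ideal_def using ideal_subset_carrier by fast
  then have "openin (zariski R) (Spec R)"
    unfolding openin_zariski[OF assms] using ring.oneideal[OF assms] by blast
  then show "Spec R \<subseteq> topspace (zariski R)" by (rule openin_subset)
qed

lemma openin_subtopology_zariski:
  assumes "ring R" "Z \<subseteq> Spec R"
  shows "openin (subtopology (zariski R) Z) U \<longleftrightarrow> (\<exists>I. ideal I R \<and> U = {P \<in> Z. \<not> I \<subseteq> P})"
proof -
  have "(Spec R - {P \<in> Spec R. I \<subseteq> P}) \<inter> Z = {P \<in> Z. \<not> I \<subseteq> P}" for I
    using assms(2) by blast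
  then show ?thesis unfolding openin_subtopology openin_zariski[OF assms(1)] by auto
qed

text \<open>Closed sets of a subspace of a spectrum are the sets of its primes that contain a given
  ideal. Hence \<open>down\<close> says that preimages of closed sets under \<open>c\<close> are
  closed, and \<open>up\<close> that images are. The ideals \<open>I\<close> and \<open>J\<close>
  are compared only on the points of \<open>Y\<close>, so each may be any convenient ideal with the
  right closed set.\<close>

lemma homeomorphic_space_zariski:
  assumes "ring R" "ring L" "Z \<subseteq> Spec R" "Y \<subseteq> Spec L" and c: "bij_betw c Y Z"
    and down: "\<And>I. ideal I R \<Longrightarrow> \<exists>J. ideal J L \<and> (\<forall>Q\<in>Y. I \<subseteq> c Q \<longleftrightarrow> J \<subseteq> Q)"
    and up: "\<And>J. ideal J L \<Longrightarrow> \<exists>I. ideal I R \<and> (\<forall>Q\<in>Y. I \<subseteq> c Q \<longleftrightarrow> J \<subseteq> Q)"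
  shows "subtopology (zariski R) Z homeomorphic_space subtopology (zariski L) Y"
proof -
  let ?R = "subtopology (zariski R) Z" and ?L = "subtopology (zariski L) Y"
  have inj: "inj_on c Y" and cY: "c ` Y = Z" using c by (auto simp: bij_betw_def)
  have top: "topspace ?R = Z" "topspace ?L = Y"
    using assms(3,4) by (auto simp: topspace_zariski[OF assms(1)] topspace_zariski[OF assms(2)])
  have "homeomorphic_map ?L ?R c"
  proof (rule bijective_open_imp_homeomorphic_map)
    show "continuous_map ?L ?R c"
      unfolding continuous_map_def top
    proof (intro conjI allI impI)
      fix U assume "openin ?R U"
      then obtain I where I: "ideal I R" "U = {P \<in> Z. \<not> I \<subseteq> P}"
        unfolding openin_subtopology_zariski[OF assms(1,3)] by blast
      obtain J where J: "ideal J L" "\<forall>Q\<in>Y. I \<subseteq> c Q \<longleftrightarrow> J \<subseteq> Q" using down[OF I(1)] by blast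
      have "{x \<in> Y. c x \<in> U} = {Q \<in> Y. \<not> J \<subseteq> Q}" using J(2) cY unfolding I(2) by blast
      then show "openin ?L {x \<in> Y. c x \<in> U}"
        unfolding openin_subtopology_zariski[OF assms(2,4)] using J(1) by blast
    qed (use cY in auto)
  next
    show "open_map ?L ?R c" unfolding open_map_def
    proof (intro allI impI)
      fix U assume "openin ?L U"
      then obtain J where J: "ideal J L" "U = {P \<in> Y. \<not> J \<subseteq> P}"
        unfolding openin_subtopology_zariski[OF assms(2,4)] by blast
      obtain I where I: "ideal I R" "\<forall>Q\<in>Y. I \<subseteq> c Q \<longleftrightarrow> J \<subseteq> Q" using up[OF J(1)] by blast
      have "c ` U = {P \<in> Z. \<not> I \<subseteq> P}" using I(2) cY unfolding J(2) by blast
      then show "openin ?R (c ` U)"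
        unfolding openin_subtopology_zariski[OF assms(1,3)] using I(1) by blast
    qed
  qed (use cY inj top in auto)
  then show ?thesis using homeomorphic_map_imp_homeomorphic_space homeomorphic_space_sym by blast
qed

subsection \<open>Transport along equivariant ring isomorphisms\<close>

text \<open>The map \<open>\<phi> h\<close> is an arbitrary function on the type, so preservation of
  the carrier is an assumption of its own. For \<open>\<psi> h\<close> it follows from equivariance,
  because \<open>\<Phi>\<close> is onto.\<close>

locale equivariant_ring_iso = R: ring R + S: ring S
  for R :: "('a, 'r) ring_scheme" and S :: "('c, 's) ring_scheme" +
  fixes \<Phi> :: "'a \<Rightarrow> 'c" and H :: "('h, 'm) monoid_scheme" and \<phi> \<psi>
  assumes iso: "\<Phi> \<in> ring_iso R S"
    and closed: "h \<in> carrier H \<Longrightarrow> x \<in> carrier R \<Longrightarrow> \<phi> h x \<in> carrier R"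
    and equivariant: "h \<in> carrier H \<Longrightarrow> x \<in> carrier R \<Longrightarrow> \<Phi> (\<phi> h x) = \<psi> h (\<Phi> x)"
begin

lemma hom: "ring_hom_ring R S \<Phi>"
  using iso by (intro ring_hom_ringI2) (auto simp: ring_iso_def R.ring_axioms S.ring_axioms)

lemma bij: "bij_betw \<Phi> (carrier R) (carrier S)"
  using iso by (simp add: ring_iso_def)

lemma inj: "inj_on \<Phi> (carrier R)"
  using bij by (simp add: bij_betw_def)

lemma vimage_image: "I \<subseteq> carrier R \<Longrightarrow> {r \<in> carrier R. \<Phi> r \<in> \<Phi> ` I} = I"
  using inj by (auto dest: inj_onD)

lemma mem_image_iff: "I \<subseteq> carrier R \<Longrightarrow> x \<in> carrier R \<Longrightarrow> \<Phi> x \<in> \<Phi> ` I \<longleftrightarrow> x \<in> I"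
  using inj by (auto dest: inj_onD)

lemma image_subset_iff':
  "I \<subseteq> carrier R \<Longrightarrow> J \<subseteq> carrier R \<Longrightarrow> \<Phi> ` I \<subseteq> \<Phi> ` J \<longleftrightarrow> I \<subseteq> J"
  using mem_image_iff by blast

lemma image_eq_iff:
  "I \<subseteq> carrier R \<Longrightarrow> J \<subseteq> carrier R \<Longrightarrow> \<Phi> ` I = \<Phi> ` J \<longleftrightarrow> I = J"
  using inj inj_on_image_eq_iff by blast

lemma image_carrier: "\<Phi> ` carrier R = carrier S"
  using bij by (simp add: bij_betw_def)

lemma ideal_image_iff:
  assumes "I \<subseteq> carrier R"
  shows "ideal (\<Phi> ` I) S \<longleftrightarrow> ideal I R"
proof
  assume "ideal (\<Phi> ` I) S"
  then show "ideal I R" using ring_hom_ring.ideal_vimage[OF hom] vimage_image[OF assms] by fastforce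
next
  assume "ideal I R"
  interpret h: ring_hom_ring R S \<Phi> by (rule hom)
  interpret I: ideal I R by fact
  show "ideal (\<Phi> ` I) S"
  proof (rule idealI)
    show "subgroup (\<Phi> ` I) (add_monoid S)"
      by (rule h.img_is_add_subgroup) (rule I.a_subgroup)
    fix a x assume "a \<in> \<Phi> ` I" "x \<in> carrier S"
    then obtain b y where "b \<in> I" "a = \<Phi> b" "y \<in> carrier R" "x = \<Phi> y"
      using image_carrier by blast
    then show "x \<otimes>\<^bsub>S\<^esub> a \<in> \<Phi> ` I" "a \<otimes>\<^bsub>S\<^esub> x \<in> \<Phi> ` I"
      using I.I_l_closed I.I_r_closed by (auto simp flip: h.hom_mult)
  qed (rule S.ring_axioms)
qed

lemma ideal_obtain:
  assumes "ideal J S"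
  obtains I where "ideal I R" "J = \<Phi> ` I"
proof
  show "ideal {r \<in> carrier R. \<Phi> r \<in> J} R" using ring_hom_ring.ideal_vimage[OF hom assms] .
  show "J = \<Phi> ` {r \<in> carrier R. \<Phi> r \<in> J}"
    using subsetD[OF ideal_subset_carrier[OF assms]] by (auto simp flip: image_carrier)
qed

lemma mult_mem_image_iff:
  assumes "P \<subseteq> carrier R" "a \<in> carrier R" "b \<in> carrier R"
  shows "\<Phi> a \<otimes>\<^bsub>S\<^esub> \<Phi> b \<in> \<Phi> ` P \<longleftrightarrow> a \<otimes>\<^bsub>R\<^esub> b \<in> P"
proof -
  interpret h: ring_hom_ring R S \<Phi> by (rule hom)
  show ?thesis using assms by (simp add: mem_image_iff flip: h.hom_mult)
qed

lemma image_act: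
  assumes "I \<subseteq> carrier R" "h \<in> carrier H"
  shows "\<psi> h ` \<Phi> ` I = \<Phi> ` \<phi> h ` I"
  unfolding image_image by (rule image_cong) (use assms equivariant in auto)

lemma act_subset: "I \<subseteq> carrier R \<Longrightarrow> h \<in> carrier H \<Longrightarrow> \<phi> h ` I \<subseteq> carrier R"
  using closed by blast

lemma H_invariant_image_iff:
  assumes "I \<subseteq> carrier R"
  shows "H_invariant H \<psi> (\<Phi> ` I) \<longleftrightarrow> H_invariant H \<phi> I"
  unfolding H_invariant_def using assms by (simp add: image_act act_subset image_eq_iff)

lemma prime_ideal_image_iff:
  assumes "P \<subseteq> carrier R"
  shows "prime_ideal S (\<Phi> ` P) \<longleftrightarrow> prime_ideal R P"
proof -
  interpret h: ring_hom_ring R S \<Phi> by (rule hom)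
  have "\<Phi> ` P \<noteq> carrier S \<longleftrightarrow> P \<noteq> carrier R"
    using image_eq_iff[OF assms] by (simp flip: image_carrier)
  moreover have "\<Phi> a \<otimes>\<^bsub>S\<^esub> \<Phi> t \<otimes>\<^bsub>S\<^esub> \<Phi> b \<in> \<Phi> ` P \<longleftrightarrow> a \<otimes>\<^bsub>R\<^esub> t \<otimes>\<^bsub>R\<^esub> b \<in> P"
    if "a \<in> carrier R" "b \<in> carrier R" "t \<in> carrier R" for a b t
    using that assms by (simp add: mem_image_iff flip: h.hom_mult)
  ultimately show ?thesis
    unfolding R.prime_ideal_iff_elements S.prime_ideal_iff_elements
    by (simp add: ideal_image_iff[OF assms] mem_image_iff[OF assms] flip: image_carrier)
qed

lemma completely_prime_image_iff:
  assumes "P \<subseteq> carrier R"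
  shows "completely_prime S (\<Phi> ` P) \<longleftrightarrow> completely_prime R P"
proof -
  interpret h: ring_hom_ring R S \<Phi> by (rule hom)
  have "\<one>\<^bsub>S\<^esub> \<in> \<Phi> ` P \<longleftrightarrow> \<one>\<^bsub>R\<^esub> \<in> P"
    using mem_image_iff[OF assms, of "\<one>\<^bsub>R\<^esub>"] by simp
  then show ?thesis
    unfolding R.completely_prime_iff_elements S.completely_prime_iff_elements
    by (simp add: ideal_image_iff[OF assms] mult_mem_image_iff[OF assms] mem_image_iff[OF assms]
      flip: image_carrier)
qed

text \<open>Each ideal of \<open>S\<close> is the image of an ideal of \<open>R\<close>, and
  invariance, inclusion and products correspond under \<open>\<Phi>\<close>. So the quantifiers over
  pairs of ideals on the two sides range over matching pairs.\<close>

lemma H_prime_image_iff: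
  assumes "P \<subseteq> carrier R"
  shows "H_prime H \<psi> S (\<Phi> ` P) \<longleftrightarrow> H_prime H \<phi> R P"
proof -
  have proper: "\<Phi> ` P \<noteq> carrier S \<longleftrightarrow> P \<noteq> carrier R"
    using image_eq_iff[OF assms] by (simp flip: image_carrier)
  have prod: "(\<forall>i\<in>\<Phi> ` I. \<forall>j\<in>\<Phi> ` J. i \<otimes>\<^bsub>S\<^esub> j \<in> \<Phi> ` P) \<longleftrightarrow> (\<forall>i\<in>I. \<forall>j\<in>J. i \<otimes>\<^bsub>R\<^esub> j \<in> P)"
    if "ideal I R" "ideal J R" for I J
    using that[THEN ideal_subset_carrier] mult_mem_image_iff[OF assms]
    by (simp add: subset_iff)
  have img: "ideal I R \<Longrightarrow> (ideal (\<Phi> ` I) S \<and> (H_invariant H \<psi> (\<Phi> ` I) \<longleftrightarrow> H_invariant H \<phi> I)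
     \<and> (\<Phi> ` I \<subseteq> \<Phi> ` P \<longleftrightarrow> I \<subseteq> P))" for I
    using ideal_subset_carrier[of I R] ideal_image_iff H_invariant_image_iff image_subset_iff' assms by auto
  have "(\<forall>I J. ideal I S \<and> H_invariant H \<psi> I \<and> ideal J S \<and> H_invariant H \<psi> J \<and>
        (\<forall>i\<in>I. \<forall>j\<in>J. i \<otimes>\<^bsub>S\<^esub> j \<in> \<Phi> ` P) \<longrightarrow> I \<subseteq> \<Phi> ` P \<or> J \<subseteq> \<Phi> ` P) \<longleftrightarrow>
    (\<forall>I J. ideal I R \<and> H_invariant H \<phi> I \<and> ideal J R \<and> H_invariant H \<phi> J \<and>
        (\<forall>i\<in>I. \<forall>j\<in>J. i \<otimes>\<^bsub>R\<^esub> j \<in> P) \<longrightarrow> I \<subseteq> P \<or> J \<subseteq> P)" (is "?A \<longleftrightarrow> ?B")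
  proof
    assume ?A
    show ?B
    proof (intro allI impI, elim conjE)
      fix I J assume *: "ideal I R" "H_invariant H \<phi> I" "ideal J R" "H_invariant H \<phi> J"
        "\<forall>i\<in>I. \<forall>j\<in>J. i \<otimes>\<^bsub>R\<^esub> j \<in> P"
      show "I \<subseteq> P \<or> J \<subseteq> P"
        using \<open>?A\<close>[rule_format, of "\<Phi> ` I" "\<Phi> ` J"] * img[of I] img[of J] prod[of I J] by blast
    qed
  next
    assume ?B
    show ?A
    proof (intro allI impI, elim conjE)
      fix I' J' assume *: "ideal I' S" "H_invariant H \<psi> I'" "ideal J' S" "H_invariant H \<psi> J'"
        "\<forall>i\<in>I'. \<forall>j\<in>J'. i \<otimes>\<^bsub>S\<^esub> j \<in> \<Phi> ` P"
      obtain I where I: "ideal I R" "I' = \<Phi> ` I" using ideal_obtain[OF *(1)] by metis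
      obtain J where J: "ideal J R" "J' = \<Phi> ` J" using ideal_obtain[OF *(3)] by metis
      show "I' \<subseteq> \<Phi> ` P \<or> J' \<subseteq> \<Phi> ` P"
        using \<open>?B\<close>[rule_format, of I J] *(2,4,5) img[of I] img[of J] prod[of I J] I(1) J(1)
        unfolding I(2) J(2) by blast
    qed
  qed
  then show ?thesis
    unfolding R.H_prime_iff_elements S.H_prime_iff_elements
    by (simp add: ideal_image_iff[OF assms] H_invariant_image_iff[OF assms] proper)
qed

lemma bij_betw_H_prime:
  "bij_betw ((`) \<Phi>) {P. H_prime H \<phi> R P} {P. H_prime H \<psi> S P}"
  unfolding bij_betw_def
proof
  show "inj_on ((`) \<Phi>) {P. H_prime H \<phi> R P}"
    by (rule inj_onI) (simp add: H_prime_def image_eq_iff ideal_subset_carrier)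
  show "(`) \<Phi> ` {P. H_prime H \<phi> R P} = {P. H_prime H \<psi> S P}"
  proof (intro equalityI subsetI)
    fix P' assume "P' \<in> {P. H_prime H \<psi> S P}"
    moreover from this obtain P where "ideal P R" "P' = \<Phi> ` P"
      using ideal_obtain[of P'] by (auto simp: H_prime_def)
    ultimately show "P' \<in> (`) \<Phi> ` {P. H_prime H \<phi> R P}"
      by (auto simp: H_prime_image_iff ideal_subset_carrier)
  qed (auto simp: H_prime_image_iff H_prime_def[of H \<phi> R] ideal_subset_carrier)
qed

text \<open>Images commute with the intersection over the group because \<open>\<Phi>\<close> is
  injective on the carrier and the index set is nonempty.\<close>

lemma H_stratum_image:
  assumes "J \<subseteq> carrier R" "carrier H \<noteq> {}"
  shows "(`) \<Phi> ` H_stratum H \<phi> R J = H_stratum H \<psi> S (\<Phi> ` J)"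
proof -
  have inter: "(\<Inter>h\<in>carrier H. \<psi> h ` \<Phi> ` P) = \<Phi> ` (\<Inter>h\<in>carrier H. \<phi> h ` P)" if "P \<subseteq> carrier R" for P
  proof -
    have "inj_on \<Phi> (\<Union>h\<in>carrier H. \<phi> h ` P)"
      by (rule inj_on_subset[OF inj]) (use that closed in blast)
    moreover obtain h where "h \<in> carrier H" using assms(2) by blast
    ultimately have "\<Phi> ` (\<Inter>h\<in>carrier H. \<phi> h ` P) = (\<Inter>h\<in>carrier H. \<Phi> ` \<phi> h ` P)"
      by (intro image_INT[of _ "\<Union>h\<in>carrier H. \<phi> h ` P" _ _ h]) auto
    then show ?thesis using that by (simp add: image_act)
  qed
  have sub: "(\<Inter>h\<in>carrier H. \<phi> h ` P) \<subseteq> carrier R" if "P \<subseteq> carrier R" for P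
  proof -
    obtain h where "h \<in> carrier H" using assms(2) by blast
    then show ?thesis using act_subset[OF that] by blast
  qed
  have iff: "\<Phi> ` P \<in> H_stratum H \<psi> S (\<Phi> ` J) \<longleftrightarrow> P \<in> H_stratum H \<phi> R J" if "P \<subseteq> carrier R" for P
    unfolding H_stratum_def Spec_def using that assms
    by (simp add: prime_ideal_image_iff inter image_eq_iff sub)
  have carr: "P \<in> H_stratum H \<phi> R J \<Longrightarrow> P \<subseteq> carrier R" for P
    by (simp add: H_stratum_def Spec_def prime_ideal_def ideal_subset_carrier)
  have surj: "\<exists>P. P \<subseteq> carrier R \<and> P' = \<Phi> ` P" if "P' \<in> H_stratum H \<psi> S (\<Phi> ` J)" for P'
  proof -
    have "ideal P' S" using that by (simp add: H_stratum_def Spec_def prime_ideal_def)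
    then obtain P where "ideal P R" "P' = \<Phi> ` P" by (rule ideal_obtain)
    then show ?thesis using ideal_subset_carrier by blast
  qed
  show ?thesis
  proof (intro equalityI subsetI)
    fix P' assume "P' \<in> (`) \<Phi> ` H_stratum H \<phi> R J"
    then obtain P where P: "P \<in> H_stratum H \<phi> R J" "P' = \<Phi> ` P" by (rule imageE)
    show "P' \<in> H_stratum H \<psi> S (\<Phi> ` J)"
      unfolding P(2) iff[OF carr[OF P(1)]] by (rule P(1))
  next
    fix P' assume P': "P' \<in> H_stratum H \<psi> S (\<Phi> ` J)"
    then obtain P where P: "P \<subseteq> carrier R" "P' = \<Phi> ` P" using surj by metis
    show "P' \<in> (`) \<Phi> ` H_stratum H \<phi> R J"
      using P' iff[OF P(1)] unfolding P(2) by (intro imageI) simp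
  qed
qed

lemma homeomorphic_space_zariski_image:
  assumes "Z \<subseteq> Spec R"
  shows "subtopology (zariski R) Z homeomorphic_space subtopology (zariski S) ((`) \<Phi> ` Z)"
proof -
  have Z: "P \<subseteq> carrier R" if "P \<in> Z" for P
    using that assms ideal_subset_carrier by (auto simp: Spec_def prime_ideal_def)
  have inj: "inj_on ((`) \<Phi>) Z" by (rule inj_onI) (simp add: Z image_eq_iff)
  have "subtopology (zariski S) ((`) \<Phi> ` Z) homeomorphic_space subtopology (zariski R) Z"
  proof (rule homeomorphic_space_zariski[where c = "(`) \<Phi>"])
    show "(`) \<Phi> ` Z \<subseteq> Spec S"
      using assms Z by (auto simp: Spec_def prime_ideal_image_iff)
    fix I assume "ideal I S"
    then obtain J where "ideal J R" "I = \<Phi> ` J" by (rule ideal_obtain)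
    then show "\<exists>J. ideal J R \<and> (\<forall>Q\<in>Z. I \<subseteq> \<Phi> ` Q \<longleftrightarrow> J \<subseteq> Q)"
      using Z image_subset_iff' ideal_subset_carrier by metis
  next
    fix J assume J: "ideal J R"
    then have "ideal (\<Phi> ` J) S" by (simp add: ideal_image_iff ideal_subset_carrier)
    then show "\<exists>I. ideal I S \<and> (\<forall>Q\<in>Z. I \<subseteq> \<Phi> ` Q \<longleftrightarrow> J \<subseteq> Q)"
      using Z image_subset_iff' ideal_subset_carrier[OF J] by metis
  qed (use assms inj R.ring_axioms S.ring_axioms in \<open>auto simp: bij_betw_def\<close>)
  then show ?thesis by (rule homeomorphic_space_sym[THEN iffD1])
qed

end

section \<open>Twisted monoid rings\<close>

text \<open>The twist \<open>p\<close> receives the coefficients along with the degrees, instead of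
  being a scalar factor. Thus the ordinary monoid ring is literally the instance in which
  \<open>p\<close> multiplies the coefficients, with no factor \<open>\<one>\<close> to remove, and
  free algebras, Laurent rings and twisted algebras share one development.\<close>

definition twisted_monoid_ring ::
  "('a, 'b) ring_scheme \<Rightarrow> ('w, 'c) monoid_scheme \<Rightarrow> ('w \<Rightarrow> 'w \<Rightarrow> 'a \<Rightarrow> 'a \<Rightarrow> 'a) \<Rightarrow> ('w \<Rightarrow> 'a) ring"
  where
  "twisted_monoid_ring R M p = \<lparr>
     carrier = {f. (\<forall>w. f w \<in> carrier R) \<and> finite {w. f w \<noteq> \<zero>\<^bsub>R\<^esub>} \<and> {w. f w \<noteq> \<zero>\<^bsub>R\<^esub>} \<subseteq> carrier M},
     monoid.mult = (\<lambda>f g w. finsum R (\<lambda>(u, v). p u v (f u) (g v))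
        {(u, v). f u \<noteq> \<zero>\<^bsub>R\<^esub> \<and> g v \<noteq> \<zero>\<^bsub>R\<^esub> \<and> u \<otimes>\<^bsub>M\<^esub> v = w}),
     monoid.one = monomial R \<one>\<^bsub>R\<^esub> \<one>\<^bsub>M\<^esub>,
     ring.zero = (\<lambda>w. \<zero>\<^bsub>R\<^esub>),
     ring.add = (\<lambda>f g w. f w \<oplus>\<^bsub>R\<^esub> g w)\<rparr>"

lemma monoid_ring_eq_twisted: "monoid_ring R M = twisted_monoid_ring R M (\<lambda>_ _ a b. a \<otimes>\<^bsub>R\<^esub> b)"
  by (simp add: monoid_ring_def twisted_monoid_ring_def)

text \<open>\<open>p_assoc\<close> is the 2-cocycle condition in the form it takes for a biadditive
  \<open>p\<close>, and the two unit laws normalize the cocycle at the identity of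
  \<open>M\<close>.\<close>

locale twisted_product = K: ring K + M: monoid M
  for K :: "('a, 'b) ring_scheme" (structure) and M :: "('w, 'c) monoid_scheme" +
  fixes p :: "'w \<Rightarrow> 'w \<Rightarrow> 'a \<Rightarrow> 'a \<Rightarrow> 'a"
  assumes p_closed [simp]:
      "u \<in> carrier M \<Longrightarrow> v \<in> carrier M \<Longrightarrow> a \<in> carrier K \<Longrightarrow> b \<in> carrier K \<Longrightarrow> p u v a b \<in> carrier K"
    and p_add_left: "u \<in> carrier M \<Longrightarrow> v \<in> carrier M \<Longrightarrow> a \<in> carrier K \<Longrightarrow> a' \<in> carrier K \<Longrightarrow> b \<in> carrier K
      \<Longrightarrow> p u v (a \<oplus> a') b = p u v a b \<oplus> p u v a' b"
    and p_add_right: "u \<in> carrier M \<Longrightarrow> v \<in> carrier M \<Longrightarrow> a \<in> carrier K \<Longrightarrow> b \<in> carrier K \<Longrightarrow> b' \<in> carrier K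
      \<Longrightarrow> p u v a (b \<oplus> b') = p u v a b \<oplus> p u v a b'"
    and p_assoc: "u \<in> carrier M \<Longrightarrow> v \<in> carrier M \<Longrightarrow> w \<in> carrier M
      \<Longrightarrow> a \<in> carrier K \<Longrightarrow> b \<in> carrier K \<Longrightarrow> c \<in> carrier K
      \<Longrightarrow> p (u \<otimes>\<^bsub>M\<^esub> v) w (p u v a b) c = p u (v \<otimes>\<^bsub>M\<^esub> w) a (p v w b c)"
    and p_one_left: "u \<in> carrier M \<Longrightarrow> a \<in> carrier K \<Longrightarrow> p \<one>\<^bsub>M\<^esub> u \<one> a = a"
    and p_one_right: "u \<in> carrier M \<Longrightarrow> a \<in> carrier K \<Longrightarrow> p u \<one>\<^bsub>M\<^esub> a \<one> = a"
begin

abbreviation "A \<equiv> twisted_monoid_ring K M p"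

abbreviation supp :: "('w \<Rightarrow> 'a) \<Rightarrow> 'w set" where "supp f \<equiv> {w. f w \<noteq> \<zero>}"

lemma p_zero_left [simp]:
  assumes "u \<in> carrier M" "v \<in> carrier M" "b \<in> carrier K" shows "p u v \<zero> b = \<zero>"
  using p_add_left[of u v \<zero> \<zero> b] p_closed[of u v \<zero> b] assms
  by (metis K.add.l_cancel_one' K.l_zero K.zero_closed)

lemma p_zero_right [simp]:
  assumes "u \<in> carrier M" "v \<in> carrier M" "a \<in> carrier K" shows "p u v a \<zero> = \<zero>"
  using p_add_right[of u v a \<zero> \<zero>] p_closed[of u v a \<zero>] assms
  by (metis K.add.l_cancel_one' K.l_zero K.zero_closed)

lemma in_carrier_iff: "f \<in> carrier A \<longleftrightarrow> (\<forall>w. f w \<in> carrier K) \<and> finite (supp f) \<and> supp f \<subseteq> carrier M"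
  by (simp add: twisted_monoid_ring_def)

lemma coeff_closed: "f \<in> carrier A \<Longrightarrow> f w \<in> carrier K"
  by (simp add: in_carrier_iff)

lemma finite_supp: "f \<in> carrier A \<Longrightarrow> finite (supp f)"
  by (simp add: in_carrier_iff)

lemma supp_subset: "f \<in> carrier A \<Longrightarrow> f w \<noteq> \<zero> \<Longrightarrow> w \<in> carrier M"
  by (auto simp: in_carrier_iff)

lemma carrierI:
  "(\<And>w. f w \<in> carrier K) \<Longrightarrow> finite S \<Longrightarrow> supp f \<subseteq> S \<Longrightarrow> S \<subseteq> carrier M \<Longrightarrow> f \<in> carrier A"
  by (auto simp: in_carrier_iff intro: finite_subset)

lemma add_eq: "f \<oplus>\<^bsub>A\<^esub> g = (\<lambda>w. f w \<oplus> g w)"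
  and zero_eq: "\<zero>\<^bsub>A\<^esub> = (\<lambda>w. \<zero>)"
  and one_eq: "\<one>\<^bsub>A\<^esub> = monomial K \<one> \<one>\<^bsub>M\<^esub>"
  by (simp_all add: twisted_monoid_ring_def)

lemma add_closed:
  assumes "f \<in> carrier A" "g \<in> carrier A" shows "f \<oplus>\<^bsub>A\<^esub> g \<in> carrier A"
  unfolding add_eq
  by (rule carrierI[where S = "supp f \<union> supp g"]) (use assms in \<open>auto simp: in_carrier_iff\<close>)

text \<open>The sets \<open>U\<close> and \<open>V\<close> may exceed the supports, so that several
  products can be written as sums over one common index set. The distributive laws are proved this
  way.\<close>

lemma mult_eq:
  assumes f: "f \<in> carrier A" and g: "g \<in> carrier A"
    and U: "finite U" "supp f \<subseteq> U" "U \<subseteq> carrier M" and V: "finite V" "supp g \<subseteq> V" "V \<subseteq> carrier M"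
  shows "(f \<otimes>\<^bsub>A\<^esub> g) w =
    (\<Oplus>x\<in>U \<times> V. if fst x \<otimes>\<^bsub>M\<^esub> snd x = w then p (fst x) (snd x) (f (fst x)) (g (snd x)) else \<zero>)"
proof -
  have "(f \<otimes>\<^bsub>A\<^esub> g) w = finsum K (\<lambda>(u, v). p u v (f u) (g v))
        {(u, v). f u \<noteq> \<zero> \<and> g v \<noteq> \<zero> \<and> u \<otimes>\<^bsub>M\<^esub> v = w}"
    by (simp add: twisted_monoid_ring_def)
  also have "\<dots> = (\<Oplus>x\<in>U \<times> V. if fst x \<otimes>\<^bsub>M\<^esub> snd x = w then p (fst x) (snd x) (f (fst x)) (g (snd x)) else \<zero>)"
    by (rule K.add.finprod_mono_neutral_cong_left)
      (use assms coeff_closed[OF f] coeff_closed[OF g] in \<open>auto simp: subset_iff\<close>)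
  finally show ?thesis .
qed

lemma mult_closed:
  assumes f: "f \<in> carrier A" and g: "g \<in> carrier A"
  shows "f \<otimes>\<^bsub>A\<^esub> g \<in> carrier A"
proof (rule carrierI[where S = "(\<lambda>x. fst x \<otimes>\<^bsub>M\<^esub> snd x) ` (supp f \<times> supp g)"])
  have sub: "supp f \<subseteq> carrier M" "supp g \<subseteq> carrier M" using f g by (auto simp: in_carrier_iff)
  note eq = mult_eq[OF f g finite_supp[OF f] order.refl sub(1) finite_supp[OF g] order.refl sub(2)]
  show "(f \<otimes>\<^bsub>A\<^esub> g) w \<in> carrier K" for w
    unfolding eq by (rule K.finsum_closed) (use coeff_closed[OF f] coeff_closed[OF g] sub in \<open>auto simp: subset_iff\<close>)
  show "supp (f \<otimes>\<^bsub>A\<^esub> g) \<subseteq> (\<lambda>x. fst x \<otimes>\<^bsub>M\<^esub> snd x) ` (supp f \<times> supp g)"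
  proof (rule subsetI, rule ccontr)
    fix w assume w: "w \<in> supp (f \<otimes>\<^bsub>A\<^esub> g)" "w \<notin> (\<lambda>x. fst x \<otimes>\<^bsub>M\<^esub> snd x) ` (supp f \<times> supp g)"
    have "(f \<otimes>\<^bsub>A\<^esub> g) w = \<zero>"
      unfolding eq by (rule K.add.finprod_one_eqI) (use w(2) in auto)
    then show False using w(1) by simp
  qed
qed (use f g in \<open>auto simp: in_carrier_iff subset_iff\<close>)

lemma mult_nonzeroD:
  assumes f: "f \<in> carrier A" and g: "g \<in> carrier A" and "(f \<otimes>\<^bsub>A\<^esub> g) w \<noteq> \<zero>"
  obtains u v where "f u \<noteq> \<zero>" "g v \<noteq> \<zero>" "w = u \<otimes>\<^bsub>M\<^esub> v"
proof -
  have sub: "supp f \<subseteq> carrier M" "supp g \<subseteq> carrier M" using f g by (auto simp: in_carrier_iff)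
  note eq = mult_eq[OF f g finite_supp[OF f] order.refl sub(1) finite_supp[OF g] order.refl sub(2)]
  have "\<exists>u v. f u \<noteq> \<zero> \<and> g v \<noteq> \<zero> \<and> w = u \<otimes>\<^bsub>M\<^esub> v"
  proof (rule ccontr)
    assume "\<not> ?thesis"
    then have "(f \<otimes>\<^bsub>A\<^esub> g) w = \<zero>"
      unfolding eq by (intro K.add.finprod_one_eqI) force
    then show False using assms(3) by simp
  qed
  then show ?thesis using that by blast
qed

lemma conv_l_distr:
  assumes "f \<in> carrier A" "g \<in> carrier A" "h \<in> carrier A"
  shows "(f \<oplus>\<^bsub>A\<^esub> g) \<otimes>\<^bsub>A\<^esub> h = f \<otimes>\<^bsub>A\<^esub> h \<oplus>\<^bsub>A\<^esub> g \<otimes>\<^bsub>A\<^esub> h"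
proof
  fix w
  let ?U = "supp f \<union> supp g" and ?V = "supp h"
  have sub: "?U \<subseteq> carrier M" "?V \<subseteq> carrier M" using assms by (auto simp: in_carrier_iff)
  have fin: "finite ?U" "finite ?V" using assms[THEN finite_supp] by blast+
  have coeff: "f x \<in> carrier K" "g x \<in> carrier K" "h x \<in> carrier K" for x
    using assms[THEN coeff_closed] by blast+
  have s: "supp f \<subseteq> ?U" "supp g \<subseteq> ?U" "supp (f \<oplus>\<^bsub>A\<^esub> g) \<subseteq> ?U" by (auto simp: add_eq)
  let ?c = "\<lambda>f x. if fst x \<otimes>\<^bsub>M\<^esub> snd x = w then p (fst x) (snd x) (f (fst x)) (h (snd x)) else \<zero>"
  have "((f \<oplus>\<^bsub>A\<^esub> g) \<otimes>\<^bsub>A\<^esub> h) w = (\<Oplus>x\<in>?U \<times> ?V. ?c (f \<oplus>\<^bsub>A\<^esub> g) x)"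
    using mult_eq[OF add_closed[OF assms(1,2)] assms(3) fin(1) s(3) sub(1) fin(2) order.refl sub(2)] .
  also have "\<dots> = (\<Oplus>x\<in>?U \<times> ?V. ?c f x \<oplus> ?c g x)"
    by (rule K.add.finprod_cong') (use coeff sub in \<open>auto simp: add_eq p_add_left subset_iff\<close>)
  also have "\<dots> = (\<Oplus>x\<in>?U \<times> ?V. ?c f x) \<oplus> (\<Oplus>x\<in>?U \<times> ?V. ?c g x)"
    by (rule K.finsum_addf) (use coeff sub in \<open>auto simp: subset_iff\<close>)
  also have "\<dots> = (f \<otimes>\<^bsub>A\<^esub> h) w \<oplus> (g \<otimes>\<^bsub>A\<^esub> h) w"
    using mult_eq[OF assms(1,3) fin(1) s(1) sub(1) fin(2) order.refl sub(2)]
      mult_eq[OF assms(2,3) fin(1) s(2) sub(1) fin(2) order.refl sub(2)] by simp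
  finally show "((f \<oplus>\<^bsub>A\<^esub> g) \<otimes>\<^bsub>A\<^esub> h) w = (f \<otimes>\<^bsub>A\<^esub> h \<oplus>\<^bsub>A\<^esub> g \<otimes>\<^bsub>A\<^esub> h) w" by (simp add: add_eq)
qed

lemma conv_r_distr:
  assumes "f \<in> carrier A" "g \<in> carrier A" "h \<in> carrier A"
  shows "h \<otimes>\<^bsub>A\<^esub> (f \<oplus>\<^bsub>A\<^esub> g) = h \<otimes>\<^bsub>A\<^esub> f \<oplus>\<^bsub>A\<^esub> h \<otimes>\<^bsub>A\<^esub> g"
proof
  fix w
  let ?U = "supp f \<union> supp g" and ?V = "supp h"
  have sub: "?U \<subseteq> carrier M" "?V \<subseteq> carrier M" using assms by (auto simp: in_carrier_iff)
  have fin: "finite ?U" "finite ?V" using assms[THEN finite_supp] by blast+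
  have coeff: "f x \<in> carrier K" "g x \<in> carrier K" "h x \<in> carrier K" for x
    using assms[THEN coeff_closed] by blast+
  have s: "supp f \<subseteq> ?U" "supp g \<subseteq> ?U" "supp (f \<oplus>\<^bsub>A\<^esub> g) \<subseteq> ?U" by (auto simp: add_eq)
  let ?c = "\<lambda>f x. if fst x \<otimes>\<^bsub>M\<^esub> snd x = w then p (fst x) (snd x) (h (fst x)) (f (snd x)) else \<zero>"
  have "(h \<otimes>\<^bsub>A\<^esub> (f \<oplus>\<^bsub>A\<^esub> g)) w = (\<Oplus>x\<in>?V \<times> ?U. ?c (f \<oplus>\<^bsub>A\<^esub> g) x)"
    using mult_eq[OF assms(3) add_closed[OF assms(1,2)] fin(2) order.refl sub(2) fin(1) s(3) sub(1)] .
  also have "\<dots> = (\<Oplus>x\<in>?V \<times> ?U. ?c f x \<oplus> ?c g x)"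
    by (rule K.add.finprod_cong') (use coeff sub in \<open>auto simp: add_eq p_add_right subset_iff\<close>)
  also have "\<dots> = (\<Oplus>x\<in>?V \<times> ?U. ?c f x) \<oplus> (\<Oplus>x\<in>?V \<times> ?U. ?c g x)"
    by (rule K.finsum_addf) (use coeff sub in \<open>auto simp: subset_iff\<close>)
  also have "\<dots> = (h \<otimes>\<^bsub>A\<^esub> f) w \<oplus> (h \<otimes>\<^bsub>A\<^esub> g) w"
    using mult_eq[OF assms(3,1) fin(2) order.refl sub(2) fin(1) s(1) sub(1)]
      mult_eq[OF assms(3,2) fin(2) order.refl sub(2) fin(1) s(2) sub(1)] by simp
  finally show "(h \<otimes>\<^bsub>A\<^esub> (f \<oplus>\<^bsub>A\<^esub> g)) w = (h \<otimes>\<^bsub>A\<^esub> f \<oplus>\<^bsub>A\<^esub> h \<otimes>\<^bsub>A\<^esub> g) w" by (simp add: add_eq)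
qed

lemma monomial_closed [simp]: "a \<in> carrier K \<Longrightarrow> u \<in> carrier M \<Longrightarrow> monomial K a u \<in> carrier A"
  by (rule carrierI[where S = "{u}"]) (auto simp: monomial_def)

lemma mult_monomial_monomial:
  assumes "a \<in> carrier K" "b \<in> carrier K" "u \<in> carrier M" "v \<in> carrier M"
  shows "monomial K a u \<otimes>\<^bsub>A\<^esub> monomial K b v = monomial K (p u v a b) (u \<otimes>\<^bsub>M\<^esub> v)"
proof
  fix w
  have "(monomial K a u \<otimes>\<^bsub>A\<^esub> monomial K b v) w = (\<Oplus>x\<in>{u} \<times> {v}. if fst x \<otimes>\<^bsub>M\<^esub> snd x = w
     then p (fst x) (snd x) (monomial K a u (fst x)) (monomial K b v (snd x)) else \<zero>)"
    by (rule mult_eq[OF monomial_closed monomial_closed]) (use assms in \<open>auto simp: monomial_def\<close>)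
  then show "(monomial K a u \<otimes>\<^bsub>A\<^esub> monomial K b v) w = monomial K (p u v a b) (u \<otimes>\<^bsub>M\<^esub> v) w"
    using assms by (auto simp: monomial_def)
qed

lemma carrier_induct_on [consumes 2, case_names zero monomial add]:
  assumes "f \<in> carrier A" "supp f \<subseteq> S"
    and zero: "P (\<lambda>_. \<zero>)"
    and mono: "\<And>a u. a \<in> carrier K \<Longrightarrow> u \<in> carrier M \<Longrightarrow> u \<in> S \<Longrightarrow> P (monomial K a u)"
    and add: "\<And>f g. f \<in> carrier A \<Longrightarrow> g \<in> carrier A \<Longrightarrow> P f \<Longrightarrow> P g \<Longrightarrow> P (f \<oplus>\<^bsub>A\<^esub> g)"
  shows "P f"
  using assms(1,2)
proof (induction "card (supp f)" arbitrary: f)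
  case 0
  then have "f = (\<lambda>_. \<zero>)" using finite_supp[OF 0(2)] by auto
  then show ?case using zero by simp
next
  case (Suc n)
  then obtain u where u: "f u \<noteq> \<zero>" by (metis (mono_tags, lifting) Collect_empty_eq card.empty nat.distinct(1))
  define g where "g = f(u := \<zero>)"
  have supp_g: "supp g = supp f - {u}" by (auto simp: g_def)
  have g: "g \<in> carrier A"
    by (rule carrierI[where S = "supp f - {u}"]) (use Suc.prems(1) in \<open>auto simp: g_def in_carrier_iff\<close>)
  have "P g"
  proof (rule Suc.hyps(1)[OF _ g])
    show "n = card (supp g)" using Suc.hyps(2) finite_supp[OF Suc.prems(1)] u by (simp add: supp_g)
    show "supp g \<subseteq> S" using Suc.prems(2) by (auto simp: supp_g)
  qed
  moreover have "P (monomial K (f u) u)"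
    using u Suc.prems coeff_closed supp_subset by (intro mono) auto
  moreover have "f = g \<oplus>\<^bsub>A\<^esub> monomial K (f u) u"
    using coeff_closed[OF Suc.prems(1)] by (auto simp: g_def add_eq monomial_def)
  ultimately show ?case
    using add[of g "monomial K (f u) u"] g u Suc.prems(1) supp_subset coeff_closed by simp
qed

lemma carrier_induct [consumes 1, case_names zero monomial add]:
  assumes "f \<in> carrier A"
    and "P (\<lambda>_. \<zero>)"
    and "\<And>a u. a \<in> carrier K \<Longrightarrow> u \<in> carrier M \<Longrightarrow> P (monomial K a u)"
    and "\<And>f g. f \<in> carrier A \<Longrightarrow> g \<in> carrier A \<Longrightarrow> P f \<Longrightarrow> P g \<Longrightarrow> P (f \<oplus>\<^bsub>A\<^esub> g)"
  shows "P f"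
  using carrier_induct_on[of f UNIV P] assms by blast

lemma zero_in_A: "(\<lambda>_. \<zero>) \<in> carrier A" by (simp add: in_carrier_iff)

lemma mult_zero_left: "f \<in> carrier A \<Longrightarrow> (\<lambda>_. \<zero>) \<otimes>\<^bsub>A\<^esub> f = (\<lambda>_. \<zero>)"
  and mult_zero_right: "f \<in> carrier A \<Longrightarrow> f \<otimes>\<^bsub>A\<^esub> (\<lambda>_. \<zero>) = (\<lambda>_. \<zero>)"
  by (simp_all add: twisted_monoid_ring_def)

text \<open>Both sides are additive in each argument. Three nested inductions reduce the law to
  monomials, where it is \<open>p_assoc\<close>.\<close>

lemma conv_assoc:
  assumes "f \<in> carrier A" "g \<in> carrier A" "h \<in> carrier A"
  shows "f \<otimes>\<^bsub>A\<^esub> g \<otimes>\<^bsub>A\<^esub> h = f \<otimes>\<^bsub>A\<^esub> (g \<otimes>\<^bsub>A\<^esub> h)"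
  using assms
proof (induction f rule: carrier_induct)
  case zero
  then show ?case by (simp add: mult_zero_left mult_closed)
next
  case (add f f')
  then show ?case by (simp add: conv_l_distr mult_closed)
next
  case a: (monomial a u)
  show ?case using a(3,4)
  proof (induction g rule: carrier_induct)
    case zero
    then show ?case using a by (simp add: mult_zero_right mult_zero_left)
  next
    case (add g g')
    then show ?case using a by (simp add: conv_l_distr conv_r_distr mult_closed)
  next
    case b: (monomial b v)
    show ?case using b(3)
    proof (induction h rule: carrier_induct)
      case zero
      then show ?case using a b by (simp add: mult_zero_right mult_closed)
    next
      case (add h h')
      then show ?case using a b by (simp add: conv_r_distr mult_closed)
    next
      case (monomial c w)
      then show ?case using a b by (simp add: mult_monomial_monomial M.m_assoc p_assoc)
    qed
  qed
qed

lemma ring_A: "ring A"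
proof (rule ringI)
  show "abelian_group A"
  proof (rule abelian_groupI)
    fix f assume f: "f \<in> carrier A"
    have "(\<lambda>w. \<ominus> f w) \<in> carrier A"
      by (rule carrierI[where S = "supp f"]) (use f in \<open>auto simp: in_carrier_iff\<close>)
    moreover have "(\<lambda>w. \<ominus> f w) \<oplus>\<^bsub>A\<^esub> f = \<zero>\<^bsub>A\<^esub>"
      using coeff_closed[OF f] by (simp add: add_eq zero_eq K.l_neg)
    ultimately show "\<exists>g\<in>carrier A. g \<oplus>\<^bsub>A\<^esub> f = \<zero>\<^bsub>A\<^esub>" by blast
  qed (auto simp: add_closed, auto simp: add_eq zero_eq zero_in_A K.a_ac coeff_closed)
  show "Group.monoid A"
  proof
    fix f assume "f \<in> carrier A"
    then show "\<one>\<^bsub>A\<^esub> \<otimes>\<^bsub>A\<^esub> f = f"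
      unfolding one_eq
      by (induction f rule: carrier_induct)
        (auto simp: mult_zero_right mult_monomial_monomial p_one_left conv_r_distr)
  next
    fix f assume "f \<in> carrier A"
    then show "f \<otimes>\<^bsub>A\<^esub> \<one>\<^bsub>A\<^esub> = f"
      unfolding one_eq
      by (induction f rule: carrier_induct)
        (auto simp: mult_zero_left mult_monomial_monomial p_one_right conv_l_distr)
  qed (auto simp: mult_closed conv_assoc one_eq)
qed (auto simp: conv_l_distr conv_r_distr)

sublocale A: ring A by (rule ring_A)

lemma a_inv_eq:
  assumes "f \<in> carrier A" shows "\<ominus>\<^bsub>A\<^esub> f = (\<lambda>w. \<ominus> f w)"
proof (rule A.minus_equality)
  show "(\<lambda>w. \<ominus> f w) \<in> carrier A"
    by (rule carrierI[where S = "supp f"]) (use assms in \<open>auto simp: in_carrier_iff\<close>)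
  show "(\<lambda>w. \<ominus> f w) \<oplus>\<^bsub>A\<^esub> f = \<zero>\<^bsub>A\<^esub>"
    using coeff_closed[OF assms] by (simp add: add_eq zero_eq K.l_neg)
qed (rule assms)

lemma conv_minus_eq: "f \<in> carrier A \<Longrightarrow> g \<in> carrier A \<Longrightarrow> f \<ominus>\<^bsub>A\<^esub> g = (\<lambda>w. f w \<ominus> g w)"
  by (simp add: a_minus_def a_inv_eq add_eq)

text \<open>The condition \<open>inj\<close> leaves \<open>(u, v)\<close> as the only pair that can
  contribute to this coefficient. It is asked only at the given \<open>v\<close>, so the lemma also
  serves the free monoid. Summing over \<open>insert v (supp f)\<close> covers the case
  \<open>f v = \<zero>\<close>.\<close>

lemma monomial_mult_cancel:
  assumes "f \<in> carrier A" "a \<in> carrier K" "u \<in> carrier M" "v \<in> carrier M"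
    and inj: "\<And>v'. v' \<in> carrier M \<Longrightarrow> u \<otimes>\<^bsub>M\<^esub> v' = u \<otimes>\<^bsub>M\<^esub> v \<Longrightarrow> v' = v"
  shows "(monomial K a u \<otimes>\<^bsub>A\<^esub> f) (u \<otimes>\<^bsub>M\<^esub> v) = p u v a (f v)"
proof -
  have "(monomial K a u \<otimes>\<^bsub>A\<^esub> f) (u \<otimes>\<^bsub>M\<^esub> v) = (\<Oplus>x\<in>{u} \<times> insert v (supp f). if fst x \<otimes>\<^bsub>M\<^esub> snd x = u \<otimes>\<^bsub>M\<^esub> v
     then p (fst x) (snd x) (monomial K a u (fst x)) (f (snd x)) else \<zero>)"
    by (rule mult_eq[OF monomial_closed[OF assms(2,3)] assms(1)])
      (use assms(2-4) supp_subset[OF assms(1)] finite_supp[OF assms(1)] in \<open>auto simp: monomial_def\<close>)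
  also have "\<dots> = (\<Oplus>x\<in>{(u, v)}. p u v a (f v))"
    by (rule K.add.finprod_mono_neutral_cong_right)
      (use assms coeff_closed[OF assms(1)] finite_supp[OF assms(1)] in \<open>auto simp: monomial_def dest!: inj[rotated] supp_subset[OF assms(1)]\<close>)
  finally show ?thesis using assms coeff_closed by simp
qed

lemma mult_monomial_cancel:
  assumes "f \<in> carrier A" "a \<in> carrier K" "u \<in> carrier M" "v \<in> carrier M"
    and inj: "\<And>v'. v' \<in> carrier M \<Longrightarrow> v' \<otimes>\<^bsub>M\<^esub> u = v \<otimes>\<^bsub>M\<^esub> u \<Longrightarrow> v' = v"
  shows "(f \<otimes>\<^bsub>A\<^esub> monomial K a u) (v \<otimes>\<^bsub>M\<^esub> u) = p v u (f v) a"
proof -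
  have "(f \<otimes>\<^bsub>A\<^esub> monomial K a u) (v \<otimes>\<^bsub>M\<^esub> u) = (\<Oplus>x\<in>insert v (supp f) \<times> {u}. if fst x \<otimes>\<^bsub>M\<^esub> snd x = v \<otimes>\<^bsub>M\<^esub> u
     then p (fst x) (snd x) (f (fst x)) (monomial K a u (snd x)) else \<zero>)"
    by (rule mult_eq[OF assms(1) monomial_closed[OF assms(2,3)]])
      (use assms(2-4) supp_subset[OF assms(1)] finite_supp[OF assms(1)] in \<open>auto simp: monomial_def\<close>)
  also have "\<dots> = (\<Oplus>x\<in>{(v, u)}. p v u (f v) a)"
    by (rule K.add.finprod_mono_neutral_cong_right)
      (use assms coeff_closed[OF assms(1)] finite_supp[OF assms(1)] in \<open>auto simp: monomial_def dest!: inj[rotated] supp_subset[OF assms(1)]\<close>)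
  finally show ?thesis using assms coeff_closed by simp
qed

text \<open>Every multiplier is a sum of monomials, and negation is multiplication by the monomial
  with coefficient \<open>\<ominus> \<one>\<close> at the identity.\<close>

lemma ideal_if_closed_monomial:
  assumes "I \<subseteq> carrier A" "(\<lambda>_. \<zero>) \<in> I"
    and add: "\<And>f g. f \<in> I \<Longrightarrow> g \<in> I \<Longrightarrow> f \<oplus>\<^bsub>A\<^esub> g \<in> I"
    and left: "\<And>f a u. f \<in> I \<Longrightarrow> a \<in> carrier K \<Longrightarrow> u \<in> carrier M \<Longrightarrow> monomial K a u \<otimes>\<^bsub>A\<^esub> f \<in> I"
    and right: "\<And>f a u. f \<in> I \<Longrightarrow> a \<in> carrier K \<Longrightarrow> u \<in> carrier M \<Longrightarrow> f \<otimes>\<^bsub>A\<^esub> monomial K a u \<in> I"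
  shows "ideal I A"
proof (rule A.ideal_I)
  fix f assume f: "f \<in> I"
  then have fA: "f \<in> carrier A" using assms(1) by blast
  show "\<ominus>\<^bsub>A\<^esub> f \<in> I"
  proof -
    have "\<ominus>\<^bsub>A\<^esub> \<one>\<^bsub>A\<^esub> = monomial K (\<ominus> \<one>) \<one>\<^bsub>M\<^esub>"
      unfolding a_inv_eq[OF A.one_closed] unfolding one_eq by (auto simp: monomial_def)
    then have "\<ominus>\<^bsub>A\<^esub> \<one>\<^bsub>A\<^esub> \<otimes>\<^bsub>A\<^esub> f \<in> I" using left[OF f, of "\<ominus> \<one>" "\<one>\<^bsub>M\<^esub>"] by simp
    then show ?thesis using fA by (simp add: A.l_minus)
  qed
  fix g assume "g \<in> carrier A"
  then show "g \<otimes>\<^bsub>A\<^esub> f \<in> I"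
  proof (induction g rule: carrier_induct)
    case (add g g')
    then show ?case using assms(3) fA by (simp add: conv_l_distr)
  qed (use left f fA assms(2) in \<open>auto simp: mult_zero_left\<close>)
  show "f \<otimes>\<^bsub>A\<^esub> g \<in> I" using \<open>g \<in> carrier A\<close>
  proof (induction g rule: carrier_induct)
    case (add g g')
    then show ?case using assms(3) fA by (simp add: conv_r_distr)
  qed (use right f fA assms(2) in \<open>auto simp: mult_zero_right\<close>)
qed (use assms in \<open>auto simp: zero_eq\<close>)

end

section \<open>Monoid algebras twisted by a bicharacter\<close>

definition additive_monoid :: "'g::monoid_add set \<Rightarrow> 'g monoid" where
  "additive_monoid S = \<lparr>carrier = S, monoid.mult = (+), one = 0\<rparr>"

lemma additive_monoid_simps [simp]:
  "carrier (additive_monoid S) = S" "x \<otimes>\<^bsub>additive_monoid S\<^esub> y = x + y" "\<one>\<^bsub>additive_monoid S\<^esub> = 0"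
  by (simp_all add: additive_monoid_def)

text \<open>\<open>\<chi>\<close> stands for the map from an integer \<open>k\<close> to the
  \<open>k\<close>-th power of \<open>q\<close>, and the twist is the bicharacter
  \<open>\<chi> (\<beta> s t)\<close>. Degrees live in a totally ordered group that contains
  \<open>S\<close>: differences of degrees can then be formed freely, and the order supplies leading
  terms.\<close>

locale twisted_algebra = field K
  for K :: "('a, 'b) ring_scheme" (structure) +
  fixes \<chi> :: "int \<Rightarrow> 'a" and \<beta> :: "'g::linordered_ab_group_add \<Rightarrow> 'g \<Rightarrow> int" and S :: "'g set"
  assumes \<chi>_closed [simp]: "\<chi> k \<in> carrier K"
    and \<chi>_add: "\<chi> (k + l) = \<chi> k \<otimes> \<chi> l"
    and \<chi>_0 [simp]: "\<chi> 0 = \<one>"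
    and \<beta>_add_left: "\<beta> (s + t) r = \<beta> s r + \<beta> t r"
    and \<beta>_add_right: "\<beta> r (s + t) = \<beta> r s + \<beta> r t"
    and zero_in_S [simp]: "0 \<in> S"
    and add_in_S: "s \<in> S \<Longrightarrow> t \<in> S \<Longrightarrow> s + t \<in> S"
begin

lemma \<chi>_mult: "\<chi> k \<otimes> \<chi> l = \<chi> (k + l)" by (simp add: \<chi>_add)

lemma \<chi>_mult_mult: "a \<in> carrier K \<Longrightarrow> \<chi> k \<otimes> (\<chi> l \<otimes> a) = \<chi> (k + l) \<otimes> a"
  by (simp add: \<chi>_add m_assoc)

lemma \<chi>_nonzero [simp]: "\<chi> k \<noteq> \<zero>"
proof
  assume "\<chi> k = \<zero>"
  then have "\<chi> (k + - k) = \<zero>" unfolding \<chi>_add by simp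
  then show False by simp
qed

lemma \<chi>_mult_eq_0_iff [simp]: "a \<in> carrier K \<Longrightarrow> \<chi> k \<otimes> a = \<zero> \<longleftrightarrow> a = \<zero>"
  by (simp add: integral_iff)

text \<open>When \<open>q\<close> is a root of unity, an equality of commutation factors holds only
  after \<open>\<chi>\<close>. This rule transports such an equality to any other exponents with the
  same difference, which reduces an exchange of monomials to an identity of integers.\<close>

lemma \<chi>_cong: "\<chi> k = \<chi> l \<Longrightarrow> m - n = k - l \<Longrightarrow> \<chi> m = \<chi> n"
proof -
  assume eq: "\<chi> k = \<chi> l" and "m - n = k - l"
  then have "m = k + (n - l)" "n = l + (n - l)" by simp_all
  then show "\<chi> m = \<chi> n" using eq \<chi>_add by metis
qed

lemma \<beta>_0 [simp]: "\<beta> 0 s = 0" "\<beta> s 0 = 0"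
  using \<beta>_add_left[of 0 0 s] \<beta>_add_right[of s 0 0] by simp_all

lemma \<beta>_minus: "\<beta> (- s) t = - \<beta> s t" "\<beta> s (- t) = - \<beta> s t"
  using \<beta>_add_left[of s "-s" t] \<beta>_add_right[of s t "-t"] by simp_all

lemma \<beta>_diff: "\<beta> (s - r) t = \<beta> s t - \<beta> r t" "\<beta> s (t - r) = \<beta> s t - \<beta> s r"
  using \<beta>_add_left[of s "-r" t] \<beta>_add_right[of s t "-r"] by (simp_all add: \<beta>_minus)

lemmas \<beta>_simps = \<beta>_add_left \<beta>_add_right \<beta>_minus \<beta>_diff

sublocale twisted_product K "additive_monoid S" "\<lambda>u v a b. \<chi> (\<beta> u v) \<otimes> (a \<otimes> b)"
proof (intro twisted_product.intro twisted_product_axioms.intro)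
  show "monoid (additive_monoid S)"
    by unfold_locales (auto simp: add_in_S add.assoc)
  fix u v w a b c
  assume "u \<in> carrier (additive_monoid S)" "v \<in> carrier (additive_monoid S)" "w \<in> carrier (additive_monoid S)"
    and abc: "a \<in> carrier K" "b \<in> carrier K" "c \<in> carrier K"
  have "\<chi> (\<beta> (u + v) w) \<otimes> (\<chi> (\<beta> u v) \<otimes> (a \<otimes> b) \<otimes> c) = \<chi> (\<beta> (u + v) w) \<otimes> (\<chi> (\<beta> u v) \<otimes> (a \<otimes> b \<otimes> c))"
    using abc by (simp add: m_assoc)
  also have "\<dots> = \<chi> (\<beta> u (v + w)) \<otimes> (\<chi> (\<beta> v w) \<otimes> (a \<otimes> b \<otimes> c))"
    using abc by (simp add: \<chi>_mult_mult \<beta>_simps ac_simps)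
  also have "\<dots> = \<chi> (\<beta> u (v + w)) \<otimes> (a \<otimes> (\<chi> (\<beta> v w) \<otimes> (b \<otimes> c)))"
    using abc by (simp add: m_ac)
  finally show "\<chi> (\<beta> (u \<otimes>\<^bsub>additive_monoid S\<^esub> v) w) \<otimes> (\<chi> (\<beta> u v) \<otimes> (a \<otimes> b) \<otimes> c) =
      \<chi> (\<beta> u (v \<otimes>\<^bsub>additive_monoid S\<^esub> w)) \<otimes> (a \<otimes> (\<chi> (\<beta> v w) \<otimes> (b \<otimes> c)))"
    by simp
qed (auto simp: ring_axioms l_distr r_distr)

abbreviation mon :: "'g \<Rightarrow> 'g \<Rightarrow> 'a" where "mon s \<equiv> monomial K \<one> s"

abbreviation smult :: "'a \<Rightarrow> ('g \<Rightarrow> 'a) \<Rightarrow> 'g \<Rightarrow> 'a" where "smult a f \<equiv> (\<lambda>w. a \<otimes> f w)"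

lemma monomial_in_A [simp]: "a \<in> carrier K \<Longrightarrow> s \<in> S \<Longrightarrow> monomial K a s \<in> carrier A"
  using monomial_closed[of a s] by simp

lemma supp_in_S: "f \<in> carrier A \<Longrightarrow> f w \<noteq> \<zero> \<Longrightarrow> w \<in> S"
  using supp_subset[of f w] by simp

text \<open>Multiplication by a monomial is a scaled shift by \<open>s\<close>. If
  \<open>w - s\<close> falls outside \<open>S\<close>, both sides vanish, so the formula holds for
  every \<open>w\<close> of the ambient group.\<close>

lemma monomial_mult_apply:
  assumes f: "f \<in> carrier A" and a: "a \<in> carrier K" and s: "s \<in> S"
  shows "(monomial K a s \<otimes>\<^bsub>A\<^esub> f) w = \<chi> (\<beta> s (w - s)) \<otimes> (a \<otimes> f (w - s))"
proof (cases "w - s \<in> S")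
  case True
  then have "(monomial K a s \<otimes>\<^bsub>A\<^esub> f) (s \<otimes>\<^bsub>additive_monoid S\<^esub> (w - s)) = \<chi> (\<beta> s (w - s)) \<otimes> (a \<otimes> f (w - s))"
    using s by (intro monomial_mult_cancel[OF f a]) auto
  then show ?thesis by simp
next
  case False
  then have "f (w - s) = \<zero>" using supp_in_S[OF f] by force
  moreover have "(monomial K a s \<otimes>\<^bsub>A\<^esub> f) w = \<zero>"
  proof (rule ccontr)
    assume "(monomial K a s \<otimes>\<^bsub>A\<^esub> f) w \<noteq> \<zero>"
    then obtain u v where "monomial K a s u \<noteq> \<zero>" "f v \<noteq> \<zero>" "w = u + v"
      using mult_nonzeroD[OF monomial_in_A[OF a s] f] by auto
    moreover from this have "u = s" by (simp add: monomial_def split: if_splits)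
    ultimately show False using False supp_in_S[OF f, of v] by simp
  qed
  ultimately show ?thesis using a by simp
qed

lemma mult_monomial_apply:
  assumes f: "f \<in> carrier A" and a: "a \<in> carrier K" and s: "s \<in> S"
  shows "(f \<otimes>\<^bsub>A\<^esub> monomial K a s) w = \<chi> (\<beta> (w - s) s) \<otimes> (f (w - s) \<otimes> a)"
proof (cases "w - s \<in> S")
  case True
  then have "(f \<otimes>\<^bsub>A\<^esub> monomial K a s) ((w - s) \<otimes>\<^bsub>additive_monoid S\<^esub> s) = \<chi> (\<beta> (w - s) s) \<otimes> (f (w - s) \<otimes> a)"
    using s by (intro mult_monomial_cancel[OF f a]) auto
  then show ?thesis by simp
next
  case False
  then have "f (w - s) = \<zero>" using supp_in_S[OF f] by force
  moreover have "(f \<otimes>\<^bsub>A\<^esub> monomial K a s) w = \<zero>"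
  proof (rule ccontr)
    assume "(f \<otimes>\<^bsub>A\<^esub> monomial K a s) w \<noteq> \<zero>"
    then obtain u v where "f u \<noteq> \<zero>" "monomial K a s v \<noteq> \<zero>" "w = u + v"
      using mult_nonzeroD[OF f monomial_in_A[OF a s]] by auto
    moreover from this have "v = s" by (simp add: monomial_def split: if_splits)
    ultimately show False using False supp_in_S[OF f, of u] by simp
  qed
  ultimately show ?thesis using a by simp
qed

lemma smult_eq: "f \<in> carrier A \<Longrightarrow> a \<in> carrier K \<Longrightarrow> smult a f = monomial K a 0 \<otimes>\<^bsub>A\<^esub> f"
  by (rule ext) (simp add: monomial_mult_apply coeff_closed)

lemma smult_closed: "f \<in> carrier A \<Longrightarrow> a \<in> carrier K \<Longrightarrow> smult a f \<in> carrier A"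
  by (simp add: smult_eq)

lemma ideal_smult: "ideal I A \<Longrightarrow> f \<in> I \<Longrightarrow> a \<in> carrier K \<Longrightarrow> smult a f \<in> I"
  using smult_eq[of f a] ideal_subset_carrier[of I A] ideal.I_l_closed[of I A f "monomial K a 0"]
  by auto

lemma ideal_smult_iff:
  assumes "ideal I A" "f \<in> carrier A" "a \<in> carrier K" "a \<noteq> \<zero>"
  shows "smult a f \<in> I \<longleftrightarrow> f \<in> I"
proof
  assume "smult a f \<in> I"
  then have mem: "smult (inv a) (smult a f) \<in> I"
    by (rule ideal_smult[OF assms(1)]) (use assms in \<open>simp add: field_Units\<close>)
  have eq: "smult (inv a) (smult a f) = f"
    using assms coeff_closed[OF assms(2)] by (simp add: field_Units flip: m_assoc)
  show "f \<in> I" by (rule back_subst[of "\<lambda>x. x \<in> I", OF mem eq])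
qed (use assms ideal_smult in auto)

lemma ideal_mon_iff:
  assumes "ideal I A" "a \<in> carrier K" "a \<noteq> \<zero>" "s \<in> S"
  shows "monomial K a s \<in> I \<longleftrightarrow> mon s \<in> I"
proof -
  have "monomial K a s = smult a (mon s)" using assms by (auto simp: monomial_def)
  then show ?thesis using ideal_smult_iff[of I "mon s" a] assms by simp
qed

lemma ideal_zero: "ideal I A \<Longrightarrow> (\<lambda>_. \<zero>) \<in> I"
  using additive_subgroup.zero_closed[OF ideal.axioms(1), of I A] by (simp add: zero_eq)

lemma ideal_add: "ideal I A \<Longrightarrow> f \<in> I \<Longrightarrow> g \<in> I \<Longrightarrow> (\<lambda>w. f w \<oplus> g w) \<in> I"
  using A.ideal_a_closed[of I f g] by (simp add: add_eq)

lemma ideal_diff: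
  assumes "ideal I A" "f \<in> I" "g \<in> I" shows "(\<lambda>w. f w \<ominus> g w) \<in> I"
proof -
  have "f \<in> carrier A" "g \<in> carrier A" using assms ideal_subset_carrier by blast+
  then show ?thesis
    using A.ideal_a_closed[OF assms(1,2) A.ideal_a_inv_closed[OF assms(1,3)]]
    by (simp add: conv_minus_eq flip: a_minus_def)
qed

lemma mem_ideal_if_monomials_mem:
  assumes "ideal I A" "f \<in> carrier A" "\<And>s. f s \<noteq> \<zero> \<Longrightarrow> mon s \<in> I"
  shows "f \<in> I"
proof -
  have "supp f \<subseteq> {s. mon s \<in> I}" using assms(3) by blast
  with assms(2) show ?thesis
  proof (induction f rule: carrier_induct_on)
    case (monomial a u)
    then show ?case using assms(1) ideal_mon_iff[of I a u] ideal_zero[of I]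
      by (cases "a = \<zero>") (auto simp: monomial_def)
  qed (use assms(1) in \<open>auto simp: ideal_zero A.ideal_a_closed\<close>)
qed

subsection \<open>Faces\<close>

text \<open>Equivalently, a submonoid whose complement in \<open>S\<close> is a prime ideal of the
  monoid \<open>S\<close>.\<close>

definition face :: "'g set \<Rightarrow> bool" where
  "face F \<longleftrightarrow> F \<subseteq> S \<and> 0 \<in> F \<and> (\<forall>s\<in>S. \<forall>t\<in>S. s + t \<in> F \<longleftrightarrow> s \<in> F \<and> t \<in> F)"

definition face_ideal :: "'g set \<Rightarrow> ('g \<Rightarrow> 'a) set" where
  "face_ideal F = {f \<in> carrier A. \<forall>s\<in>F. f s = \<zero>}"

lemma faceD:
  assumes "face F"
  shows "s \<in> F \<Longrightarrow> s \<in> S" "0 \<in> F" "s \<in> F \<Longrightarrow> t \<in> F \<Longrightarrow> s + t \<in> F"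
    "s \<in> S \<Longrightarrow> t \<in> S \<Longrightarrow> s + t \<in> F \<Longrightarrow> s \<in> F" "s \<in> S \<Longrightarrow> t \<in> S \<Longrightarrow> s + t \<in> F \<Longrightarrow> t \<in> F"
  using assms unfolding face_def by blast+

lemma mon_in_face_ideal_iff: "face F \<Longrightarrow> s \<in> S \<Longrightarrow> mon s \<in> face_ideal F \<longleftrightarrow> s \<notin> F"
  by (auto simp: face_ideal_def monomial_def[of K \<one> s, THEN fun_cong])

lemma face_ideal_ideal:
  assumes F: "face F" shows "ideal (face_ideal F) A"
proof (rule ideal_if_closed_monomial)
  fix f a u assume f: "f \<in> face_ideal F" and a: "a \<in> carrier K" and u: "u \<in> carrier (additive_monoid S)"
  then have fA: "f \<in> carrier A" and u: "u \<in> S" by (auto simp: face_ideal_def)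
  have "f (s - u) = \<zero>" if "s \<in> F" for s
  proof (rule ccontr)
    assume nz: "f (s - u) \<noteq> \<zero>"
    then have "s - u \<in> S" using supp_in_S[OF fA] by auto
    then have "s - u \<in> F" using faceD(5)[OF F u, of "s - u"] that by simp
    then show False using f nz by (simp add: face_ideal_def)
  qed
  moreover have "monomial K a u \<otimes>\<^bsub>A\<^esub> f \<in> carrier A" "f \<otimes>\<^bsub>A\<^esub> monomial K a u \<in> carrier A"
    using fA a u by simp_all
  ultimately show "monomial K a u \<otimes>\<^bsub>A\<^esub> f \<in> face_ideal F" "f \<otimes>\<^bsub>A\<^esub> monomial K a u \<in> face_ideal F"
    using a by (simp_all add: face_ideal_def monomial_mult_apply[OF fA a u] mult_monomial_apply[OF fA a u])
next
  fix f g assume "f \<in> face_ideal F" "g \<in> face_ideal F"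
  then show "f \<oplus>\<^bsub>A\<^esub> g \<in> face_ideal F"
    using add_closed[of f g] by (simp add: face_ideal_def add_eq)
qed (auto simp: face_ideal_def zero_in_A)

text \<open>A sum of two degrees of \<open>S\<close> lies in \<open>F\<close> only if both summands
  do. So modulo \<open>face_ideal F\<close> the product is that of the twisted algebra on
  \<open>F\<close>.\<close>

lemma mult_apply_on_face:
  assumes F: "face F" and f: "f \<in> carrier A" and g: "g \<in> carrier A" and w: "w \<in> F"
  shows "(f \<otimes>\<^bsub>A\<^esub> g) w = finsum K (\<lambda>(u, v). \<chi> (\<beta> u v) \<otimes> (f u \<otimes> g v))
      {(u, v). u \<in> F \<and> v \<in> F \<and> f u \<noteq> \<zero> \<and> g v \<noteq> \<zero> \<and> u + v = w}"
proof -
  have "{(u, v). u \<in> F \<and> v \<in> F \<and> f u \<noteq> \<zero> \<and> g v \<noteq> \<zero> \<and> u + v = w} = {(u, v). f u \<noteq> \<zero> \<and> g v \<noteq> \<zero> \<and> u + v = w}"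
    using faceD(4,5)[OF F] w supp_in_S[OF f] supp_in_S[OF g] by blast
  then show ?thesis by (simp add: twisted_monoid_ring_def)
qed

text \<open>The product of the leading coefficients on the face survives.\<close>

lemma completely_prime_face_ideal:
  assumes F: "face F" shows "completely_prime A (face_ideal F)"
  unfolding A.completely_prime_iff_elements
proof (intro conjI ballI impI face_ideal_ideal F)
  show "\<one>\<^bsub>A\<^esub> \<notin> face_ideal F"
    using mon_in_face_ideal_iff[OF F zero_in_S] faceD(2)[OF F] by (simp add: one_eq)
  fix f g assume f: "f \<in> carrier A" and g: "g \<in> carrier A" and fg: "f \<otimes>\<^bsub>A\<^esub> g \<in> face_ideal F"
  show "f \<in> face_ideal F \<or> g \<in> face_ideal F"
  proof (rule ccontr)
    assume notin: "\<not> (f \<in> face_ideal F \<or> g \<in> face_ideal F)"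
    define Xf Y where "Xf = {s \<in> F. f s \<noteq> \<zero>}" and "Y = {s \<in> F. g s \<noteq> \<zero>}"
    have fin: "finite Xf" "finite Y"
      using finite_supp[OF f] finite_supp[OF g] by (auto simp: Xf_def Y_def elim: rev_finite_subset)
    have ne: "Xf \<noteq> {}" "Y \<noteq> {}" using notin f g by (auto simp: Xf_def Y_def face_ideal_def)
    define x y where "x = Max Xf" and "y = Max Y"
    have x: "x \<in> Xf" "\<And>u. u \<in> Xf \<Longrightarrow> u \<le> x" and y: "y \<in> Y" "\<And>u. u \<in> Y \<Longrightarrow> u \<le> y"
      using fin ne by (simp_all add: x_def y_def)
    have xy: "x + y \<in> F" using x(1) y(1) faceD(3)[OF F] by (simp add: Xf_def Y_def)
    have "u = x \<and> v = y" if "u \<in> Xf" "v \<in> Y" "u + v = x + y" for u v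
      using x(2)[OF that(1)] y(2)[OF that(2)] that(3)
      by (metis add_le_less_mono add_less_le_mono order.strict_iff_order)
    then have "{(u, v). u \<in> F \<and> v \<in> F \<and> f u \<noteq> \<zero> \<and> g v \<noteq> \<zero> \<and> u + v = x + y} = {(x, y)}"
      using x(1) y(1) by (auto simp: Xf_def Y_def)
    then have "(f \<otimes>\<^bsub>A\<^esub> g) (x + y) = \<chi> (\<beta> x y) \<otimes> (f x \<otimes> g y)"
      using mult_apply_on_face[OF F f g xy] coeff_closed[OF f] coeff_closed[OF g] by simp
    moreover have "\<dots> \<noteq> \<zero>"
      using x(1) y(1) coeff_closed[OF f] coeff_closed[OF g] by (simp add: Xf_def Y_def integral_iff)
    ultimately show False using fg xy by (simp add: face_ideal_def)
  qed
qed

end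

subsection \<open>Torus actions and graded ideals\<close>

text \<open>The element \<open>h\<close> scales the monomial of degree \<open>s\<close> by
  \<open>char h s\<close>. Of the group laws only their effect on these scalars is kept: inverses
  and products of the functions \<open>char h\<close> are again of this form on \<open>S\<close>.
  The infinitude of the field enters through \<open>char_separates\<close>.\<close>

locale twisted_algebra_torus = twisted_algebra K \<chi> \<beta> S
  for K :: "('a, 'b) ring_scheme" (structure) and \<chi> and \<beta> :: "'g::linordered_ab_group_add \<Rightarrow> 'g \<Rightarrow> int" and S +
  fixes H :: "('h, 'c) monoid_scheme" and char :: "'h \<Rightarrow> 'g \<Rightarrow> 'a"
  assumes char_closed [simp]: "h \<in> carrier H \<Longrightarrow> char h s \<in> carrier K"
    and char_inverse: "h \<in> carrier H \<Longrightarrow> \<exists>h'\<in>carrier H. \<forall>s\<in>S. char h' s \<otimes> char h s = \<one>"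
    and char_mult: "h \<in> carrier H \<Longrightarrow> h' \<in> carrier H \<Longrightarrow> \<exists>h''\<in>carrier H. \<forall>s\<in>S. char h'' s = char h s \<otimes> char h' s"
    and char_separates: "s \<in> S \<Longrightarrow> t \<in> S \<Longrightarrow> s \<noteq> t \<Longrightarrow> \<exists>h\<in>carrier H. char h s \<noteq> char h t"
    and H_nonempty: "carrier H \<noteq> {}"
begin

abbreviation act :: "'h \<Rightarrow> ('g \<Rightarrow> 'a) \<Rightarrow> 'g \<Rightarrow> 'a" where "act h f \<equiv> (\<lambda>s. char h s \<otimes> f s)"

lemma act_closed: "h \<in> carrier H \<Longrightarrow> f \<in> carrier A \<Longrightarrow> act h f \<in> carrier A"
  by (rule carrierI[where S = "supp f"]) (auto simp: in_carrier_iff)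

lemma act_act_inverse:
  assumes "h \<in> carrier H" "h' \<in> carrier H" "\<forall>s\<in>S. char h' s \<otimes> char h s = \<one>" "f \<in> carrier A"
  shows "act h' (act h f) = f" "act h (act h' f) = f"
proof -
  have "char h' s \<otimes> (char h s \<otimes> f s) = f s" "char h s \<otimes> (char h' s \<otimes> f s) = f s" for s
  proof -
    have *: "char h' s \<otimes> (char h s \<otimes> f s) = (char h' s \<otimes> char h s) \<otimes> f s"
      "char h s \<otimes> (char h' s \<otimes> f s) = (char h' s \<otimes> char h s) \<otimes> f s"
      using assms coeff_closed[OF assms(4)] by (simp_all add: m_ac)
    show "char h' s \<otimes> (char h s \<otimes> f s) = f s" "char h s \<otimes> (char h' s \<otimes> f s) = f s"
      unfolding * using assms coeff_closed[OF assms(4)] supp_in_S[OF assms(4), of s]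
      by (cases "f s = \<zero>"; simp)+
  qed
  then show "act h' (act h f) = f" "act h (act h' f) = f" by auto
qed

text \<open>Elimination by eigenvalues: if \<open>h\<close> separates \<open>s\<close> from another
  degree \<open>t\<close> of \<open>f\<close>, then \<open>act h f\<close> minus
  \<open>char h s\<close> times \<open>f\<close> loses \<open>s\<close> and keeps \<open>t\<close>,
  so by induction the monomial of degree \<open>t\<close> lies in \<open>V\<close>. Removing that
  term from \<open>f\<close> shrinks the support without touching \<open>s\<close>. \<open>V\<close>
  is a stable subspace rather than an ideal, because the lemma is also applied to an intersection of
  translates of a prime.\<close>

lemma mon_mem_if_stable:
  assumes V: "V \<subseteq> carrier A"
    and diff: "\<And>f g. f \<in> V \<Longrightarrow> g \<in> V \<Longrightarrow> (\<lambda>w. f w \<ominus> g w) \<in> V"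
    and scal: "\<And>a f. a \<in> carrier K \<Longrightarrow> f \<in> V \<Longrightarrow> smult a f \<in> V"
    and stable: "\<And>h f. h \<in> carrier H \<Longrightarrow> f \<in> V \<Longrightarrow> act h f \<in> V"
    and "f \<in> V" "f s \<noteq> \<zero>"
  shows "mon s \<in> V"
  using assms(5,6)
proof (induction "card (supp f)" arbitrary: f s rule: less_induct)
  case less
  have f: "f \<in> carrier A" using V less.prems by blast
  note fK = coeff_closed[OF f]
  show ?case
  proof (cases "supp f = {s}")
    case True
    then have "f w = \<zero>" if "w \<noteq> s" for w using that by blast
    then have "mon s = smult (inv (f s)) f"
      using less.prems fK by (auto simp: monomial_def field_Units)
    then show ?thesis using scal less.prems fK by (simp add: field_Units)
  next
    case False
    then obtain t where t: "f t \<noteq> \<zero>" "t \<noteq> s" using less.prems by blast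
    then obtain h where h: "h \<in> carrier H" "char h s \<noteq> char h t"
      using char_separates[of s t] supp_in_S[OF f] less.prems by auto
    define g where "g = (\<lambda>w. char h w \<otimes> f w \<ominus> char h s \<otimes> f w)"
    have gV: "g \<in> V" unfolding g_def using less.prems h scal stable by (intro diff) auto
    have g_eq: "g w = (char h w \<ominus> char h s) \<otimes> f w" for w
      using h fK by (simp add: g_def l_distr l_minus a_minus_def)
    have supp_g: "supp g \<subset> supp f"
    proof
      show "supp g \<subseteq> supp f" using h by (auto simp: g_eq)
      have "g s = \<zero>" using h fK by (simp add: g_eq a_minus_def r_neg)
      then show "supp g \<noteq> supp f" using less.prems by blast
    qed
    have "g t \<noteq> \<zero>" using h t fK by (auto simp: g_eq integral_iff)
    then have "mon t \<in> V"
      using less.hyps[OF psubset_card_mono[OF finite_supp[OF f] supp_g] gV] by blast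
    define f' where "f' = (\<lambda>w. f w \<ominus> f t \<otimes> mon t w)"
    have "f' \<in> V" unfolding f'_def using less.prems \<open>mon t \<in> V\<close> scal fK by (intro diff) auto
    have supp_f': "supp f' = supp f - {t}" using fK by (auto simp: f'_def monomial_def)
    have "card (supp f') < card (supp f)"
      unfolding supp_f' using t finite_supp[OF f] by (intro psubset_card_mono) auto
    then show ?thesis using less.hyps[OF _ \<open>f' \<in> V\<close>, of s] less.prems t supp_f' by blast
  qed
qed

lemma H_invariantD: "H_invariant H act I \<Longrightarrow> h \<in> carrier H \<Longrightarrow> f \<in> I \<Longrightarrow> act h f \<in> I"
  unfolding H_invariant_def by blast

text \<open>One inclusion suffices, since every scaling is undone by another element of
  \<open>H\<close>.\<close>

lemma H_invariantI:
  assumes "I \<subseteq> carrier A" "\<And>h f. h \<in> carrier H \<Longrightarrow> f \<in> I \<Longrightarrow> act h f \<in> I"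
  shows "H_invariant H act I"
  unfolding H_invariant_def
proof (intro ballI equalityI subsetI)
  fix h f assume h: "h \<in> carrier H" and f: "f \<in> I"
  obtain h' where h': "h' \<in> carrier H" "\<forall>s\<in>S. char h' s \<otimes> char h s = \<one>" using char_inverse[OF h] by blast
  have "f = act h (act h' f)" using act_act_inverse(2)[OF h h'] f assms(1) by auto
  then show "f \<in> act h ` I" using assms(2)[OF h'(1) f] by (intro image_eqI[of _ _ "act h' f"]) auto
qed (use assms in auto)

lemma mon_mem_if_H_invariant:
  assumes "ideal I A" "H_invariant H act I" "f \<in> I" "f s \<noteq> \<zero>"
  shows "mon s \<in> I"
  by (rule mon_mem_if_stable[OF _ _ _ _ assms(3,4)])
    (use assms ideal_subset_carrier ideal_diff ideal_smult H_invariantD in auto)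

lemma H_invariant_subset_face_ideal:
  assumes "ideal I A" "H_invariant H act I"
  shows "I \<subseteq> face_ideal {s \<in> S. mon s \<notin> I}"
  using assms mon_mem_if_H_invariant[OF assms] ideal_subset_carrier[OF assms(1)]
  by (auto simp: face_ideal_def)

lemma H_invariant_face_ideal:
  assumes "face F" shows "H_invariant H act (face_ideal F)"
proof (rule H_invariantI)
  fix h f assume "h \<in> carrier H" "f \<in> face_ideal F"
  then show "act h f \<in> face_ideal F" using act_closed[of h f] by (auto simp: face_ideal_def)
qed (auto simp: face_ideal_def)

lemma H_prime_face_ideal:
  assumes F: "face F" shows "H_prime H act A (face_ideal F)"
proof -
  have "completely_prime A (face_ideal F)" by (rule completely_prime_face_ideal[OF F])
  then have P: "ideal (face_ideal F) A" "\<one>\<^bsub>A\<^esub> \<notin> face_ideal F"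
    and prime: "\<And>a b. a \<in> carrier A \<Longrightarrow> b \<in> carrier A \<Longrightarrow> a \<otimes>\<^bsub>A\<^esub> b \<in> face_ideal F \<Longrightarrow> a \<in> face_ideal F \<or> b \<in> face_ideal F"
    by (auto simp: A.completely_prime_iff_elements)
  have "I \<subseteq> face_ideal F \<or> J \<subseteq> face_ideal F"
    if "ideal I A" "ideal J A" "\<forall>i\<in>I. \<forall>j\<in>J. i \<otimes>\<^bsub>A\<^esub> j \<in> face_ideal F" for I J
    using that prime ideal_subset_carrier by (meson subset_iff)
  then show ?thesis
    unfolding A.H_prime_iff_elements using P H_invariant_face_ideal[OF F] A.one_closed by blast
qed

lemma H_prime_is_face_ideal:
  assumes "H_prime H act A P"
  shows "face {s \<in> S. mon s \<notin> P} \<and> P = face_ideal {s \<in> S. mon s \<notin> P}"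
proof -
  let ?F = "{s \<in> S. mon s \<notin> P}"
  have P: "ideal P A" "P \<noteq> carrier A" and inv: "H_invariant H act P"
    and prime: "\<And>I J. ideal I A \<Longrightarrow> H_invariant H act I \<Longrightarrow> ideal J A \<Longrightarrow> H_invariant H act J \<Longrightarrow>
        \<forall>i\<in>I. \<forall>j\<in>J. i \<otimes>\<^bsub>A\<^esub> j \<in> P \<Longrightarrow> I \<subseteq> P \<or> J \<subseteq> P"
    using assms by (auto simp: A.H_prime_iff_elements)
  interpret P: ideal P A by (rule P)
  have eq: "P = face_ideal ?F"
  proof
    show "P \<subseteq> face_ideal ?F" by (rule H_invariant_subset_face_ideal[OF P(1) inv])
    show "face_ideal ?F \<subseteq> P"
    proof
      fix f assume f: "f \<in> face_ideal ?F"
      show "f \<in> P"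
        by (rule mem_ideal_if_monomials_mem[OF P(1)])
          (use f supp_in_S in \<open>auto simp: face_ideal_def\<close>)
    qed
  qed
  have mon_mult: "mon s \<otimes>\<^bsub>A\<^esub> mon t = monomial K (\<chi> (\<beta> s t)) (s + t)" if "s \<in> S" "t \<in> S" for s t
    using that by (simp add: mult_monomial_monomial)
  have sum_iff: "mon s \<otimes>\<^bsub>A\<^esub> mon t \<in> P \<longleftrightarrow> mon (s + t) \<in> P" if "s \<in> S" "t \<in> S" for s t
    unfolding mon_mult[OF that] using that by (intro ideal_mon_iff[OF P(1)]) (simp_all add: add_in_S)
  have up: "mon (s + t) \<in> P" "mon (t + s) \<in> P" if "mon s \<in> P" "s \<in> S" "t \<in> S" for s t
    using that sum_iff P.I_l_closed[of "mon s" "mon t"] P.I_r_closed[of "mon s" "mon t"] by simp_all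
  have prime_mon: "mon s \<in> P \<or> mon t \<in> P" if st: "s \<in> S" "t \<in> S" "mon (s + t) \<in> P" for s t
  proof -
    \<comment> \<open>\<open>I s\<close> is the ideal generated by the monomial of degree
      \<open>s\<close>: its elements are supported on \<open>s + S\<close>. Being spanned by
      monomials it is invariant, and products from \<open>I s\<close> and \<open>I t\<close> have
      degrees in \<open>s + t + S\<close>.\<close>
    define I where "I s = {f \<in> carrier A. \<forall>w. f w \<noteq> \<zero> \<longrightarrow> w - s \<in> S}" for s
    have I: "ideal (I s) A" "H_invariant H act (I s)" if s: "s \<in> S" for s
    proof -
      show "ideal (I s) A"
      proof (rule ideal_if_closed_monomial)
        fix f a u assume f: "f \<in> I s" and a: "a \<in> carrier K" and u: "u \<in> carrier (additive_monoid S)"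
        then have fA: "f \<in> carrier A" and u: "u \<in> S" by (auto simp: I_def)
        have "w - s \<in> S" if "f (w - u) \<noteq> \<zero>" for w
          using f that add_in_S[of "w - u - s" u] u by (auto simp: I_def)
        then show "monomial K a u \<otimes>\<^bsub>A\<^esub> f \<in> I s" "f \<otimes>\<^bsub>A\<^esub> monomial K a u \<in> I s"
          using a u fA coeff_closed[OF fA]
          by (auto simp: I_def monomial_mult_apply[OF fA a u] mult_monomial_apply[OF fA a u] integral_iff)
      next
        fix f g assume f: "f \<in> I s" and g: "g \<in> I s"
        have "w - s \<in> S" if "f w \<oplus> g w \<noteq> \<zero>" for w
        proof (cases "f w = \<zero>")
          case True
          then show ?thesis using that g coeff_closed[of g w] by (auto simp: I_def)
        qed (use f in \<open>auto simp: I_def\<close>)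
        then show "f \<oplus>\<^bsub>A\<^esub> g \<in> I s"
          using f g add_closed[of f g] by (auto simp: I_def add_eq)
      qed (auto simp: I_def zero_in_A)
      show "H_invariant H act (I s)"
      proof (rule H_invariantI)
        fix h f assume "h \<in> carrier H" "f \<in> I s"
        then show "act h f \<in> I s" using act_closed[of h f] by (auto simp: I_def) (metis char_closed r_null)
      qed (auto simp: I_def)
    qed
    have "\<forall>i\<in>I s. \<forall>j\<in>I t. i \<otimes>\<^bsub>A\<^esub> j \<in> P"
    proof (intro ballI)
      fix i j assume i: "i \<in> I s" and j: "j \<in> I t"
      then have A: "i \<in> carrier A" "j \<in> carrier A" by (auto simp: I_def)
      show "i \<otimes>\<^bsub>A\<^esub> j \<in> P"
      proof (rule mem_ideal_if_monomials_mem[OF P(1)])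
        fix w assume "(i \<otimes>\<^bsub>A\<^esub> j) w \<noteq> \<zero>"
        then obtain u v where "i u \<noteq> \<zero>" "j v \<noteq> \<zero>" "w = u + v" using mult_nonzeroD[OF A] by auto
        moreover from this have "u - s \<in> S" "v - t \<in> S" using i j by (auto simp: I_def)
        ultimately have "w = (s + t) + ((u - s) + (v - t))" "(u - s) + (v - t) \<in> S"
          by (auto simp: add_in_S)
        then show "mon w \<in> P" using up(1)[OF st(3)] st add_in_S by metis
      qed (use A in simp)
    qed
    then have "I s \<subseteq> P \<or> I t \<subseteq> P" using prime I st by blast
    moreover have "mon s \<in> I s" if "s \<in> S" for s using that by (auto simp: I_def, simp add: monomial_def split: if_splits)
    ultimately show ?thesis using st by blast
  qed
  have "mon 0 \<notin> P"
  proof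
    assume "mon 0 \<in> P"
    then have "\<one>\<^bsub>A\<^esub> \<in> P" by (simp add: one_eq)
    then show False using P.one_imp_carrier P(2) by blast
  qed
  moreover have "s + t \<in> ?F \<longleftrightarrow> s \<in> ?F \<and> t \<in> ?F" if "s \<in> S" "t \<in> S" for s t
    using that up(1)[of s t] up(2)[of t s] prime_mon[of s t] add_in_S[of s t] by auto
  ultimately have "face ?F" unfolding face_def by auto
  with eq show ?thesis by blast
qed

lemma H_primes_eq: "{P. H_prime H act A P} = face_ideal ` {F. face F}"
  using H_prime_face_ideal H_prime_is_face_ideal by blast

lemma inj_on_face_ideal: "inj_on face_ideal {F. face F}"
proof (rule inj_onI, clarsimp)
  fix F G assume "face F" "face G" "face_ideal F = face_ideal G"
  then have "s \<in> F \<longleftrightarrow> s \<in> G" if "s \<in> S" for s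
    using that mon_in_face_ideal_iff[of F s] mon_in_face_ideal_iff[of G s] by simp
  then show "F = G" using \<open>face F\<close> \<open>face G\<close> faceD(1) by blast
qed

lemma card_H_primes: "card {P. H_prime H act A P} = card {F. face F}"
  unfolding H_primes_eq by (rule card_image[OF inj_on_face_ideal])

text \<open>The intersection of the translates of \<open>P\<close> is the span of the monomials in
  \<open>P\<close>: it is stable under the torus and therefore contains the monomials of its
  elements, while monomials are eigenvectors and hence stay in every translate. So the stratum is
  determined by which monomials a prime contains.\<close>

lemma H_stratum_face_ideal:
  assumes F: "face F"
  shows "H_stratum H act A (face_ideal F) = {P \<in> Spec A. \<forall>s\<in>S. mon s \<in> P \<longleftrightarrow> s \<notin> F}"
proof -
  have inter: "(\<Inter>h\<in>carrier H. act h ` P) = face_ideal {s \<in> S. mon s \<notin> P}" if P: "ideal P A" for P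
  proof -
    let ?V = "\<Inter>h\<in>carrier H. act h ` P"
    \<comment> \<open>Replacing \<open>h\<close> by its inverse turns membership in all translates
      of \<open>P\<close> into a condition on the translates of \<open>f\<close>.\<close>
    have VI: "f \<in> ?V \<longleftrightarrow> f \<in> carrier A \<and> (\<forall>h\<in>carrier H. act h f \<in> P)" for f
    proof
      assume f: "f \<in> ?V"
      obtain h0 where "h0 \<in> carrier H" using H_nonempty by blast
      then have fA: "f \<in> carrier A" using f act_closed ideal_subset_carrier[OF P] by blast
      have "act h f \<in> P" if h: "h \<in> carrier H" for h
      proof -
        obtain h' where h': "h' \<in> carrier H" "\<forall>s\<in>S. char h' s \<otimes> char h s = \<one>" using char_inverse[OF h] by blast
        obtain g where g: "g \<in> P" "f = act h' g" using f h' by blast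
        then have "act h f = g" using act_act_inverse(2)[OF h h'] ideal_subset_carrier[OF P] by blast
        then show ?thesis using g by simp
      qed
      with fA show "f \<in> carrier A \<and> (\<forall>h\<in>carrier H. act h f \<in> P)" by blast
    next
      assume f: "f \<in> carrier A \<and> (\<forall>h\<in>carrier H. act h f \<in> P)"
      show "f \<in> ?V"
      proof
        fix h assume h: "h \<in> carrier H"
        obtain h' where h': "h' \<in> carrier H" "\<forall>s\<in>S. char h' s \<otimes> char h s = \<one>" using char_inverse[OF h] by blast
        have "f = act h (act h' f)" using act_act_inverse(2)[OF h h'] f by simp
        then show "f \<in> act h ` P" using f h' by (intro image_eqI[of _ _ "act h' f"]) auto
      qed
    qed
    show ?thesis
    proof (intro equalityI subsetI)
      fix f assume f: "f \<in> ?V"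
      then have fA: "f \<in> carrier A" using VI by blast
      have "mon s \<in> P" if nz: "f s \<noteq> \<zero>" for s
      proof -
        have "mon s \<in> ?V"
        proof (rule mon_mem_if_stable[OF _ _ _ _ f nz])
          show "?V \<subseteq> carrier A" using VI by blast
        next
          fix f g assume fg: "f \<in> ?V" "g \<in> ?V"
          then have A: "f \<in> carrier A" "g \<in> carrier A" using VI by blast+
          note K = coeff_closed[OF A(1)] coeff_closed[OF A(2)]
          have "(\<lambda>w. char h w \<otimes> (f w \<ominus> g w)) \<in> P" if h: "h \<in> carrier H" for h
          proof -
            have "(\<lambda>w. char h w \<otimes> f w \<ominus> char h w \<otimes> g w) \<in> P"
              using VI[THEN iffD1, OF fg(1)] VI[THEN iffD1, OF fg(2)] h by (intro ideal_diff[OF P]) simp_all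
            moreover have "char h w \<otimes> f w \<ominus> char h w \<otimes> g w = char h w \<otimes> (f w \<ominus> g w)" for w
              using K h by (simp add: a_minus_def r_distr r_minus)
            ultimately show ?thesis by simp
          qed
          moreover have "(\<lambda>w. f w \<ominus> g w) \<in> carrier A"
            using A.minus_closed[OF A] by (simp add: conv_minus_eq A)
          ultimately show "(\<lambda>w. f w \<ominus> g w) \<in> ?V" by (simp only: VI) simp
        next
          fix a f assume a: "a \<in> carrier K" and f: "f \<in> ?V"
          then have fA: "f \<in> carrier A" using VI by blast
          have "(\<lambda>w. char h w \<otimes> (a \<otimes> f w)) \<in> P" if h: "h \<in> carrier H" for h
          proof -
            have "smult a (act h f) \<in> P" using f a h VI by (intro ideal_smult[OF P]) auto
            moreover have "a \<otimes> (char h w \<otimes> f w) = char h w \<otimes> (a \<otimes> f w)" for w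
              using h a coeff_closed[OF fA] by (simp add: m_lcomm)
            ultimately show ?thesis by simp
          qed
          then show "smult a f \<in> ?V" using smult_closed[OF fA a] by (simp only: VI) simp
        next
          fix h f assume h: "h \<in> carrier H" and f: "f \<in> ?V"
          then have fA: "f \<in> carrier A" using VI by blast
          have "act h' (act h f) \<in> P" if h': "h' \<in> carrier H" for h'
          proof -
            obtain h'' where h'': "h'' \<in> carrier H" "\<forall>s\<in>S. char h'' s = char h' s \<otimes> char h s"
              using char_mult[OF h' h] by blast
            have "act h'' f \<in> P" using f h'' VI by blast
            moreover have "char h'' w \<otimes> f w = char h' w \<otimes> (char h w \<otimes> f w)" for w
              using h h' h'' supp_in_S[OF fA, of w] coeff_closed[OF fA, of w]
              by (cases "f w = \<zero>") (simp_all add: m_assoc)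
            ultimately show ?thesis by simp
          qed
          then show "act h f \<in> ?V" using act_closed[OF h fA] by (simp only: VI) simp
        qed
        then obtain h where h: "h \<in> carrier H" "act h (mon s) \<in> P" using VI H_nonempty by blast
        obtain h' where h': "h' \<in> carrier H" "\<forall>s\<in>S. char h' s \<otimes> char h s = \<one>" using char_inverse[OF h(1)] by blast
        have s: "s \<in> S" using supp_in_S[OF fA nz] .
        then have "char h s \<noteq> \<zero>" using h' by force
        moreover have "act h (mon s) = monomial K (char h s) s" using h by (auto simp: monomial_def)
        ultimately show ?thesis using h s ideal_mon_iff[OF P, of "char h s" s] by simp
      qed
      then show "f \<in> face_ideal {s \<in> S. mon s \<notin> P}" using fA by (auto simp: face_ideal_def)
    next
      fix f assume f: "f \<in> face_ideal {s \<in> S. mon s \<notin> P}"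
      then have fA: "f \<in> carrier A" by (simp add: face_ideal_def)
      have "act h f \<in> P" if h: "h \<in> carrier H" for h
      proof (rule mem_ideal_if_monomials_mem[OF P act_closed[OF h fA]])
        fix s assume "act h f s \<noteq> \<zero>"
        then have "f s \<noteq> \<zero>" using h by auto
        then show "mon s \<in> P" using f supp_in_S[OF fA] by (auto simp: face_ideal_def)
      qed
      then show "f \<in> ?V" using VI fA by blast
    qed
  qed
  have eq_iff: "face_ideal {s \<in> S. mon s \<notin> P} = face_ideal F \<longleftrightarrow> (\<forall>s\<in>S. mon s \<in> P \<longleftrightarrow> s \<notin> F)" if P: "ideal P A" for P
  proof
    have mem: "mon s \<in> face_ideal {s \<in> S. mon s \<notin> P} \<longleftrightarrow> mon s \<in> P" if "s \<in> S" for s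
      using that by (auto simp: face_ideal_def, auto simp: monomial_def split: if_splits)
    assume "face_ideal {s \<in> S. mon s \<notin> P} = face_ideal F"
    then show "\<forall>s\<in>S. mon s \<in> P \<longleftrightarrow> s \<notin> F" using mem mon_in_face_ideal_iff[OF F] by auto
  next
    assume "\<forall>s\<in>S. mon s \<in> P \<longleftrightarrow> s \<notin> F"
    then have "{s \<in> S. mon s \<notin> P} = F" using faceD(1)[OF F] by blast
    then show "face_ideal {s \<in> S. mon s \<notin> P} = face_ideal F" by simp
  qed
  have "ideal P A" if "P \<in> Spec A" for P using that by (simp add: Spec_def prime_ideal_def)
  then show ?thesis
    unfolding H_stratum_def by (intro Collect_cong conj_cong refl) (simp only: inter eq_iff)
qed

end

subsection \<open>Strata as spectra of Laurent polynomial rings\<close>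

text \<open>\<open>\<theta>\<close> identifies the integer vectors of length \<open>r\<close> with
  the degrees in \<open>F - F\<close> whose monomials commute with those of \<open>F\<close>. The
  assumption on \<open>\<delta>\<close> says that the rescaled monomials
  \<open>v_x = \<chi> (\<delta> x) u_(\<theta> x)\<close> satisfy
  \<open>v_x v_y = v_(x + y)\<close>, that is, \<open>\<delta>\<close> splits the cocycle on this
  lattice.\<close>

locale twisted_stratum = twisted_algebra K \<chi> \<beta> S
  for K :: "('a, 'b) ring_scheme" (structure) and \<chi> and \<beta> :: "'g::linordered_ab_group_add \<Rightarrow> 'g \<Rightarrow> int" and S +
  fixes F :: "'g set" and r :: nat and \<theta> :: "(nat \<Rightarrow>\<^sub>0 int) \<Rightarrow> 'g" and \<delta> :: "(nat \<Rightarrow>\<^sub>0 int) \<Rightarrow> int"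
  assumes F: "face F"
    and \<theta>_add: "\<theta> (x + y) = \<theta> x + \<theta> y"
    and \<theta>_inj: "inj_on \<theta> {c. Poly_Mapping.keys c \<subseteq> {..<r}}"
    and \<theta>_image: "\<theta> ` {c. Poly_Mapping.keys c \<subseteq> {..<r}} =
      {g. (\<exists>a\<in>F. \<exists>b\<in>F. g = a - b) \<and> (\<forall>h\<in>F. \<chi> (\<beta> h g) = \<chi> (\<beta> g h))}"
    and \<delta>: "Poly_Mapping.keys x \<subseteq> {..<r} \<Longrightarrow> Poly_Mapping.keys y \<subseteq> {..<r} \<Longrightarrow>
      \<chi> (\<delta> (x + y)) = \<chi> (\<delta> x + \<delta> y + \<beta> (\<theta> x) (\<theta> y))"
begin

abbreviation N :: "(nat \<Rightarrow>\<^sub>0 int) set" where "N \<equiv> {c. Poly_Mapping.keys c \<subseteq> {..<r}}"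

definition G :: "'g set" where "G = {a - b | a b. a \<in> F \<and> b \<in> F}"

definition Z :: "'g set" where "Z = \<theta> ` N"

abbreviation "L \<equiv> monoid_ring K (free_Abelian_group {..<r})"

lemma N_closed: "0 \<in> N" "x \<in> N \<Longrightarrow> y \<in> N \<Longrightarrow> x + y \<in> N" "x \<in> N \<Longrightarrow> - x \<in> N" "x \<in> N \<Longrightarrow> y \<in> N \<Longrightarrow> x - y \<in> N"
  using keys_add[of x y] keys_diff[of x y] by (auto simp: keys_minus)

lemma \<theta>_0 [simp]: "\<theta> 0 = 0"
  using \<theta>_add[of 0 0] by simp

lemma \<theta>_minus: "\<theta> (- x) = - \<theta> x"
  using \<theta>_add[of x "- x"] by (simp add: eq_neg_iff_add_eq_0 add.commute)

lemma \<theta>_diff: "\<theta> (x - y) = \<theta> x - \<theta> y"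
  using \<theta>_add[of x "- y"] by (simp add: \<theta>_minus)

lemma Z_closed: "0 \<in> Z" "x \<in> Z \<Longrightarrow> y \<in> Z \<Longrightarrow> x + y \<in> Z" "x \<in> Z \<Longrightarrow> y \<in> Z \<Longrightarrow> x - y \<in> Z" "x \<in> Z \<Longrightarrow> - x \<in> Z"
proof -
  show "0 \<in> Z" unfolding Z_def by (rule image_eqI[of _ _ 0]) (auto simp: N_closed)
  show "- x \<in> Z" if x: "x \<in> Z"
  proof -
    obtain a where "a \<in> N" "x = \<theta> a" using x unfolding Z_def by auto
    then show ?thesis unfolding Z_def using N_closed(3)[of a] by (intro image_eqI[of _ _ "- a"]) (auto simp: \<theta>_minus)
  qed
  show "x + y \<in> Z" if xy: "x \<in> Z" "y \<in> Z"
  proof -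
    obtain a where "a \<in> N" "x = \<theta> a" using xy(1) unfolding Z_def by auto
    moreover obtain b where "b \<in> N" "y = \<theta> b" using xy(2) unfolding Z_def by auto
    ultimately show ?thesis unfolding Z_def using N_closed(2)[of a b] by (intro image_eqI[of _ _ "a + b"]) (auto simp: \<theta>_add)
  qed
  show "x - y \<in> Z" if xy: "x \<in> Z" "y \<in> Z"
  proof -
    obtain a where "a \<in> N" "x = \<theta> a" using xy(1) unfolding Z_def by auto
    moreover obtain b where "b \<in> N" "y = \<theta> b" using xy(2) unfolding Z_def by auto
    ultimately show ?thesis unfolding Z_def using N_closed(4)[of a b] by (intro image_eqI[of _ _ "a - b"]) (auto simp: \<theta>_diff)
  qed
qed

lemma \<theta>_in_Z: "x \<in> N \<Longrightarrow> \<theta> x \<in> Z"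
  by (simp add: Z_def)

lemma Z_iff: "g \<in> Z \<longleftrightarrow> g \<in> G \<and> (\<forall>h\<in>F. \<chi> (\<beta> h g) = \<chi> (\<beta> g h))"
  unfolding Z_def \<theta>_image G_def by blast

lemma Z_subset_G: "g \<in> Z \<Longrightarrow> g \<in> G"
  by (simp add: Z_iff)

lemma F_subset_G: "s \<in> F \<Longrightarrow> s \<in> G"
  unfolding G_def using faceD(2)[OF F] by force

lemma G_closed: "0 \<in> G" "x \<in> G \<Longrightarrow> y \<in> G \<Longrightarrow> x + y \<in> G" "x \<in> G \<Longrightarrow> y \<in> G \<Longrightarrow> x - y \<in> G"
proof -
  show "0 \<in> G" by (rule F_subset_G[OF faceD(2)[OF F]])
  assume "x \<in> G" "y \<in> G"
  then obtain a b c d where *: "a \<in> F" "b \<in> F" "c \<in> F" "d \<in> F" "x = a - b" "y = c - d"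
    unfolding G_def by blast
  then have "x + y = (a + c) - (b + d)" "x - y = (a + d) - (b + c)" by simp_all
  then show "x + y \<in> G" "x - y \<in> G" unfolding G_def using * faceD(3)[OF F] by blast+
qed

text \<open>If \<open>x = a - b\<close>, then \<open>x + b\<close> lies in \<open>F\<close> with
  both summands in \<open>S\<close>, so the face property applies. As a consequence, coefficients
  indexed by \<open>G\<close> see an element of the algebra only through its restriction to
  \<open>F\<close>.\<close>

lemma G_inter_S:
  assumes "x \<in> G" "x \<in> S" shows "x \<in> F"
proof -
  obtain a b where ab: "a \<in> F" "b \<in> F" "x = a - b" using assms unfolding G_def by blast
  show ?thesis using faceD(4)[OF F assms(2), of b] faceD(1)[OF F] ab by simp
qed

lemma G_split: "x \<in> S \<Longrightarrow> y \<in> S \<Longrightarrow> x + y \<in> G \<Longrightarrow> x \<in> F \<and> y \<in> F"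
  using G_inter_S[of "x + y"] faceD(4,5)[OF F, of x y] add_in_S by blast

lemma G_denominator: "x \<in> G \<Longrightarrow> \<exists>b\<in>F. x + b \<in> F"
  unfolding G_def by force

text \<open>This replaces localization: finitely many degrees of \<open>G\<close> are moved into
  \<open>F\<close> by one shift.\<close>

lemma G_common_denominator:
  assumes "finite T" "T \<subseteq> G" shows "\<exists>b\<in>F. \<forall>x\<in>T. x + b \<in> F"
  using assms
proof (induction T rule: finite_induct)
  case empty
  then show ?case using faceD(2)[OF F] by blast
next
  case (insert y T)
  then obtain b c where "b \<in> F" "\<forall>x\<in>T. x + b \<in> F" "c \<in> F" "y + c \<in> F"
    using G_denominator[of y] by auto
  moreover have "x + (b + c) = (x + b) + c" "y + (b + c) = (y + c) + b" for x by (simp_all add: ac_simps)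
  ultimately have "b + c \<in> F" "\<forall>x\<in>insert y T. x + (b + c) \<in> F"
    using faceD(3)[OF F] by (metis insert_iff)+
  then show ?case by blast
qed

text \<open>Centrality is imposed against \<open>F\<close> only. Bilinearity of
  \<open>\<beta>\<close> extends it to differences of elements of \<open>F\<close>.\<close>

lemma \<chi>_central:
  assumes "t \<in> G" "z \<in> Z" shows "\<chi> (\<beta> t z) = \<chi> (\<beta> z t)"
proof -
  obtain a b where ab: "a \<in> F" "b \<in> F" "t = a - b" using assms(1) unfolding G_def by blast
  have *: "\<chi> (\<beta> a z) = \<chi> (\<beta> z a)" "\<chi> (\<beta> z b) = \<chi> (\<beta> b z)"
    using assms(2) ab unfolding Z_iff by simp_all
  have "\<chi> (\<beta> a z - \<beta> b z) = \<chi> (\<beta> z a - \<beta> b z)" by (rule \<chi>_cong[OF *(1)]) simp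
  also have "\<dots> = \<chi> (\<beta> z a - \<beta> z b)" by (rule \<chi>_cong[OF *(2)]) simp
  finally show ?thesis by (simp add: ab \<beta>_diff)
qed

sublocale L: twisted_product K "free_Abelian_group {..<r}" "\<lambda>_ _ a b. a \<otimes> b"
  rewrites "twisted_monoid_ring K (free_Abelian_group {..<r}) (\<lambda>_ _ a b. a \<otimes> b) = L"
  by (intro twisted_product.intro twisted_product_axioms.intro)
    (auto simp: ring_axioms l_distr r_distr m_assoc group.is_monoid monoid_ring_eq_twisted)

lemma L_monomial_mult:
  assumes "z \<in> carrier L" "a \<in> carrier K" "\<xi> \<in> N" "\<zeta> \<in> N"
  shows "(monomial K a \<xi> \<otimes>\<^bsub>L\<^esub> z) \<zeta> = a \<otimes> z (\<zeta> - \<xi>)"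
proof -
  have "(monomial K a \<xi> \<otimes>\<^bsub>L\<^esub> z) (\<xi> \<otimes>\<^bsub>free_Abelian_group {..<r}\<^esub> (\<zeta> - \<xi>)) = a \<otimes> z (\<zeta> - \<xi>)"
    using assms N_closed(4)[of \<zeta> \<xi>] by (intro L.monomial_mult_cancel) auto
  then show ?thesis by simp
qed

lemma L_smult_eq:
  assumes "z \<in> carrier L" "a \<in> carrier K" shows "(\<lambda>\<zeta>. a \<otimes> z \<zeta>) = monomial K a 0 \<otimes>\<^bsub>L\<^esub> z"
proof
  fix \<zeta>
  have c: "monomial K a 0 \<otimes>\<^bsub>L\<^esub> z \<in> carrier L" using assms by simp
  show "a \<otimes> z \<zeta> = (monomial K a 0 \<otimes>\<^bsub>L\<^esub> z) \<zeta>"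
  proof (cases "\<zeta> \<in> N")
    case True
    then show ?thesis using L_monomial_mult[OF assms, of 0 \<zeta>] by simp
  next
    case False
    then have "z \<zeta> = \<zero>" "(monomial K a 0 \<otimes>\<^bsub>L\<^esub> z) \<zeta> = \<zero>"
      using L.supp_subset[OF assms(1)] L.supp_subset[OF c] by fastforce+
    then show ?thesis using assms(2) by simp
  qed
qed

lemma L_ideal_smult: "ideal Q L \<Longrightarrow> z \<in> Q \<Longrightarrow> a \<in> carrier K \<Longrightarrow> (\<lambda>\<zeta>. a \<otimes> z \<zeta>) \<in> Q"
  using L_smult_eq[of z a] ideal_subset_carrier[of Q L] ideal.I_l_closed[of Q L z "monomial K a 0"]
  by auto

lemma L_ideal_smult_iff:
  assumes "ideal Q L" "z \<in> carrier L" "a \<in> carrier K" "a \<noteq> \<zero>"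
  shows "(\<lambda>\<zeta>. a \<otimes> z \<zeta>) \<in> Q \<longleftrightarrow> z \<in> Q"
proof
  assume "(\<lambda>\<zeta>. a \<otimes> z \<zeta>) \<in> Q"
  then have mem: "(\<lambda>\<zeta>. inv a \<otimes> (a \<otimes> z \<zeta>)) \<in> Q"
    by (rule L_ideal_smult[OF assms(1)]) (use assms in \<open>simp add: field_Units\<close>)
  have eq: "(\<lambda>\<zeta>. inv a \<otimes> (a \<otimes> z \<zeta>)) = z"
    using assms L.coeff_closed[OF assms(2)] by (simp add: field_Units flip: m_assoc)
  show "z \<in> Q" by (rule back_subst[of "\<lambda>x. x \<in> Q", OF mem eq])
qed (use L_ideal_smult assms in blast)

lemma L_ideal_zero: "ideal Q L \<Longrightarrow> (\<lambda>_. \<zero>) \<in> Q"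
  using additive_subgroup.zero_closed[OF ideal.axioms(1), of Q L] by (simp add: L.zero_eq)

text \<open>If \<open>v\<^sub>\<zeta> = \<chi> (\<delta> \<zeta>) u\<^bsub>\<theta> \<zeta>\<^esub>\<close> are the central monomials spanning the copy of \<open>L\<close> in the
  twisted group algebra of \<open>G\<close>, then the part of \<open>f\<close> in the coset \<open>x + Z\<close> is
  \<open>u\<^sub>x\<close> times the image of \<open>coef f x\<close>.\<close>

definition coef :: "('g \<Rightarrow> 'a) \<Rightarrow> 'g \<Rightarrow> (nat \<Rightarrow>\<^sub>0 int) \<Rightarrow> 'a" where
  "coef f x = (\<lambda>\<zeta>. if \<zeta> \<in> N then \<chi> (- \<delta> \<zeta> - \<beta> x (\<theta> \<zeta>)) \<otimes> f (x + \<theta> \<zeta>) else \<zero>)"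

text \<open>The twisted group algebra of \<open>G\<close> is free over its central Laurent subring,
  with one basis monomial for each coset of \<open>Z\<close>. An element thus lies in the ideal
  generated by \<open>Q\<close> exactly if all its coefficients lie in \<open>Q\<close>, and this
  set is the preimage of that ideal under restriction to \<open>F\<close>. All \<open>x\<close> in
  \<open>G\<close> are allowed, so that no coset representatives are chosen.\<close>

definition contraction :: "((nat \<Rightarrow>\<^sub>0 int) \<Rightarrow> 'a) set \<Rightarrow> ('g \<Rightarrow> 'a) set" where
  "contraction Q = {f \<in> carrier A. \<forall>x\<in>G. coef f x \<in> Q}"

lemma coef_closed:
  assumes f: "f \<in> carrier A" shows "coef f x \<in> carrier L"
proof (rule L.carrierI[where S = "{\<zeta> \<in> N. f (x + \<theta> \<zeta>) \<noteq> \<zero>}"])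
  have "inj_on (\<lambda>\<zeta>. x + \<theta> \<zeta>) {\<zeta> \<in> N. f (x + \<theta> \<zeta>) \<noteq> \<zero>}"
    using \<theta>_inj by (auto simp: inj_on_def)
  moreover have "finite ((\<lambda>\<zeta>. x + \<theta> \<zeta>) ` {\<zeta> \<in> N. f (x + \<theta> \<zeta>) \<noteq> \<zero>})"
    by (rule finite_subset[OF _ finite_supp[OF f]]) auto
  ultimately show "finite {\<zeta> \<in> N. f (x + \<theta> \<zeta>) \<noteq> \<zero>}" by (rule finite_imageD[rotated])
qed (use coeff_closed[OF f] in \<open>auto simp: coef_def\<close>)

lemma coef_add:
  assumes "f \<in> carrier A" "g \<in> carrier A"
  shows "coef (f \<oplus>\<^bsub>A\<^esub> g) x = coef f x \<oplus>\<^bsub>L\<^esub> coef g x"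
  using coeff_closed[OF assms(1)] coeff_closed[OF assms(2)]
  by (auto simp: coef_def add_eq L.add_eq r_distr)

lemma coef_monomial_mult:
  assumes f: "f \<in> carrier A" and a: "a \<in> carrier K" and t: "t \<in> F"
  shows "coef (monomial K a t \<otimes>\<^bsub>A\<^esub> f) x = (\<lambda>\<zeta>. (\<chi> (\<beta> t (x - t)) \<otimes> a) \<otimes> coef f (x - t) \<zeta>)"
proof
  fix \<zeta>
  note K = coeff_closed[OF f]
  have *: "x + \<theta> \<zeta> - t = x - t + \<theta> \<zeta>" by simp
  have "\<chi> (- \<delta> \<zeta> - \<beta> x (\<theta> \<zeta>)) \<otimes> (\<chi> (\<beta> t (x - t + \<theta> \<zeta>)) \<otimes> (a \<otimes> f (x - t + \<theta> \<zeta>))) =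
     \<chi> (\<beta> t (x - t)) \<otimes> a \<otimes> (\<chi> (- \<delta> \<zeta> - \<beta> (x - t) (\<theta> \<zeta>)) \<otimes> f (x - t + \<theta> \<zeta>))"
  proof -
    have "\<chi> (\<beta> t (x - t)) \<otimes> a \<otimes> (\<chi> (- \<delta> \<zeta> - \<beta> (x - t) (\<theta> \<zeta>)) \<otimes> f (x - t + \<theta> \<zeta>)) =
      \<chi> (\<beta> t (x - t)) \<otimes> (\<chi> (- \<delta> \<zeta> - \<beta> (x - t) (\<theta> \<zeta>)) \<otimes> (a \<otimes> f (x - t + \<theta> \<zeta>)))"
      using a K by (simp add: m_ac)
    then show ?thesis using a K by (simp add: \<chi>_mult_mult \<beta>_simps algebra_simps)
  qed
  then show "coef (monomial K a t \<otimes>\<^bsub>A\<^esub> f) x \<zeta> = \<chi> (\<beta> t (x - t)) \<otimes> a \<otimes> coef f (x - t) \<zeta>"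
    using a faceD(1)[OF F t] unfolding coef_def by (simp add: monomial_mult_apply[OF f] *)
qed

text \<open>In contrast to multiplication from the left, the monomial has to be moved past the
  Laurent part. This costs no factor because degrees in \<open>Z\<close> are central.\<close>

lemma coef_mult_monomial:
  assumes f: "f \<in> carrier A" and a: "a \<in> carrier K" and t: "t \<in> F"
  shows "coef (f \<otimes>\<^bsub>A\<^esub> monomial K a t) x = (\<lambda>\<zeta>. (\<chi> (\<beta> (x - t) t) \<otimes> a) \<otimes> coef f (x - t) \<zeta>)"
proof
  fix \<zeta>
  note K = coeff_closed[OF f]
  have *: "x + \<theta> \<zeta> - t = x - t + \<theta> \<zeta>" by simp
  have "\<chi> (- \<delta> \<zeta> - \<beta> x (\<theta> \<zeta>)) \<otimes> (\<chi> (\<beta> (x - t + \<theta> \<zeta>) t) \<otimes> (f (x - t + \<theta> \<zeta>) \<otimes> a)) =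
     \<chi> (\<beta> (x - t) t) \<otimes> a \<otimes> (\<chi> (- \<delta> \<zeta> - \<beta> (x - t) (\<theta> \<zeta>)) \<otimes> f (x - t + \<theta> \<zeta>))" if \<zeta>: "\<zeta> \<in> N"
  proof -
    have "\<chi> (\<beta> (x - t) t) \<otimes> a \<otimes> (\<chi> (- \<delta> \<zeta> - \<beta> (x - t) (\<theta> \<zeta>)) \<otimes> f (x - t + \<theta> \<zeta>)) =
      \<chi> (\<beta> (x - t) t) \<otimes> (\<chi> (- \<delta> \<zeta> - \<beta> (x - t) (\<theta> \<zeta>)) \<otimes> (f (x - t + \<theta> \<zeta>) \<otimes> a))"
      using a K by (simp add: m_ac)
    moreover have "\<chi> (- \<delta> \<zeta> - \<beta> x (\<theta> \<zeta>) + \<beta> (x - t + \<theta> \<zeta>) t) = \<chi> (\<beta> (x - t) t + (- \<delta> \<zeta> - \<beta> (x - t) (\<theta> \<zeta>)))"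
      by (rule \<chi>_cong[OF \<chi>_central[OF F_subset_G[OF t] \<theta>_in_Z[OF \<zeta>], symmetric]]) (simp add: \<beta>_simps)
    ultimately show ?thesis using a K by (simp add: \<chi>_mult_mult)
  qed
  then show "coef (f \<otimes>\<^bsub>A\<^esub> monomial K a t) x \<zeta> = \<chi> (\<beta> (x - t) t) \<otimes> a \<otimes> coef f (x - t) \<zeta>"
    using a faceD(1)[OF F t] unfolding coef_def by (simp add: mult_monomial_apply[OF f] *)
qed

text \<open>A contributing term would write a degree of \<open>G\<close> as a sum of two degrees of
  \<open>S\<close>, one of them \<open>t\<close>, and this forces \<open>t\<close> into
  \<open>F\<close>.\<close>

lemma coef_monomial_mult_outside:
  assumes f: "f \<in> carrier A" and a: "a \<in> carrier K" and t: "t \<in> S" "t \<notin> F" and x: "x \<in> G"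
  shows "coef (monomial K a t \<otimes>\<^bsub>A\<^esub> f) x = (\<lambda>_. \<zero>)" "coef (f \<otimes>\<^bsub>A\<^esub> monomial K a t) x = (\<lambda>_. \<zero>)"
proof -
  have "f (x + \<theta> \<zeta> - t) = \<zero>" if "\<zeta> \<in> N" for \<zeta>
  proof (rule ccontr)
    assume "f (x + \<theta> \<zeta> - t) \<noteq> \<zero>"
    then have "x + \<theta> \<zeta> - t \<in> S" by (rule supp_in_S[OF f])
    moreover have "(x + \<theta> \<zeta> - t) + t \<in> G" using G_closed(2)[OF x Z_subset_G[OF \<theta>_in_Z[OF that]]] by simp
    ultimately show False using G_split[of "x + \<theta> \<zeta> - t" t] t by blast
  qed
  then show "coef (monomial K a t \<otimes>\<^bsub>A\<^esub> f) x = (\<lambda>_. \<zero>)" "coef (f \<otimes>\<^bsub>A\<^esub> monomial K a t) x = (\<lambda>_. \<zero>)"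
    using a t by (auto simp: coef_def monomial_mult_apply[OF f] mult_monomial_apply[OF f])
qed

text \<open>Changing the representative of a coset multiplies the coefficient by a power of
  \<open>q\<close> and a Laurent monomial. Both are units, so membership in an ideal depends on the
  coset alone.\<close>

lemma coef_translate:
  assumes f: "f \<in> carrier A" and \<xi>: "\<xi> \<in> N"
  shows "coef f (x + \<theta> \<xi>) = (\<lambda>\<zeta>. \<chi> (\<delta> \<xi> + \<beta> x (\<theta> \<xi>)) \<otimes> (monomial K \<one> (- \<xi>) \<otimes>\<^bsub>L\<^esub> coef f x) \<zeta>)"
proof
  fix \<zeta>
  note K = coeff_closed[OF f]
  have c: "monomial K \<one> (- \<xi>) \<otimes>\<^bsub>L\<^esub> coef f x \<in> carrier L"
    using coef_closed[OF f] \<xi> by (simp add: keys_minus)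
  show "coef f (x + \<theta> \<xi>) \<zeta> = \<chi> (\<delta> \<xi> + \<beta> x (\<theta> \<xi>)) \<otimes> (monomial K \<one> (- \<xi>) \<otimes>\<^bsub>L\<^esub> coef f x) \<zeta>"
  proof (cases "\<zeta> \<in> N")
    case False
    then have "(monomial K \<one> (- \<xi>) \<otimes>\<^bsub>L\<^esub> coef f x) \<zeta> = \<zero>"
      using L.supp_subset[OF c, of \<zeta>] by auto
    then show ?thesis using False by (auto simp: coef_def)
  next
    case True
    have *: "(monomial K \<one> (- \<xi>) \<otimes>\<^bsub>L\<^esub> coef f x) \<zeta> = coef f x (\<zeta> + \<xi>)"
      using L_monomial_mult[OF coef_closed[OF f] one_closed N_closed(3)[OF \<xi>] True]
        L.coeff_closed[OF coef_closed[OF f]] by simp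
    have "\<chi> (- \<delta> \<zeta> - \<beta> (x + \<theta> \<xi>) (\<theta> \<zeta>)) = \<chi> (\<delta> \<xi> + \<beta> x (\<theta> \<xi>) + (- \<delta> (\<zeta> + \<xi>) - \<beta> x (\<theta> \<zeta> + \<theta> \<xi>)))"
      using \<xi> True by (intro \<chi>_cong[OF \<delta>[of \<xi> \<zeta>]]) (auto simp: \<beta>_simps add.commute)
    then show ?thesis using True \<xi> N_closed(2)[OF True \<xi>] K
      unfolding * by (simp add: coef_def \<chi>_mult_mult \<theta>_add ac_simps)
  qed
qed

text \<open>Multiplying by a monomial with degree \<open>t\<close> in \<open>F\<close> shifts the
  index of the coefficients by \<open>t\<close> and scales them; a monomial off \<open>F\<close>
  makes them vanish.\<close>

lemma contraction_ideal:
  assumes Q: "ideal Q L" shows "ideal (contraction Q) A"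
proof (rule ideal_if_closed_monomial)
  show "(\<lambda>_. \<zero>) \<in> contraction Q"
    using zero_in_A L_ideal_zero[OF Q] by (auto simp: contraction_def coef_def if_distrib cong: if_cong)
next
  fix f g assume "f \<in> contraction Q" "g \<in> contraction Q"
  then show "f \<oplus>\<^bsub>A\<^esub> g \<in> contraction Q"
    using L.A.ideal_a_closed[OF Q] add_closed[of f g] by (auto simp: contraction_def coef_add)
next
  fix f a t assume f: "f \<in> contraction Q" and a: "a \<in> carrier K" and "t \<in> carrier (additive_monoid S)"
  then have t: "t \<in> S" and fA: "f \<in> carrier A" and fQ: "\<And>x. x \<in> G \<Longrightarrow> coef f x \<in> Q"
    by (auto simp: contraction_def)
  have "coef (monomial K a t \<otimes>\<^bsub>A\<^esub> f) x \<in> Q \<and> coef (f \<otimes>\<^bsub>A\<^esub> monomial K a t) x \<in> Q" if x: "x \<in> G" for x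
  proof (cases "t \<in> F")
    case True
    then have "coef f (x - t) \<in> Q" using fQ G_closed(3)[OF x F_subset_G] by blast
    then show ?thesis
      unfolding coef_monomial_mult[OF fA a True] coef_mult_monomial[OF fA a True]
      using a by (intro conjI L_ideal_smult[OF Q]) auto
  next
    case False
    then show ?thesis using coef_monomial_mult_outside[OF fA a t False x] L_ideal_zero[OF Q] by simp
  qed
  moreover have "monomial K a t \<otimes>\<^bsub>A\<^esub> f \<in> carrier A" "f \<otimes>\<^bsub>A\<^esub> monomial K a t \<in> carrier A"
    using fA a t by simp_all
  ultimately show "monomial K a t \<otimes>\<^bsub>A\<^esub> f \<in> contraction Q" "f \<otimes>\<^bsub>A\<^esub> monomial K a t \<in> contraction Q"
    by (simp_all add: contraction_def)
qed (auto simp: contraction_def)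

section \<open>Elements supported on a single coset of \<open>Z\<close>\<close>

text \<open>The condition ignores monomials of degree outside \<open>F\<close>, which lie in every
  contraction. The stronger \<open>full\<close> excludes them as well, and is used where an element
  of the algebra itself must behave like an element of the twisted group algebra.\<close>

definition on_coset :: "('g \<Rightarrow> 'a) \<Rightarrow> 'g \<Rightarrow> bool" where
  "on_coset f x \<longleftrightarrow> (\<forall>y\<in>G. f y \<noteq> \<zero> \<longrightarrow> y - x \<in> Z)"

definition full :: "('g \<Rightarrow> 'a) \<Rightarrow> 'g \<Rightarrow> bool" where
  "full f x \<longleftrightarrow> (\<forall>y. f y \<noteq> \<zero> \<longrightarrow> y \<in> F \<and> y - x \<in> Z)"

lemma full_on_coset: "full f x \<Longrightarrow> on_coset f x"
  by (simp add: full_def on_coset_def)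

text \<open>The element is the monomial of degree \<open>x\<close> times the image of
  \<open>z\<close> in the twisted group algebra, where \<open>x\<close> is a common denominator that
  moves all degrees of this image into \<open>F\<close>.\<close>

lemma lift_exists:
  assumes z: "z \<in> carrier L"
  obtains f x where "f \<in> carrier A" "x \<in> F" "coef f x = z" "full f x"
proof -
  have supp_N: "\<zeta> \<in> N" if "z \<zeta> \<noteq> \<zero>" for \<zeta> using L.supp_subset[OF z that] by simp
  note K = L.coeff_closed[OF z]
  have "finite (\<theta> ` L.supp z)" "\<theta> ` L.supp z \<subseteq> G"
    using L.finite_supp[OF z] supp_N Z_subset_G \<theta>_in_Z by auto
  then obtain x where x: "x \<in> F" "\<forall>g\<in>\<theta> ` L.supp z. g + x \<in> F" using G_common_denominator by blast
  define f where "f y = (if y - x \<in> Z then (let \<zeta> = inv_into N \<theta> (y - x) in \<chi> (\<delta> \<zeta> + \<beta> x (\<theta> \<zeta>)) \<otimes> z \<zeta>) else \<zero>)" for y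
  have f_eq: "f (x + \<theta> \<zeta>) = \<chi> (\<delta> \<zeta> + \<beta> x (\<theta> \<zeta>)) \<otimes> z \<zeta>" if "\<zeta> \<in> N" for \<zeta>
    using that inv_into_f_f[OF \<theta>_inj that] \<theta>_in_Z[OF that] by (simp add: f_def)
  have f_nz: "\<exists>\<zeta>\<in>L.supp z. y = x + \<theta> \<zeta>" if "f y \<noteq> \<zero>" for y
  proof -
    have "y - x \<in> Z" using that by (simp add: f_def split: if_splits)
    then obtain \<zeta> where \<zeta>: "\<zeta> \<in> N" "y = x + \<theta> \<zeta>" unfolding Z_def by (auto simp: algebra_simps)
    then have "z \<zeta> \<noteq> \<zero>" using that f_eq by auto
    then show ?thesis using \<zeta> by blast
  qed
  show ?thesis
  proof
    show "f \<in> carrier A"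
    proof (rule carrierI[where S = "(\<lambda>\<zeta>. x + \<theta> \<zeta>) ` L.supp z"])
      show "f w \<in> carrier K" for w using K by (auto simp: f_def Let_def)
      show "(\<lambda>\<zeta>. x + \<theta> \<zeta>) ` L.supp z \<subseteq> carrier (additive_monoid S)"
        using x(2) faceD(1)[OF F] by (auto simp: add.commute)
    qed (use L.finite_supp[OF z] f_nz in auto)
    show "x \<in> F" by (rule x)
    show "coef f x = z"
    proof
      fix \<zeta> show "coef f x \<zeta> = z \<zeta>"
        using K supp_N[of \<zeta>] by (auto simp: coef_def f_eq \<chi>_mult_mult)
    qed
    have "y \<in> F \<and> y - x \<in> Z" if "f y \<noteq> \<zero>" for y
      using f_nz[OF that] x(2) supp_N \<theta>_in_Z by (auto simp: add.commute)
    then show "full f x" by (simp add: full_def)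
  qed
qed

text \<open>Laurent parts are central, so they can be collected on the right, and the monomials of
  degrees \<open>x\<close> and \<open>y\<close> multiply to \<open>\<chi> (\<beta> x y)\<close>
  times the one of degree \<open>x + y\<close>. In the convolution sum, \<open>h\<close> matches
  pairs of exponents with sum \<open>\<zeta>\<close> with pairs of degrees with sum
  \<open>?w\<close>; the face property together with \<open>on_coset\<close> excludes further
  pairs.\<close>

lemma coef_product:
  assumes f: "f \<in> carrier A" and g: "g \<in> carrier A" and x: "x \<in> G" and y: "y \<in> G"
    and fx: "on_coset f x" and gy: "on_coset g y"
  shows "coef (f \<otimes>\<^bsub>A\<^esub> g) (x + y) = (\<lambda>\<zeta>. \<chi> (\<beta> x y) \<otimes> (coef f x \<otimes>\<^bsub>L\<^esub> coef g y) \<zeta>)"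
proof
  fix \<zeta>
  note Kf = coeff_closed[OF f] and Kg = coeff_closed[OF g]
  have c: "coef f x \<otimes>\<^bsub>L\<^esub> coef g y \<in> carrier L" using coef_closed f g by simp
  show "coef (f \<otimes>\<^bsub>A\<^esub> g) (x + y) \<zeta> = \<chi> (\<beta> x y) \<otimes> (coef f x \<otimes>\<^bsub>L\<^esub> coef g y) \<zeta>"
  proof (cases "\<zeta> \<in> N")
    case False
    then have "(coef f x \<otimes>\<^bsub>L\<^esub> coef g y) \<zeta> = \<zero>" using L.supp_subset[OF c, of \<zeta>] by auto
    then show ?thesis using False by (auto simp: coef_def)
  next
    case True
    define W where "W = {(a, b). coef f x a \<noteq> \<zero> \<and> coef g y b \<noteq> \<zero> \<and> a + b = \<zeta>}"
    define h where "h = (\<lambda>(a, b). (x + \<theta> a, y + \<theta> b))"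
    let ?w = "x + y + \<theta> \<zeta>"
    have nz: "coef f x a \<noteq> \<zero> \<longleftrightarrow> a \<in> N \<and> f (x + \<theta> a) \<noteq> \<zero>" "coef g y a \<noteq> \<zero> \<longleftrightarrow> a \<in> N \<and> g (y + \<theta> a) \<noteq> \<zero>" for a
      using Kf Kg by (auto simp: coef_def)
    have "W \<subseteq> L.supp (coef f x) \<times> L.supp (coef g y)" by (auto simp: W_def)
    then have "finite W"
      using L.finite_supp[OF coef_closed[OF f, of x]] L.finite_supp[OF coef_closed[OF g, of y]]
      by (meson finite_SigmaI finite_subset)
    have "inj_on h W"
      using \<theta>_inj by (auto simp: W_def h_def nz inj_on_def)
    have img: "{(u, v). f u \<noteq> \<zero> \<and> g v \<noteq> \<zero> \<and> u + v = ?w} = h ` W"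
    proof (intro equalityI subsetI)
      fix p assume "p \<in> {(u, v). f u \<noteq> \<zero> \<and> g v \<noteq> \<zero> \<and> u + v = ?w}"
      then obtain u v where p: "p = (u, v)" "f u \<noteq> \<zero>" "g v \<noteq> \<zero>" "u + v = ?w" by blast
      have "?w \<in> G" by (intro G_closed(2) x y Z_subset_G \<theta>_in_Z True)
      then have "u \<in> F" "v \<in> F"
        using G_split[OF supp_in_S[OF f p(2)] supp_in_S[OF g p(3)]] p(4) by simp_all
      then have "u - x \<in> Z" "v - y \<in> Z" using fx gy p F_subset_G by (auto simp: on_coset_def)
      then obtain a b where ab: "a \<in> N" "b \<in> N" "u - x = \<theta> a" "v - y = \<theta> b" unfolding Z_def by auto
      then have uv: "u = x + \<theta> a" "v = y + \<theta> b" by (simp_all flip: ab(3,4))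
      have "\<theta> (a + b) = \<theta> \<zeta>" using p(4) by (simp add: uv \<theta>_add ac_simps)
      then have "a + b = \<zeta>" using inj_onD[OF \<theta>_inj] ab N_closed(2) True by blast
      then have "(a, b) \<in> W" using ab p uv by (auto simp: W_def nz)
      moreover have "p = h (a, b)" by (simp add: p uv h_def)
      ultimately show "p \<in> h ` W" by blast
    next
      fix p assume "p \<in> h ` W"
      then show "p \<in> {(u, v). f u \<noteq> \<zero> \<and> g v \<noteq> \<zero> \<and> u + v = ?w}"
        by (auto simp: W_def h_def nz \<theta>_add ac_simps)
    qed
    have "coef (f \<otimes>\<^bsub>A\<^esub> g) (x + y) \<zeta> = \<chi> (- \<delta> \<zeta> - \<beta> (x + y) (\<theta> \<zeta>)) \<otimes>
       finsum K (\<lambda>(u, v). \<chi> (\<beta> u v) \<otimes> (f u \<otimes> g v)) (h ` W)"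
      using True by (simp add: coef_def twisted_monoid_ring_def img)
    also have "finsum K (\<lambda>(u, v). \<chi> (\<beta> u v) \<otimes> (f u \<otimes> g v)) (h ` W) =
       (\<Oplus>p\<in>W. (\<lambda>(u, v). \<chi> (\<beta> u v) \<otimes> (f u \<otimes> g v)) (h p))"
      by (rule add.finprod_reindex) (use \<open>inj_on h W\<close> Kf Kg in auto)
    also have "\<chi> (- \<delta> \<zeta> - \<beta> (x + y) (\<theta> \<zeta>)) \<otimes> \<dots> =
       (\<Oplus>p\<in>W. \<chi> (- \<delta> \<zeta> - \<beta> (x + y) (\<theta> \<zeta>)) \<otimes> (\<lambda>(u, v). \<chi> (\<beta> u v) \<otimes> (f u \<otimes> g v)) (h p))"
      by (rule finsum_rdistr) (use \<open>finite W\<close> Kf Kg in \<open>auto simp: split_beta\<close>)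
    also have "\<dots> = (\<Oplus>p\<in>W. \<chi> (\<beta> x y) \<otimes> (\<lambda>(a, b). coef f x a \<otimes> coef g y b) p)"
    proof (rule add.finprod_cong', safe)
      fix a b assume "(a, b) \<in> W"
      then have ab: "a \<in> N" "b \<in> N" "\<zeta> = a + b" by (auto simp: W_def nz)
      have "\<chi> (- \<delta> \<zeta> - \<beta> (x + y) (\<theta> \<zeta>)) \<otimes> (\<chi> (\<beta> (x + \<theta> a) (y + \<theta> b)) \<otimes> (f (x + \<theta> a) \<otimes> g (y + \<theta> b))) =
         \<chi> (- \<delta> \<zeta> - \<beta> (x + y) (\<theta> \<zeta>) + \<beta> (x + \<theta> a) (y + \<theta> b)) \<otimes> (f (x + \<theta> a) \<otimes> g (y + \<theta> b))"
        using Kf Kg by (simp add: \<chi>_mult_mult)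
      \<comment> \<open>The law for \<open>\<delta>\<close> splits the exponent at
        \<open>\<zeta> = a + b\<close>. The step after it exchanges \<open>y\<close> and
        \<open>\<theta> a\<close>, which is allowed because \<open>\<theta> a\<close> is
        central.\<close>
      also have "\<chi> (- \<delta> \<zeta> - \<beta> (x + y) (\<theta> \<zeta>) + \<beta> (x + \<theta> a) (y + \<theta> b)) =
         \<chi> (- \<delta> a - \<delta> b + \<beta> x y - \<beta> x (\<theta> a) - \<beta> y (\<theta> b) - \<beta> y (\<theta> a) + \<beta> (\<theta> a) y)"
        using ab by (intro \<chi>_cong[OF \<delta>[of a b, symmetric]]) (auto simp: \<beta>_simps \<theta>_add)
      also have "\<dots> = \<chi> (\<beta> x y + ((- \<delta> a - \<beta> x (\<theta> a)) + (- \<delta> b - \<beta> y (\<theta> b))))"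
        by (rule \<chi>_cong[OF \<chi>_central[OF y \<theta>_in_Z[OF ab(1)], symmetric]]) simp
      also have "\<dots> \<otimes> (f (x + \<theta> a) \<otimes> g (y + \<theta> b)) =
          \<chi> (\<beta> x y) \<otimes> ((\<chi> (- \<delta> a - \<beta> x (\<theta> a)) \<otimes> f (x + \<theta> a)) \<otimes> (\<chi> (- \<delta> b - \<beta> y (\<theta> b)) \<otimes> g (y + \<theta> b)))"
        using Kf Kg by (simp add: \<chi>_add m_ac)
      finally show "\<chi> (- \<delta> \<zeta> - \<beta> (x + y) (\<theta> \<zeta>)) \<otimes> (case h (a, b) of (u, v) \<Rightarrow> \<chi> (\<beta> u v) \<otimes> (f u \<otimes> g v)) =
          \<chi> (\<beta> x y) \<otimes> (coef f x a \<otimes> coef g y b)"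
        using ab by (simp add: h_def coef_def)
    qed (use L.coeff_closed[OF coef_closed] f g in auto)
    also have "\<dots> = \<chi> (\<beta> x y) \<otimes> (\<Oplus>p\<in>W. (\<lambda>(a, b). coef f x a \<otimes> coef g y b) p)"
      by (rule finsum_rdistr[symmetric]) (use \<open>finite W\<close> L.coeff_closed[OF coef_closed] f g in \<open>auto simp: split_beta\<close>)
    also have "(\<Oplus>p\<in>W. (\<lambda>(a, b). coef f x a \<otimes> coef g y b) p) = (coef f x \<otimes>\<^bsub>L\<^esub> coef g y) \<zeta>"
      by (simp add: monoid_ring_def W_def)
    finally show ?thesis .
  qed
qed

lemma on_coset_product:
  assumes f: "f \<in> carrier A" and g: "g \<in> carrier A"
    and fx: "on_coset f x" and gy: "on_coset g y"
  shows "on_coset (f \<otimes>\<^bsub>A\<^esub> g) (x + y)"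
  unfolding on_coset_def
proof (intro ballI impI)
  fix w assume w: "w \<in> G" "(f \<otimes>\<^bsub>A\<^esub> g) w \<noteq> \<zero>"
  then obtain u v where uv: "f u \<noteq> \<zero>" "g v \<noteq> \<zero>" "w = u + v" using mult_nonzeroD[OF f g] by auto
  then have "u \<in> F" "v \<in> F" using G_split[OF supp_in_S[OF f] supp_in_S[OF g]] w by blast+
  then have "u - x \<in> Z" "v - y \<in> Z" using fx gy uv F_subset_G by (auto simp: on_coset_def)
  then have "(u - x) + (v - y) \<in> Z" by (rule Z_closed)
  then show "w - (x + y) \<in> Z" by (simp add: uv algebra_simps)
qed

lemma L_cring: "cring L"
proof (intro cring.intro L.ring_A L.A.monoid_comm_monoidI)
  fix z w assume "z \<in> carrier L" "w \<in> carrier L"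
  then show "z \<otimes>\<^bsub>L\<^esub> w = w \<otimes>\<^bsub>L\<^esub> z"
  proof (induction z rule: L.carrier_induct)
    case zero
    then show ?case by (simp add: L.mult_zero_left L.mult_zero_right)
  next
    case (add f g)
    then show ?case by (simp add: L.conv_l_distr L.conv_r_distr)
  next
    case z: (monomial a u)
    show ?case using z(3)
    proof (induction w rule: L.carrier_induct)
      case zero
      then show ?case using z by (simp add: L.mult_zero_left L.mult_zero_right)
    next
      case (add f g)
      then show ?case using z by (simp add: L.conv_l_distr L.conv_r_distr)
    next
      case (monomial b v)
      then show ?case using z by (simp add: L.mult_monomial_monomial m_comm add.commute)
    qed
  qed
qed

lemma L_prime_mult:
  assumes Q: "prime_ideal L Q" and "a \<in> carrier L" "b \<in> carrier L" "a \<otimes>\<^bsub>L\<^esub> b \<in> Q"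
  shows "a \<in> Q \<or> b \<in> Q"
proof -
  interpret LC: cring L by (rule L_cring)
  have "a \<otimes>\<^bsub>L\<^esub> t \<otimes>\<^bsub>L\<^esub> b \<in> Q" if "t \<in> carrier L" for t
  proof -
    have "a \<otimes>\<^bsub>L\<^esub> t \<otimes>\<^bsub>L\<^esub> b = t \<otimes>\<^bsub>L\<^esub> (a \<otimes>\<^bsub>L\<^esub> b)" using assms that by (simp add: LC.m_ac)
    then show ?thesis using assms that ideal.I_l_closed[of Q L] by (simp add: prime_ideal_def)
  qed
  then show ?thesis using assms unfolding L.A.prime_ideal_iff_elements by blast
qed

text \<open>The commutation characters of \<open>F\<close> on \<open>G / Z\<close> are distinct, so twisted commutators with
  monomials remove all cosets but one from \<open>f\<close>, without leaving a given ideal.\<close>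

lemma separate_coset:
  assumes I: "ideal I A" and "f \<in> I" "x \<in> G"
  shows "\<exists>s\<in>F. \<exists>g\<in>I. \<exists>\<kappa>\<in>carrier K. \<kappa> \<noteq> \<zero> \<and>
    (\<forall>y\<in>G. g (y + s) = (if y - x \<in> Z then \<kappa> \<otimes> (\<chi> (\<beta> s y) \<otimes> f y) else \<zero>))"
  using assms(2,3)
proof (induction "card {y \<in> G. f y \<noteq> \<zero> \<and> y - x \<notin> Z}" arbitrary: f x rule: less_induct)
  case less
  have fA: "f \<in> carrier A" using less.prems ideal_subset_carrier[OF I] by blast
  note K = coeff_closed[OF fA]
  let ?B = "{y \<in> G. f y \<noteq> \<zero> \<and> y - x \<notin> Z}"
  show ?case
  proof (cases "?B = {}")
    case True
    then have "\<forall>y\<in>G. f (y + 0) = (if y - x \<in> Z then \<one> \<otimes> (\<chi> (\<beta> 0 y) \<otimes> f y) else \<zero>)"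
      using K by auto
    then show ?thesis using less.prems(1) faceD(2)[OF F] one_closed one_not_zero by blast
  next
    case False
    then obtain y0 where y0: "y0 \<in> G" "f y0 \<noteq> \<zero>" "y0 - x \<notin> Z" by blast
    have "y0 - x \<in> G" by (rule G_closed(3)[OF y0(1) less.prems(2)])
    then obtain h where h: "h \<in> F" "\<chi> (\<beta> h (y0 - x)) \<noteq> \<chi> (\<beta> (y0 - x) h)"
      using y0(3) by (auto simp: Z_iff)
    have hS: "h \<in> S" using faceD(1)[OF F h(1)] .
    \<comment> \<open>The scalar in \<open>f'\<close> is chosen to cancel at \<open>y0\<close>,
      where \<open>c\<close> is zero. On the coset of \<open>x\<close> the value
      \<open>\<chi> (c y)\<close> is constant, and by the choice of \<open>h\<close> it is not
      \<open>\<one>\<close>. So \<open>y0\<close> disappears while the wanted coset is only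
      scaled.\<close>
    define c where "c y = \<beta> h y0 - \<beta> y0 h + \<beta> y h - \<beta> h y" for y
    define f' where "f' = (\<lambda>w. (mon h \<otimes>\<^bsub>A\<^esub> f) w \<ominus> (f \<otimes>\<^bsub>A\<^esub> monomial K (\<chi> (\<beta> h y0 - \<beta> y0 h)) h) w)"
    have f'I: "f' \<in> I" unfolding f'_def
      by (rule ideal_diff[OF I ideal.I_l_closed[OF I less.prems(1)] ideal.I_r_closed[OF I less.prems(1)]])
        (use hS in auto)
    have f'_eq: "f' (y + h) = (\<one> \<ominus> \<chi> (c y)) \<otimes> (\<chi> (\<beta> h y) \<otimes> f y)" for y
    proof -
      have "f' (y + h) = \<chi> (\<beta> h y) \<otimes> f y \<ominus> \<chi> (\<beta> y h) \<otimes> (\<chi> (\<beta> h y0 - \<beta> y0 h) \<otimes> f y)"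
        unfolding f'_def using K
        by (simp add: monomial_mult_apply[OF fA one_closed hS] mult_monomial_apply[OF fA \<chi>_closed hS] m_comm)
      also have "\<chi> (\<beta> y h) \<otimes> (\<chi> (\<beta> h y0 - \<beta> y0 h) \<otimes> f y) = \<chi> (c y) \<otimes> (\<chi> (\<beta> h y) \<otimes> f y)"
        using K by (simp add: \<chi>_mult_mult c_def ac_simps)
      finally show ?thesis using K by (simp add: a_minus_def l_distr l_minus)
    qed
    have c_x: "\<chi> (c y) = \<chi> (c x)" if "y - x \<in> Z" for y
      by (rule \<chi>_cong[OF \<chi>_central[OF F_subset_G[OF h(1)] that, symmetric]]) (simp add: c_def \<beta>_diff)
    have "\<chi> (c x) \<noteq> \<one>"
    proof
      assume "\<chi> (c x) = \<one>"
      then have "\<chi> (c x) = \<chi> 0" by simp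
      then have "\<chi> (\<beta> h (y0 - x)) = \<chi> (\<beta> (y0 - x) h)" by (rule \<chi>_cong) (simp add: c_def \<beta>_diff)
      then show False using h(2) by simp
    qed
    then have nz: "\<one> \<ominus> \<chi> (c x) \<noteq> \<zero>" by simp
    have "{y \<in> G. f' y \<noteq> \<zero> \<and> y - (x + h) \<notin> Z} \<subseteq> (\<lambda>y. y + h) ` (?B - {y0})"
    proof
      fix w assume w: "w \<in> {y \<in> G. f' y \<noteq> \<zero> \<and> y - (x + h) \<notin> Z}"
      define y where "y = w - h"
      have "c y0 = 0" by (simp add: c_def)
      then have "f' (y0 + h) = \<zero>" using K by (simp add: f'_eq a_minus_def r_neg)
      then have "y \<noteq> y0" using w by (auto simp: y_def)
      moreover have "f y \<noteq> \<zero>"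
      proof
        assume "f y = \<zero>"
        then have "f' (y + h) = \<zero>" by (simp add: f'_eq)
        then show False using w by (simp add: y_def)
      qed
      moreover have "y \<in> G" using w G_closed(3)[OF _ F_subset_G[OF h(1)], of w] by (simp add: y_def)
      moreover have "y - x \<notin> Z" using w by (simp add: y_def diff_diff_eq add.commute)
      ultimately show "w \<in> (\<lambda>y. y + h) ` (?B - {y0})"
        by (intro image_eqI[of _ _ y]) (auto simp: y_def)
    qed
    moreover have finB: "finite ?B" by (rule finite_subset[OF _ finite_supp[OF fA]]) auto
    ultimately have "card {y \<in> G. f' y \<noteq> \<zero> \<and> y - (x + h) \<notin> Z} \<le> card ((\<lambda>y. y + h) ` (?B - {y0}))"
      by (intro card_mono) auto
    also have "\<dots> \<le> card (?B - {y0})" using finB by (intro card_image_le) simp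
    also have "\<dots> < card ?B" using finB y0 by (intro psubset_card_mono) auto
    finally obtain s g \<kappa> where sg: "s \<in> F" "g \<in> I" "\<kappa> \<in> carrier K" "\<kappa> \<noteq> \<zero>"
      and g: "\<And>y. y \<in> G \<Longrightarrow> g (y + s) = (if y - (x + h) \<in> Z then \<kappa> \<otimes> (\<chi> (\<beta> s y) \<otimes> f' y) else \<zero>)"
      using less.hyps[OF _ f'I G_closed(2)[OF less.prems(2) F_subset_G[OF h(1)]]] by blast
    \<comment> \<open>Besides the new factor from the commutator, this collects the scalar that
      arises when \<open>\<beta> s (y + h)\<close> is split.\<close>
    define \<kappa>' where "\<kappa>' = \<kappa> \<otimes> (\<one> \<ominus> \<chi> (c x)) \<otimes> \<chi> (\<beta> s h)"
    have "\<kappa>' \<in> carrier K" "\<kappa>' \<noteq> \<zero>" using sg nz by (simp_all add: \<kappa>'_def integral_iff)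
    moreover have "g (y + (h + s)) = (if y - x \<in> Z then \<kappa>' \<otimes> (\<chi> (\<beta> (h + s) y) \<otimes> f y) else \<zero>)" if y: "y \<in> G" for y
    proof -
      have "g (y + (h + s)) = (if y - x \<in> Z then \<kappa> \<otimes> (\<chi> (\<beta> s (y + h)) \<otimes> f' (y + h)) else \<zero>)"
        using g[OF G_closed(2)[OF y F_subset_G[OF h(1)]]] by (simp add: add.assoc)
      also have "\<kappa> \<otimes> (\<chi> (\<beta> s (y + h)) \<otimes> f' (y + h)) = \<kappa>' \<otimes> (\<chi> (\<beta> (h + s) y) \<otimes> f y)" if "y - x \<in> Z"
      proof -
        have "\<kappa> \<otimes> (\<chi> (\<beta> s (y + h)) \<otimes> f' (y + h)) =
          \<kappa> \<otimes> (\<one> \<ominus> \<chi> (c x)) \<otimes> (\<chi> (\<beta> s (y + h)) \<otimes> (\<chi> (\<beta> h y) \<otimes> f y))"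
          unfolding f'_eq c_x[OF that] using sg K by (simp add: m_ac)
        also have "\<dots> = \<kappa>' \<otimes> (\<chi> (\<beta> (h + s) y) \<otimes> f y)"
          unfolding \<kappa>'_def using sg K by (simp add: m_assoc \<chi>_mult_mult \<beta>_simps ac_simps)
        finally show ?thesis .
      qed
      then show ?thesis using calculation by simp
    qed
    ultimately show ?thesis using sg faceD(3)[OF F h(1) sg(1)] by blast
  qed
qed

text \<open>Separation changes the coefficient at the chosen coset only by a nonzero scalar, so it
  stays outside \<open>Q\<close>. Primality of a contraction can therefore be tested on elements of
  a single coset.\<close>

lemma exists_on_coset_notin:
  assumes I: "ideal I A" and Q: "ideal Q L" and f: "f \<in> I" and x: "x \<in> G" and "coef f x \<notin> Q"
  obtains g y where "g \<in> I" "y \<in> G" "on_coset g y" "coef g y \<notin> Q"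
proof -
  have fA: "f \<in> carrier A" using f ideal_subset_carrier[OF I] by blast
  note K = coeff_closed[OF fA]
  obtain s g \<kappa> where sg: "s \<in> F" "g \<in> I" "\<kappa> \<in> carrier K" "\<kappa> \<noteq> \<zero>"
    and g: "\<And>y. y \<in> G \<Longrightarrow> g (y + s) = (if y - x \<in> Z then \<kappa> \<otimes> (\<chi> (\<beta> s y) \<otimes> f y) else \<zero>)"
    using separate_coset[OF I f x] by blast
  have sG: "s \<in> G" using F_subset_G[OF sg(1)] .
  show ?thesis
  proof
    show "g \<in> I" "x + s \<in> G" using sg G_closed(2)[OF x sG] by auto
    show "on_coset g (x + s)" unfolding on_coset_def
    proof (intro ballI impI)
      fix w assume w: "w \<in> G" "g w \<noteq> \<zero>"
      then have "w - s - x \<in> Z" using g[OF G_closed(3)[OF w(1) sG]] by (simp split: if_splits)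
      then show "w - (x + s) \<in> Z" by (simp add: diff_diff_eq add.commute)
    qed
    have "coef g (x + s) \<zeta> = (\<kappa> \<otimes> \<chi> (\<beta> s x)) \<otimes> coef f x \<zeta>" for \<zeta>
    proof (cases "\<zeta> \<in> N")
      case True
      have e: "x + s + \<theta> \<zeta> = (x + \<theta> \<zeta>) + s" by (simp add: ac_simps)
      have "g (x + s + \<theta> \<zeta>) = \<kappa> \<otimes> (\<chi> (\<beta> s (x + \<theta> \<zeta>)) \<otimes> f (x + \<theta> \<zeta>))"
        using g[of "x + \<theta> \<zeta>"] G_closed(2)[OF x Z_subset_G[OF \<theta>_in_Z[OF True]]] \<theta>_in_Z[OF True]
        unfolding e by simp
      then have "coef g (x + s) \<zeta> = \<kappa> \<otimes> (\<chi> (- \<delta> \<zeta> - \<beta> (x + s) (\<theta> \<zeta>)) \<otimes> (\<chi> (\<beta> s (x + \<theta> \<zeta>)) \<otimes> f (x + \<theta> \<zeta>)))"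
        using True sg K by (simp add: coef_def m_lcomm)
      then show ?thesis using True sg K by (simp add: coef_def m_assoc \<chi>_mult_mult \<beta>_simps algebra_simps)
    qed (use sg in \<open>auto simp: coef_def\<close>)
    then have eq: "coef g (x + s) = (\<lambda>\<zeta>. (\<kappa> \<otimes> \<chi> (\<beta> s x)) \<otimes> coef f x \<zeta>)" ..
    show "coef g (x + s) \<notin> Q"
      unfolding eq using L_ideal_smult_iff[OF Q coef_closed[OF fA], of "\<kappa> \<otimes> \<chi> (\<beta> s x)" x] sg assms(5)
      by (simp add: integral_iff)
  qed
qed

lemma coef_outside_coset:
  assumes "f \<in> carrier A" "on_coset f x" "y \<in> G" "y - x \<notin> Z"
  shows "coef f y = (\<lambda>_. \<zero>)"
proof
  fix \<zeta>
  have "f (y + \<theta> \<zeta>) = \<zero>" if "\<zeta> \<in> N"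
  proof (rule ccontr)
    assume "f (y + \<theta> \<zeta>) \<noteq> \<zero>"
    then have "y + \<theta> \<zeta> - x \<in> Z"
      using assms(2) G_closed(2)[OF assms(3) Z_subset_G[OF \<theta>_in_Z[OF that]]] by (simp add: on_coset_def)
    then have "(y + \<theta> \<zeta> - x) - \<theta> \<zeta> \<in> Z" by (rule Z_closed(3)[OF _ \<theta>_in_Z[OF that]])
    then show False using assms(4) by (simp add: algebra_simps)
  qed
  then show "coef f y \<zeta> = \<zero>" by (auto simp: coef_def)
qed

lemma on_coset_mem_contraction:
  assumes Q: "ideal Q L" and f: "f \<in> carrier A" "on_coset f x" and "coef f x \<in> Q"
  shows "f \<in> contraction Q"
proof -
  have "coef f y \<in> Q" if y: "y \<in> G" for y
  proof (cases "y - x \<in> Z")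
    case True
    then obtain \<xi> where \<xi>: "\<xi> \<in> N" "y - x = \<theta> \<xi>" unfolding Z_def by auto
    then have y_eq: "y = x + \<theta> \<xi>" by (simp flip: \<xi>(2))
    have "monomial K \<one> (- \<xi>) \<otimes>\<^bsub>L\<^esub> coef f x \<in> Q"
      using N_closed(3)[OF \<xi>(1)] by (intro ideal.I_l_closed[OF Q assms(4)] L.monomial_closed) auto
    then show ?thesis unfolding y_eq coef_translate[OF f(1) \<xi>(1)] by (intro L_ideal_smult[OF Q]) auto
  next
    case False
    then show ?thesis using coef_outside_coset[OF f y] L_ideal_zero[OF Q] by simp
  qed
  then show ?thesis using f by (simp add: contraction_def)
qed

text \<open>A lift of \<open>z \<in> J\<close> to a single coset lies in
  \<open>contraction J\<close>, and its coefficient gives \<open>z\<close> back. This yields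
  injectivity of \<open>contraction\<close> and also half of the comparison of closed sets.\<close>

lemma contraction_subset_iff:
  assumes J: "ideal J L" and Q: "ideal Q L"
  shows "contraction J \<subseteq> contraction Q \<longleftrightarrow> J \<subseteq> Q"
proof
  assume sub: "contraction J \<subseteq> contraction Q"
  show "J \<subseteq> Q"
  proof
    fix z assume z: "z \<in> J"
    then have "z \<in> carrier L" using ideal_subset_carrier[OF J] by blast
    then obtain f x where f: "f \<in> carrier A" "x \<in> F" "coef f x = z" "full f x"
      by (rule lift_exists)
    have "f \<in> contraction J" by (rule on_coset_mem_contraction[OF J]) (use f z full_on_coset in auto)
    then have "coef f x \<in> Q" using sub f(2) F_subset_G by (auto simp: contraction_def)
    then show "z \<in> Q" using f(3) by simp
  qed
qed (auto simp: contraction_def)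

text \<open>By injectivity of \<open>\<theta>\<close> only \<open>\<zeta> = 0\<close> leads to the
  degree \<open>s\<close>. The coefficient is a nonzero scalar and hence lies in no proper
  ideal.\<close>

lemma coef_mon:
  assumes "s \<in> F"
  shows "coef (mon s) s = (\<lambda>\<zeta>. \<chi> (- \<delta> 0) \<otimes> \<one>\<^bsub>L\<^esub> \<zeta>)"
proof
  fix \<zeta>
  have "\<theta> \<zeta> = 0 \<longleftrightarrow> \<zeta> = 0" if "\<zeta> \<in> N"
    using inj_onD[OF \<theta>_inj, of \<zeta> 0] that by auto
  then show "coef (mon s) s \<zeta> = \<chi> (- \<delta> 0) \<otimes> \<one>\<^bsub>L\<^esub> \<zeta>"
    by (auto simp: coef_def L.one_eq monomial_def)
qed

lemma coef_mon_notin: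
  assumes "ideal Q L" "Q \<noteq> carrier L" "s \<in> F" shows "coef (mon s) s \<notin> Q"
  unfolding coef_mon[OF assms(3)]
  using L_ideal_smult_iff[OF assms(1) L.A.one_closed, of "\<chi> (- \<delta> 0)"] ideal.one_imp_carrier[OF assms(1)] assms(2)
  by auto

section \<open>Contraction and extension between the stratum and the Laurent spectrum\<close>

definition stratum :: "('g \<Rightarrow> 'a) set set" where
  "stratum = {P \<in> Spec A. \<forall>s\<in>S. mon s \<in> P \<longleftrightarrow> s \<notin> F}"

text \<open>If neither of two ideals lies in the contraction, each contains an element of a single
  coset with coefficient outside \<open>Q\<close>. The coefficient of their product is the product
  of these coefficients up to a scalar, which contradicts primality of \<open>Q\<close>.\<close>

lemma contraction_in_stratum:
  assumes Q: "prime_ideal L Q" shows "contraction Q \<in> stratum"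
proof -
  have Q': "ideal Q L" "Q \<noteq> carrier L" using Q by (auto simp: prime_ideal_def)
  note I = contraction_ideal[OF Q'(1)]
  have mon: "mon s \<in> contraction Q \<longleftrightarrow> s \<notin> F" if s: "s \<in> S" for s
  proof
    assume "mon s \<in> contraction Q"
    then show "s \<notin> F" using coef_mon_notin[OF Q'] F_subset_G by (auto simp: contraction_def)
  next
    assume "s \<notin> F"
    have "coef (mon s) x = (\<lambda>_. \<zero>)" if x: "x \<in> G" for x
    proof
      fix \<zeta>
      have "x + \<theta> \<zeta> \<noteq> s" if "\<zeta> \<in> N"
        using G_closed(2)[OF x Z_subset_G[OF \<theta>_in_Z[OF that]]] G_inter_S[OF _ s] \<open>s \<notin> F\<close> by auto
      then show "coef (mon s) x \<zeta> = \<zero>" by (auto simp: coef_def monomial_def)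
    qed
    then show "mon s \<in> contraction Q" using L_ideal_zero[OF Q'(1)] s by (simp add: contraction_def)
  qed
  have "prime_ideal A (contraction Q)"
    unfolding prime_ideal_def A.ideal_prod_subset_iff[OF I]
  proof (intro conjI allI impI I)
    have "mon 0 \<in> carrier A" "mon 0 \<notin> contraction Q"
      using mon[OF zero_in_S] faceD(2)[OF F] by simp_all
    then show "contraction Q \<noteq> carrier A" by blast
  next
    fix I J assume "ideal I A \<and> ideal J A \<and> (\<forall>i\<in>I. \<forall>j\<in>J. i \<otimes>\<^bsub>A\<^esub> j \<in> contraction Q)"
    then have IJ: "ideal I A" "ideal J A" "\<forall>i\<in>I. \<forall>j\<in>J. i \<otimes>\<^bsub>A\<^esub> j \<in> contraction Q" by blast+
    show "I \<subseteq> contraction Q \<or> J \<subseteq> contraction Q"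
    proof (rule ccontr)
      assume "\<not> (I \<subseteq> contraction Q \<or> J \<subseteq> contraction Q)"
      then obtain f g where fg: "f \<in> I" "f \<notin> contraction Q" "g \<in> J" "g \<notin> contraction Q" by blast
      then have "f \<in> carrier A" "g \<in> carrier A" using IJ ideal_subset_carrier by blast+
      then obtain x y where xy: "x \<in> G" "coef f x \<notin> Q" "y \<in> G" "coef g y \<notin> Q"
        using fg by (auto simp: contraction_def)
      obtain f' x' where f': "f' \<in> I" "x' \<in> G" "on_coset f' x'" "coef f' x' \<notin> Q"
        using exists_on_coset_notin[OF IJ(1) Q'(1) fg(1) xy(1,2)] by blast
      obtain g' y' where g': "g' \<in> J" "y' \<in> G" "on_coset g' y'" "coef g' y' \<notin> Q"
        using exists_on_coset_notin[OF IJ(2) Q'(1) fg(3) xy(3,4)] by blast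
      have A: "f' \<in> carrier A" "g' \<in> carrier A" using f' g' IJ ideal_subset_carrier by blast+
      have "f' \<otimes>\<^bsub>A\<^esub> g' \<in> contraction Q" using IJ(3) f' g' by blast
      then have "coef (f' \<otimes>\<^bsub>A\<^esub> g') (x' + y') \<in> Q" using G_closed(2)[OF f'(2) g'(2)] by (simp add: contraction_def)
      then have "(\<lambda>\<zeta>. \<chi> (\<beta> x' y') \<otimes> (coef f' x' \<otimes>\<^bsub>L\<^esub> coef g' y') \<zeta>) \<in> Q"
        unfolding coef_product[OF A f'(2) g'(2) f'(3) g'(3)] .
      then have "coef f' x' \<otimes>\<^bsub>L\<^esub> coef g' y' \<in> Q"
        using L_ideal_smult_iff[OF Q'(1), of "coef f' x' \<otimes>\<^bsub>L\<^esub> coef g' y'"] A coef_closed by simp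
      then show False using L_prime_mult[OF Q coef_closed[OF A(1)] coef_closed[OF A(2)]] f' g' by blast
    qed
  qed
  then show ?thesis using mon by (simp add: stratum_def Spec_def)
qed

definition component :: "('g \<Rightarrow> 'a) \<Rightarrow> 'g \<Rightarrow> 'g \<Rightarrow> 'a" where
  "component f x = (\<lambda>y. if y \<in> F \<and> y - x \<in> Z then f y else \<zero>)"

text \<open>No closure under sums or multiples is built in. For \<open>P\<close> in the stratum this
  set of coefficients turns out to be an ideal, because lifts can be moved to a common
  representative.\<close>

definition extension :: "('g \<Rightarrow> 'a) set \<Rightarrow> ((nat \<Rightarrow>\<^sub>0 int) \<Rightarrow> 'a) set" where
  "extension P = {z \<in> carrier L. \<exists>f\<in>P. \<exists>x\<in>F. full f x \<and> coef f x = z}"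

lemma full_smult: "full f x \<Longrightarrow> a \<in> carrier K \<Longrightarrow> full (smult a f) x"
  unfolding full_def by (metis r_null)

lemma full_product:
  assumes "f \<in> carrier A" "g \<in> carrier A" "full f x" "full g y" shows "full (f \<otimes>\<^bsub>A\<^esub> g) (x + y)"
  unfolding full_def
proof (intro allI impI)
  fix w assume w: "(f \<otimes>\<^bsub>A\<^esub> g) w \<noteq> \<zero>"
  then obtain u v where uv: "f u \<noteq> \<zero>" "g v \<noteq> \<zero>" "w = u + v" using mult_nonzeroD[OF assms(1,2)] by auto
  then have "w \<in> F" using assms(3,4) faceD(3)[OF F] by (auto simp: full_def)
  then show "w \<in> F \<and> w - (x + y) \<in> Z"
    using on_coset_product[OF assms(1,2) full_on_coset[OF assms(3)] full_on_coset[OF assms(4)]] w F_subset_G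
    by (auto simp: on_coset_def)
qed

lemma full_mon: "s \<in> F \<Longrightarrow> full (mon s) s"
  by (auto simp: full_def monomial_def Z_closed)

lemma component_closed: "f \<in> carrier A \<Longrightarrow> component f x \<in> carrier A"
  by (rule carrierI[where S = "supp f"]) (auto simp: component_def in_carrier_iff)

lemma full_component: "full (component f x) x"
  by (auto simp: full_def component_def)

lemma coef_component:
  assumes "f \<in> carrier A" "x \<in> G" shows "coef (component f x) x = coef f x"
proof
  fix \<zeta>
  have "f (x + \<theta> \<zeta>) = \<zero>" if "\<zeta> \<in> N" "x + \<theta> \<zeta> \<notin> F"
    using that supp_in_S[OF assms(1)] G_inter_S G_closed(2)[OF assms(2) Z_subset_G[OF \<theta>_in_Z[OF that(1)]]] by blast
  then show "coef (component f x) x \<zeta> = coef f x \<zeta>"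
    using \<theta>_in_Z by (auto simp: coef_def component_def)
qed

lemma coef_smult:
  assumes "f \<in> carrier A" "a \<in> carrier K"
  shows "coef (smult a f) x = (\<lambda>\<zeta>. a \<otimes> coef f x \<zeta>)"
  using assms coeff_closed[OF assms(1)] by (auto simp: coef_def m_lcomm)

lemma full_apply:
  assumes "f \<in> carrier A" "\<zeta> \<in> N"
  shows "f (x + \<theta> \<zeta>) = \<chi> (\<delta> \<zeta> + \<beta> x (\<theta> \<zeta>)) \<otimes> coef f x \<zeta>"
  using assms coeff_closed[OF assms(1)] by (simp add: coef_def \<chi>_mult_mult)

context
  fixes P assumes P: "P \<in> stratum"
begin

lemma P_ideal: "ideal P A"
  using P by (simp add: stratum_def Spec_def prime_ideal_def)

lemma P_prime:
  "a \<in> carrier A \<Longrightarrow> b \<in> carrier A \<Longrightarrow> (\<And>t. t \<in> carrier A \<Longrightarrow> a \<otimes>\<^bsub>A\<^esub> t \<otimes>\<^bsub>A\<^esub> b \<in> P) \<Longrightarrow> a \<in> P \<or> b \<in> P"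
  using P unfolding stratum_def Spec_def A.prime_ideal_iff_elements by blast

lemma mon_in_P_iff: "s \<in> S \<Longrightarrow> mon s \<in> P \<longleftrightarrow> s \<notin> F"
  using P by (simp add: stratum_def)

lemma P_carrier: "f \<in> P \<Longrightarrow> f \<in> carrier A"
  using ideal_subset_carrier[OF P_ideal] by blast

text \<open>A full element is normal modulo \<open>P\<close>: its degrees lie in one coset of
  \<open>Z\<close>, so it commutes with each monomial of \<open>F\<close> up to one scalar, and all
  other monomials lie in \<open>P\<close>. Hence \<open>f t g\<close> is in \<open>P\<close> for
  every \<open>t\<close> as soon as \<open>f g\<close> is.\<close>

lemma full_normal_prime:
  assumes f: "f \<in> carrier A" "full f x" and g: "g \<in> carrier A" and fg: "f \<otimes>\<^bsub>A\<^esub> g \<in> P"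
  shows "f \<in> P \<or> g \<in> P"
proof (rule P_prime[OF f(1) g])
  fix t assume "t \<in> carrier A"
  then show "f \<otimes>\<^bsub>A\<^esub> t \<otimes>\<^bsub>A\<^esub> g \<in> P"
  proof (induction t rule: carrier_induct)
    case zero
    then show ?case using f g ideal_zero[OF P_ideal] by (simp add: mult_zero_left mult_zero_right)
  next
    case (add t t')
    then show ?case using f g A.ideal_a_closed[OF P_ideal] by (simp add: A.r_distr A.l_distr)
  next
    case (monomial a u)
    then have a: "a \<in> carrier K" and u: "u \<in> S" by simp_all
    show ?case
    proof (cases "u \<in> F")
      case False
      then have "monomial K a u \<in> P"
        using mon_in_P_iff[OF u] ideal_mon_iff[OF P_ideal a _ u] ideal_zero[OF P_ideal]
        by (cases "a = \<zero>") (auto simp: monomial_def)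
      then have "f \<otimes>\<^bsub>A\<^esub> monomial K a u \<in> P" using f(1) by (rule ideal.I_l_closed[OF P_ideal])
      then show ?thesis using g by (rule ideal.I_r_closed[OF P_ideal])
    next
      case True
      note K = coeff_closed[OF f(1)]
      \<comment> \<open>The commutation factor is computed at the representative \<open>x\<close>;
        the central part of a degree of \<open>f\<close> does not change it.\<close>
      let ?c = "\<chi> (\<beta> x u - \<beta> u x)"
      have "(f \<otimes>\<^bsub>A\<^esub> monomial K a u) w = (monomial K (?c \<otimes> a) u \<otimes>\<^bsub>A\<^esub> f) w" for w
      proof (cases "f (w - u) = \<zero>")
        case True
        then show ?thesis using a u by (simp add: mult_monomial_apply[OF f(1)] monomial_mult_apply[OF f(1)])
      next
        case False
        then have z: "w - u - x \<in> Z" using f(2) by (auto simp: full_def)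
        have "\<chi> (\<beta> (w - u) u) = \<chi> (\<beta> u (w - u) + (\<beta> x u - \<beta> u x))"
          by (rule \<chi>_cong[OF \<chi>_central[OF F_subset_G[OF \<open>u \<in> F\<close>] z, symmetric]]) (simp add: \<beta>_simps)
        then show ?thesis using a u K
          by (simp add: mult_monomial_apply[OF f(1)] monomial_mult_apply[OF f(1)] m_assoc \<chi>_mult_mult m_comm[of a])
      qed
      then have "f \<otimes>\<^bsub>A\<^esub> monomial K a u = monomial K (?c \<otimes> a) u \<otimes>\<^bsub>A\<^esub> f" ..
      then have "f \<otimes>\<^bsub>A\<^esub> monomial K a u \<otimes>\<^bsub>A\<^esub> g = monomial K (?c \<otimes> a) u \<otimes>\<^bsub>A\<^esub> (f \<otimes>\<^bsub>A\<^esub> g)"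
        using f g a u by (simp add: A.m_assoc)
      then show ?thesis using ideal.I_l_closed[OF P_ideal fg] a u by simp
    qed
  qed
qed

text \<open>Monomials of \<open>F\<close> are full and not in \<open>P\<close>, hence regular modulo
  \<open>P\<close>. Cancelling them takes the place of inverting them.\<close>

lemma mon_cancel:
  assumes "s \<in> F" "f \<in> carrier A" "mon s \<otimes>\<^bsub>A\<^esub> f \<in> P" shows "f \<in> P"
  using full_normal_prime[OF _ full_mon[OF assms(1)] assms(2,3)] mon_in_P_iff faceD(1)[OF F assms(1)] assms(1)
  by simp

lemma mem_P_if_zero_on_face:
  assumes "f \<in> carrier A" "\<And>s. s \<in> F \<Longrightarrow> f s = \<zero>" shows "f \<in> P"
  by (rule mem_ideal_if_monomials_mem[OF P_ideal assms(1)])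
    (use assms mon_in_P_iff supp_in_S[OF assms(1)] in blast)

text \<open>Separation yields an element \<open>g\<close> of \<open>P\<close> that agrees on
  \<open>F\<close> with \<open>\<kappa>\<close> times a monomial times the component. The difference
  is spanned by monomials off \<open>F\<close>, which are in \<open>P\<close>; then the monomial and
  \<open>\<kappa>\<close> are cancelled.\<close>

lemma component_in_P:
  assumes f: "f \<in> P" and x: "x \<in> G" shows "component f x \<in> P"
proof -
  obtain s g \<kappa> where sg: "s \<in> F" "g \<in> P" "\<kappa> \<in> carrier K" "\<kappa> \<noteq> \<zero>"
    and g: "\<And>y. y \<in> G \<Longrightarrow> g (y + s) = (if y - x \<in> Z then \<kappa> \<otimes> (\<chi> (\<beta> s y) \<otimes> f y) else \<zero>)"
    using separate_coset[OF P_ideal f x] by blast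
  have sS: "s \<in> S" and sG: "s \<in> G" using faceD(1)[OF F sg(1)] F_subset_G[OF sg(1)] by auto
  note fA = P_carrier[OF f]
  define c where "c = monomial K \<kappa> s \<otimes>\<^bsub>A\<^esub> component f x"
  have cA: "c \<in> carrier A" using component_closed[OF fA] sg sS by (simp add: c_def)
  have "(\<lambda>w. c w \<ominus> g w) \<in> P"
  proof (rule mem_P_if_zero_on_face)
    show "(\<lambda>w. c w \<ominus> g w) \<in> carrier A"
      using A.minus_closed[OF cA P_carrier[OF sg(2)]] by (simp add: conv_minus_eq cA P_carrier[OF sg(2)])
    fix w assume w: "w \<in> F"
    then have wG: "w - s \<in> G" using G_closed(3)[OF F_subset_G sG] by blast
    have "component f x (w - s) = (if w - s - x \<in> Z then f (w - s) else \<zero>)"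
      using G_inter_S[OF wG] supp_in_S[OF fA, of "w - s"]
      by (cases "f (w - s) = \<zero>") (auto simp: component_def)
    then have "c w = (if w - s - x \<in> Z then \<chi> (\<beta> s (w - s)) \<otimes> (\<kappa> \<otimes> f (w - s)) else \<zero>)"
      using sg sS by (simp add: c_def monomial_mult_apply[OF component_closed[OF fA]])
    also have "\<dots> = g w"
      using g[OF wG] sg coeff_closed[OF fA] by (simp add: m_lcomm)
    finally show "c w \<ominus> g w = \<zero>"
      using coeff_closed[OF P_carrier[OF sg(2)]] by (simp add: a_minus_def r_neg)
  qed
  then have "(\<lambda>w. (c w \<ominus> g w) \<oplus> g w) \<in> P" using ideal_add[OF P_ideal _ sg(2)] by blast
  moreover have "(c w \<ominus> g w) \<oplus> g w = c w" for w
    using coeff_closed[OF P_carrier[OF sg(2)]] coeff_closed[OF cA] by (simp add: a_minus_def a_assoc l_neg)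
  ultimately have "c \<in> P" by simp
  moreover have "c = mon s \<otimes>\<^bsub>A\<^esub> smult \<kappa> (component f x)"
    using sg sS component_closed[OF fA] smult_closed[OF component_closed[OF fA] sg(3)]
      coeff_closed[OF component_closed[OF fA]]
    by (auto simp: c_def monomial_mult_apply)
  ultimately have "smult \<kappa> (component f x) \<in> P"
    using mon_cancel[OF sg(1) smult_closed[OF component_closed[OF fA] sg(3)]] by simp
  then show ?thesis using ideal_smult_iff[OF P_ideal component_closed[OF fA] sg(3,4)] by simp
qed

text \<open>Subtracting the component at \<open>x\<close> clears one coset on \<open>F\<close> and
  leaves the components at the other cosets as they were.\<close>

lemma mem_P_if_components_in_P:
  assumes "f \<in> carrier A" "\<And>x. x \<in> F \<Longrightarrow> component f x \<in> P" shows "f \<in> P"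
  using assms
proof (induction "card {y \<in> F. f y \<noteq> \<zero>}" arbitrary: f rule: less_induct)
  case less
  note K = coeff_closed[OF less.prems(1)]
  show ?case
  proof (cases "{y \<in> F. f y \<noteq> \<zero>} = {}")
    case True
    then show ?thesis using mem_P_if_zero_on_face[OF less.prems(1)] by blast
  next
    case False
    then obtain x where x: "x \<in> F" "f x \<noteq> \<zero>" by blast
    define g where "g = (\<lambda>w. f w \<ominus> component f x w)"
    have gA: "g \<in> carrier A"
      using A.minus_closed[OF less.prems(1) component_closed[OF less.prems(1)]]
      by (simp add: g_def conv_minus_eq less.prems(1) component_closed[OF less.prems(1)])
    have g_eq: "g y = (if y \<in> F \<and> y - x \<in> Z then \<zero> else f y)" for y
      using K by (simp add: g_def component_def a_minus_def r_neg)
    have "finite {y \<in> F. f y \<noteq> \<zero>}" by (rule finite_subset[OF _ finite_supp[OF less.prems(1)]]) auto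
    moreover have "{y \<in> F. g y \<noteq> \<zero>} \<subseteq> {y \<in> F. f y \<noteq> \<zero>}" by (auto simp: g_eq)
    moreover have "g x = \<zero>" using x Z_closed(1) by (simp add: g_eq)
    ultimately have "card {y \<in> F. g y \<noteq> \<zero>} < card {y \<in> F. f y \<noteq> \<zero>}"
      using x by (intro psubset_card_mono) blast+
    moreover have "component g y \<in> P" if y: "y \<in> F" for y
    proof (cases "y - x \<in> Z")
      case True
      have "component g y = (\<lambda>_. \<zero>)"
      proof
        fix w
        have "w - x \<in> Z" if "w - y \<in> Z" using Z_closed(2)[OF that True] by simp
        then show "component g y w = \<zero>" by (simp add: component_def g_eq)
      qed
      then show ?thesis using ideal_zero[OF P_ideal] by simp
    next
      case False
      have "component g y = component f y"
      proof
        fix w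
        have "w - x \<notin> Z" if "w - y \<in> Z" using Z_closed(3)[OF _ that, of "w - x"] False by auto
        then show "component g y w = component f y w" by (simp add: component_def g_eq)
      qed
      then show ?thesis using less.prems(2)[OF y] by simp
    qed
    ultimately have "g \<in> P" using less.hyps[OF _ gA] by blast
    then have "(\<lambda>w. g w \<oplus> component f x w) \<in> P" using ideal_add[OF P_ideal _ less.prems(2)[OF x(1)]] by blast
    moreover have "g w \<oplus> component f x w = f w" for w using K by (simp add: g_eq component_def)
    ultimately show ?thesis by simp
  qed
qed

text \<open>If \<open>z\<close> is the common coefficient, then \<open>f\<close> is
  \<open>u_x z\<close> and \<open>g\<close> is \<open>u_y z\<close>. So \<open>u_x g\<close> and
  \<open>u_y f\<close> differ by the commutation factor \<open>?c\<close> of the two monomials, and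
  \<open>u_x\<close> can be cancelled. Membership of a full lift in \<open>P\<close> thus depends
  only on its coefficient.\<close>

lemma full_mem_P_transfer:
  assumes f: "f \<in> P" "x \<in> F" "full f x" and g: "g \<in> carrier A" "y \<in> F" "full g y" and eq: "coef f x = coef g y"
  shows "g \<in> P"
proof -
  note fA = P_carrier[OF f(1)]
  have xS: "x \<in> S" "y \<in> S" using f g faceD(1)[OF F] by auto
  let ?c = "\<chi> (\<beta> x y - \<beta> y x)"
  have "(mon x \<otimes>\<^bsub>A\<^esub> g) w = (monomial K ?c y \<otimes>\<^bsub>A\<^esub> f) w" for w
  proof (cases "w - x - y \<in> Z")
    case True
    then obtain \<zeta> where \<zeta>: "\<zeta> \<in> N" "w - x - y = \<theta> \<zeta>" unfolding Z_def by auto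
    then have w: "w - x = y + \<theta> \<zeta>" "w - y = x + \<theta> \<zeta>" by (simp_all flip: \<zeta>(2))
    have cK: "coef g y \<zeta> \<in> carrier K" using L.coeff_closed[OF coef_closed[OF g(1)]] .
    show ?thesis
      using xS cK
      by (simp add: monomial_mult_apply[OF g(1)] monomial_mult_apply[OF fA] w full_apply[OF g(1) \<zeta>(1)]
          full_apply[OF fA \<zeta>(1)] eq \<chi>_mult_mult) (simp add: \<beta>_simps ac_simps)
  next
    case False
    then have "g (w - x) = \<zero>" "f (w - y) = \<zero>"
      using f(3) g(3) by (auto simp: full_def diff_diff_eq add.commute)
    then show ?thesis using xS by (simp add: monomial_mult_apply[OF g(1)] monomial_mult_apply[OF fA])
  qed
  then have "mon x \<otimes>\<^bsub>A\<^esub> g = monomial K ?c y \<otimes>\<^bsub>A\<^esub> f" ..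
  also have "\<dots> \<in> P" using xS by (intro ideal.I_l_closed[OF P_ideal f(1)]) simp
  finally show ?thesis using mon_cancel[OF f(2) g(1)] by simp
qed

lemma mem_extension_iff:
  assumes "f \<in> carrier A" "x \<in> F" "full f x"
  shows "coef f x \<in> extension P \<longleftrightarrow> f \<in> P"
  using assms full_mem_P_transfer coef_closed[OF assms(1)] by (auto simp: extension_def)

lemma smult_mem_extension:
  assumes "z \<in> carrier L" "a \<in> carrier K" "a \<noteq> \<zero>"
  shows "(\<lambda>\<zeta>. a \<otimes> z \<zeta>) \<in> extension P \<longleftrightarrow> z \<in> extension P"
proof -
  obtain f x where f: "f \<in> carrier A" "x \<in> F" "coef f x = z" "full f x" using lift_exists[OF assms(1)] .
  have "(\<lambda>\<zeta>. a \<otimes> z \<zeta>) \<in> extension P \<longleftrightarrow> smult a f \<in> P"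
    using mem_extension_iff[OF smult_closed[OF f(1) assms(2)] f(2) full_smult[OF f(4) assms(2)]]
    by (simp add: coef_smult[OF f(1) assms(2)] f(3))
  also have "\<dots> \<longleftrightarrow> f \<in> P" by (rule ideal_smult_iff[OF P_ideal f(1) assms(2,3)])
  also have "\<dots> \<longleftrightarrow> z \<in> extension P" using mem_extension_iff[OF f(1,2,4)] f(3) by simp
  finally show ?thesis .
qed

lemma mult_mem_extension_iff:
  assumes "f \<in> carrier A" "x \<in> F" "full f x" "g \<in> carrier A" "y \<in> F" "full g y"
  shows "coef f x \<otimes>\<^bsub>L\<^esub> coef g y \<in> extension P \<longleftrightarrow> f \<otimes>\<^bsub>A\<^esub> g \<in> P"
proof -
  have "f \<otimes>\<^bsub>A\<^esub> g \<in> P \<longleftrightarrow> coef (f \<otimes>\<^bsub>A\<^esub> g) (x + y) \<in> extension P"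
    using assms by (intro mem_extension_iff[symmetric] full_product faceD(3)[OF F] mult_closed)
  also have "coef (f \<otimes>\<^bsub>A\<^esub> g) (x + y) = (\<lambda>\<zeta>. \<chi> (\<beta> x y) \<otimes> (coef f x \<otimes>\<^bsub>L\<^esub> coef g y) \<zeta>)"
    using assms by (intro coef_product F_subset_G full_on_coset)
  finally show ?thesis
    using smult_mem_extension[of "coef f x \<otimes>\<^bsub>L\<^esub> coef g y" "\<chi> (\<beta> x y)"] assms coef_closed by simp
qed

text \<open>Two lifts with representatives \<open>x\<close> and \<open>y\<close> are added after
  both have been moved to \<open>x + y\<close>. The scalar \<open>\<chi> (- \<beta> t x)\<close>
  undoes the factor produced by left multiplication with the monomial of degree
  \<open>t\<close>.\<close>

lemma extension_shift:
  assumes "f \<in> P" "x \<in> F" "full f x" "t \<in> F"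
  obtains g where "g \<in> P" "full g (t + x)" "coef g (t + x) = coef f x"
proof
  note fA = P_carrier[OF assms(1)]
  let ?m = "monomial K (\<chi> (- \<beta> t x)) t"
  have t: "t \<in> S" using faceD(1)[OF F assms(4)] .
  show "?m \<otimes>\<^bsub>A\<^esub> f \<in> P" using t by (intro ideal.I_l_closed[OF P_ideal assms(1)]) simp
  have "full ?m t" using assms(4) Z_closed(1) by (auto simp: full_def monomial_def)
  then show "full (?m \<otimes>\<^bsub>A\<^esub> f) (t + x)" using assms fA t by (intro full_product) auto
  show "coef (?m \<otimes>\<^bsub>A\<^esub> f) (t + x) = coef f x"
    using L.coeff_closed[OF coef_closed[OF fA]] by (simp add: coef_monomial_mult[OF fA _ assms(4)] \<chi>_mult)
qed

text \<open>Products of coefficients correspond to products of full lifts up to a nonzero scalar,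
  and full elements are normal modulo \<open>P\<close>. Hence two Laurent elements with product in
  the extension have lifts with product in \<open>P\<close>, and one of the lifts is in
  \<open>P\<close>.\<close>

lemma extension_prime: "prime_ideal L (extension P)"
proof -
  interpret LC: cring L by (rule L_cring)
  have mult: "z \<otimes>\<^bsub>L\<^esub> w \<in> extension P" if z: "z \<in> extension P" and w: "w \<in> carrier L" for z w
  proof -
    obtain f x where f: "f \<in> P" "x \<in> F" "full f x" "coef f x = z" using z by (auto simp: extension_def)
    obtain g y where g: "g \<in> carrier A" "y \<in> F" "coef g y = w" "full g y" using lift_exists[OF w] .
    have "f \<otimes>\<^bsub>A\<^esub> g \<in> P" using f(1) g(1) by (rule ideal.I_r_closed[OF P_ideal])
    then show ?thesis using mult_mem_extension_iff[OF P_carrier[OF f(1)] f(2,3) g(1,2,4)] f g by simp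
  qed
  have carr: "z \<in> carrier L" if "z \<in> extension P" for z using that by (simp add: extension_def)
  have ideal: "ideal (extension P) L"
  proof (rule L.ideal_if_closed_monomial)
    show "(\<lambda>_. \<zero>) \<in> extension P"
    proof -
      have "coef (\<lambda>_. \<zero>) 0 = (\<lambda>_. \<zero>)" "full (\<lambda>_. \<zero>) 0" by (auto simp: full_def coef_def)
      then show ?thesis
        using mem_extension_iff[OF zero_in_A faceD(2)[OF F]] ideal_zero[OF P_ideal] by simp
    qed
  next
    fix z w assume zw: "z \<in> extension P" "w \<in> extension P"
    then obtain f x g y where f: "f \<in> P" "x \<in> F" "full f x" "coef f x = z"
      and g: "g \<in> P" "y \<in> F" "full g y" "coef g y = w" by (auto simp: extension_def)
    obtain f' where f': "f' \<in> P" "full f' (y + x)" "coef f' (y + x) = z"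
      using extension_shift[OF f(1-3) g(2)] f(4) by blast
    obtain g' where g': "g' \<in> P" "full g' (y + x)" "coef g' (y + x) = w"
      using extension_shift[OF g(1-3) f(2)] g(4) by (metis add.commute)
    have "coef (f' \<oplus>\<^bsub>A\<^esub> g') (y + x) = z \<oplus>\<^bsub>L\<^esub> w"
      using coef_add[OF P_carrier[OF f'(1)] P_carrier[OF g'(1)]] f' g' by simp
    moreover have "full (f' \<oplus>\<^bsub>A\<^esub> g') (y + x)"
      unfolding full_def
    proof (intro allI impI)
      fix w assume "(f' \<oplus>\<^bsub>A\<^esub> g') w \<noteq> \<zero>"
      then have "f' w \<noteq> \<zero> \<or> g' w \<noteq> \<zero>" by (auto simp: add_eq)
      then show "w \<in> F \<and> w - (y + x) \<in> Z" using f' g' by (auto simp: full_def)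
    qed
    moreover have "f' \<oplus>\<^bsub>A\<^esub> g' \<in> P" using A.ideal_a_closed[OF P_ideal f'(1) g'(1)] .
    ultimately show "z \<oplus>\<^bsub>L\<^esub> w \<in> extension P"
      using mem_extension_iff[OF P_carrier faceD(3)[OF F g(2) f(2)], of "f' \<oplus>\<^bsub>A\<^esub> g'"] by simp
  next
    fix z a u assume "z \<in> extension P" "a \<in> carrier K" "u \<in> carrier (free_Abelian_group {..<r})"
    then show "monomial K a u \<otimes>\<^bsub>L\<^esub> z \<in> extension P" "z \<otimes>\<^bsub>L\<^esub> monomial K a u \<in> extension P"
      using mult[of z "monomial K a u"] LC.m_comm[of z "monomial K a u"] carr by simp_all
  qed (use carr in auto)
  have "\<one>\<^bsub>L\<^esub> \<notin> extension P"
  proof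
    assume "\<one>\<^bsub>L\<^esub> \<in> extension P"
    then have "(\<lambda>\<zeta>. \<chi> (- \<delta> 0) \<otimes> \<one>\<^bsub>L\<^esub> \<zeta>) \<in> extension P" using smult_mem_extension by simp
    then have "coef (mon 0) 0 \<in> extension P" by (simp add: coef_mon[OF faceD(2)[OF F]])
    then have "mon 0 \<in> P" using mem_extension_iff[of "mon 0" 0] full_mon[OF faceD(2)[OF F]] faceD(2)[OF F] by simp
    then show False using mon_in_P_iff[OF zero_in_S] faceD(2)[OF F] by simp
  qed
  moreover have "z \<in> extension P \<or> w \<in> extension P"
    if zw: "z \<in> carrier L" "w \<in> carrier L" "\<forall>t\<in>carrier L. z \<otimes>\<^bsub>L\<^esub> t \<otimes>\<^bsub>L\<^esub> w \<in> extension P" for z w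
  proof -
    have "z \<otimes>\<^bsub>L\<^esub> \<one>\<^bsub>L\<^esub> \<otimes>\<^bsub>L\<^esub> w \<in> extension P" using zw(3) by blast
    then have zw': "z \<otimes>\<^bsub>L\<^esub> w \<in> extension P" using zw by simp
    obtain f x where f: "f \<in> carrier A" "x \<in> F" "coef f x = z" "full f x" using lift_exists[OF zw(1)] .
    obtain g y where g: "g \<in> carrier A" "y \<in> F" "coef g y = w" "full g y" using lift_exists[OF zw(2)] .
    have "f \<otimes>\<^bsub>A\<^esub> g \<in> P" using mult_mem_extension_iff[OF f(1,2,4) g(1,2,4)] zw' f g by simp
    then have "f \<in> P \<or> g \<in> P" by (rule full_normal_prime[OF f(1,4) g(1)])
    then show ?thesis using mem_extension_iff[OF f(1,2,4)] mem_extension_iff[OF g(1,2,4)] f g by simp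
  qed
  ultimately show ?thesis unfolding L.A.prime_ideal_iff_elements using ideal L.A.one_closed by blast
qed

lemma contraction_extension: "contraction (extension P) = P"
proof (intro equalityI subsetI)
  fix f assume "f \<in> contraction (extension P)"
  then have fA: "f \<in> carrier A" and f: "\<And>x. x \<in> G \<Longrightarrow> coef f x \<in> extension P" by (auto simp: contraction_def)
  show "f \<in> P"
  proof (rule mem_P_if_components_in_P[OF fA])
    fix x assume x: "x \<in> F"
    show "component f x \<in> P"
      using mem_extension_iff[OF component_closed[OF fA] x full_component] f[OF F_subset_G[OF x]]
      by (simp add: coef_component[OF fA F_subset_G[OF x]])
  qed
next
  fix f assume f: "f \<in> P"
  note fA = P_carrier[OF f]
  have "coef f x \<in> extension P" if x: "x \<in> G" for x
  proof -
    \<comment> \<open>The extension is described by representatives in \<open>F\<close>, whereas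
      \<open>x\<close> ranges over \<open>G\<close>; multiplication by the monomial of degree
      \<open>b\<close> bridges the gap.\<close>
    obtain b where b: "b \<in> F" "x + b \<in> F" using G_denominator[OF x] by blast
    have bS: "b \<in> S" using faceD(1)[OF F b(1)] .
    have c: "component f x \<in> P" using component_in_P[OF f x] .
    have "mon b \<otimes>\<^bsub>A\<^esub> component f x \<in> P" using bS by (intro ideal.I_l_closed[OF P_ideal c]) simp
    moreover have "full (mon b \<otimes>\<^bsub>A\<^esub> component f x) (b + x)"
      by (rule full_product[OF _ P_carrier[OF c] full_mon[OF b(1)] full_component]) (use bS in simp)
    ultimately have "coef (mon b \<otimes>\<^bsub>A\<^esub> component f x) (b + x) \<in> extension P"
      using mem_extension_iff[OF P_carrier] b by (simp add: add.commute)
    then show ?thesis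
      using smult_mem_extension[OF coef_closed[OF fA]]
      by (simp add: coef_monomial_mult[OF P_carrier[OF c] one_closed b(1)] coef_component[OF fA x])
  qed
  then show "f \<in> contraction (extension P)" using fA by (simp add: contraction_def)
qed

end

lemma stratum_homeomorphic_laurent:
  "subtopology (zariski A) stratum homeomorphic_space zariski L"
proof -
  have SpecL: "ideal Q L" if "Q \<in> Spec L" for Q using that by (simp add: Spec_def prime_ideal_def)
  have "subtopology (zariski A) stratum homeomorphic_space subtopology (zariski L) (Spec L)"
  proof (rule homeomorphic_space_zariski[where c = contraction])
    show "bij_betw contraction (Spec L) stratum"
      unfolding bij_betw_def
    proof
      show "inj_on contraction (Spec L)"
      proof (rule inj_onI)
        fix Q Q' assume *: "Q \<in> Spec L" "Q' \<in> Spec L" "contraction Q = contraction Q'"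
        then show "Q = Q'"
          using contraction_subset_iff[OF SpecL SpecL, OF *(1,2)] contraction_subset_iff[OF SpecL SpecL, OF *(2,1)] by simp
      qed
      show "contraction ` Spec L = stratum"
      proof (intro equalityI subsetI)
        fix P assume "P \<in> stratum"
        then show "P \<in> contraction ` Spec L"
          using extension_prime contraction_extension by (intro image_eqI[of _ _ "extension P"]) (simp_all add: Spec_def)
      qed (auto simp: Spec_def contraction_in_stratum)
    qed
  next
    fix I assume I: "ideal I A"
    \<comment> \<open>An ideal lies in the contraction of \<open>Q\<close> exactly if all
      coefficients of its elements lie in \<open>Q\<close>, so the Laurent ideal they generate
      defines the same closed set.\<close>
    let ?E = "{coef f x | f x. f \<in> I \<and> x \<in> G}"
    have sub: "?E \<subseteq> carrier L" using coef_closed ideal_subset_carrier[OF I] by blast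
    have "I \<subseteq> contraction Q \<longleftrightarrow> Idl\<^bsub>L\<^esub> ?E \<subseteq> Q" if Q: "Q \<in> Spec L" for Q
    proof -
      have "I \<subseteq> contraction Q \<longleftrightarrow> ?E \<subseteq> Q"
        using ideal_subset_carrier[OF I] by (auto simp: contraction_def)
      also have "\<dots> \<longleftrightarrow> Idl\<^bsub>L\<^esub> ?E \<subseteq> Q"
        using L.A.genideal_self[OF sub] L.A.genideal_minimal[OF SpecL[OF Q], of ?E] by blast
      finally show ?thesis .
    qed
    then show "\<exists>J. ideal J L \<and> (\<forall>Q\<in>Spec L. I \<subseteq> contraction Q \<longleftrightarrow> J \<subseteq> Q)"
      using L.A.genideal_ideal[OF sub] by blast
  next
    fix J assume J: "ideal J L"
    then show "\<exists>I. ideal I A \<and> (\<forall>Q\<in>Spec L. I \<subseteq> contraction Q \<longleftrightarrow> J \<subseteq> Q)"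
      using contraction_ideal contraction_subset_iff SpecL by blast
  qed (auto simp: stratum_def ring_A L.ring_A)
  then show ?thesis using subtopology_topspace[of "zariski L"] topspace_zariski[OF L.ring_A] by simp
qed

end

section \<open>Coordinates on sublattices of integer vectors\<close>

lemma keys_subset_lessThan_iff:
  "Poly_Mapping.keys c \<subseteq> {..<m::nat} \<longleftrightarrow> (\<forall>i\<ge>m. Poly_Mapping.lookup c i = 0)"
proof -
  have "Poly_Mapping.keys c \<subseteq> {..<m} \<longleftrightarrow> (\<forall>i. Poly_Mapping.lookup c i \<noteq> 0 \<longrightarrow> i < m)"
    by (auto simp: subset_iff in_keys_iff)
  then show ?thesis by (metis not_less)
qed

locale twisted_lattice_algebra = twisted_algebra K \<chi> \<beta> S
  for K :: "('a, 'b) ring_scheme" (structure) and \<chi> and \<beta> :: "(nat \<Rightarrow>\<^sub>0 int) \<Rightarrow> (nat \<Rightarrow>\<^sub>0 int) \<Rightarrow> int" and S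
begin

lemma \<beta>_frag_cmul: "\<beta> (frag_cmul k b) t = k * \<beta> b t" "\<beta> t (frag_cmul k b) = k * \<beta> t b"
proof -
  have n: "\<beta> (frag_cmul (int n) b) t = int n * \<beta> b t \<and> \<beta> t (frag_cmul (int n) b) = int n * \<beta> t b" for n
    by (induction n) (simp_all add: frag_cmul_distrib \<beta>_simps algebra_simps)
  obtain n where "k = int n \<or> k = - int n" by (metis int_cases2)
  then have "\<beta> (frag_cmul k b) t = k * \<beta> b t \<and> \<beta> t (frag_cmul k b) = k * \<beta> t b"
  proof
    assume "k = - int n"
    then have "frag_cmul k b = - frag_cmul (int n) b" by simp
    then show ?thesis using n[of n] \<open>k = - int n\<close> by (simp only: \<beta>_minus) simp
  qed (use n in simp)
  then show "\<beta> (frag_cmul k b) t = k * \<beta> b t" "\<beta> t (frag_cmul k b) = k * \<beta> t b" by auto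
qed

text \<open>These are the requirements of \<open>twisted_stratum\<close> on \<open>\<theta>\<close>
  and \<open>\<delta>\<close> with the central lattice replaced by an arbitrary \<open>V\<close>,
  which makes an induction over sublattices possible.\<close>

definition coordinates ::
  "(nat \<Rightarrow>\<^sub>0 int) set \<Rightarrow> nat \<Rightarrow> ((nat \<Rightarrow>\<^sub>0 int) \<Rightarrow> nat \<Rightarrow>\<^sub>0 int) \<Rightarrow> ((nat \<Rightarrow>\<^sub>0 int) \<Rightarrow> int) \<Rightarrow> bool" where
  "coordinates V r \<theta> \<delta> \<longleftrightarrow> (\<forall>x y. \<theta> (x + y) = \<theta> x + \<theta> y) \<and>
    inj_on \<theta> {c. Poly_Mapping.keys c \<subseteq> {..<r}} \<and> \<theta> ` {c. Poly_Mapping.keys c \<subseteq> {..<r}} = V \<and>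
    (\<forall>x y. Poly_Mapping.keys x \<subseteq> {..<r} \<longrightarrow> Poly_Mapping.keys y \<subseteq> {..<r} \<longrightarrow>
      \<chi> (\<delta> (x + y)) = \<chi> (\<delta> x + \<delta> y + \<beta> (\<theta> x) (\<theta> y)))"

text \<open>A sublattice on which \<open>\<beta>\<close> is symmetric up to \<open>\<chi>\<close> has a basis \<open>b\<^sub>0, b\<^sub>1, \<dots>\<close>, and
  \<open>\<chi> (\<delta> k)\<close> is the scalar by which \<open>u\<^bsub>\<theta> k\<^esub>\<close> differs from \<open>u\<^bsub>b\<^sub>0\<^esub>\<^bsup>k\<^sub>0\<^esup> u\<^bsub>b\<^sub>1\<^esub>\<^bsup>k\<^sub>1\<^esup> \<dots>\<close>.\<close>

lemma sublattice_coordinates: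
  assumes "V \<subseteq> {c. Poly_Mapping.keys c \<subseteq> {..<n}}" "0 \<in> V" "\<And>x y. x \<in> V \<Longrightarrow> y \<in> V \<Longrightarrow> x - y \<in> V"
    and "\<And>x y. x \<in> V \<Longrightarrow> y \<in> V \<Longrightarrow> \<chi> (\<beta> x y) = \<chi> (\<beta> y x)"
  shows "\<exists>r \<theta> \<delta>. coordinates V r \<theta> \<delta>"
  using assms
proof (induction n arbitrary: V)
  case 0
  then have "V = {0}" by auto
  then show ?case
    unfolding coordinates_def by (intro exI[of _ 0] exI[of _ "\<lambda>_. 0"]) (auto simp: inj_on_def)
next
  case (Suc n)
  let ?l = "Poly_Mapping.lookup"
  have minus: "- x \<in> V" if "x \<in> V" for x using Suc.prems(3)[OF Suc.prems(2) that] by simp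
  have plus: "x + y \<in> V" if "x \<in> V" "y \<in> V" for x y using Suc.prems(3)[OF that(1) minus[OF that(2)]] by simp
  have cmul: "frag_cmul k x \<in> V" if "x \<in> V" for k x
    using frag_closure_minus_cmul[of "\<lambda>x. x \<in> V"] Suc.prems(2,3) that by blast
  have V_n: "Poly_Mapping.keys x \<subseteq> {..<n}" if "x \<in> V" "?l x n = 0" for x
  proof -
    have "Poly_Mapping.keys x \<subseteq> {..<Suc n}" using Suc.prems(1) that(1) by auto
    then have "?l x i = 0" if "i \<ge> Suc n" for i using that by (simp add: keys_subset_lessThan_iff)
    then have "?l x i = 0" if "i \<ge> n" for i using that \<open>?l x n = 0\<close> by (cases "i = n") auto
    then show ?thesis by (simp add: keys_subset_lessThan_iff)
  qed
  show ?case
  proof (cases "\<forall>x\<in>V. ?l x n = 0")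
    case True
    then have "V \<subseteq> {c. Poly_Mapping.keys c \<subseteq> {..<n}}" using V_n by blast
    then show ?thesis by (rule Suc.IH[OF _ Suc.prems(2-4)])
  next
    case False
    then obtain x0 where x0: "x0 \<in> V" "?l x0 n \<noteq> 0" by blast
    \<comment> \<open>The coordinates at position \<open>n\<close> of the elements of
      \<open>V\<close> form a nonzero subgroup of the integers. Its least positive element
      \<open>d\<close> generates it, and an element \<open>b\<close> attaining \<open>d\<close>
      becomes the new basis vector.\<close>
    define D where "D = (\<lambda>d. 0 < d \<and> (\<exists>x\<in>V. ?l x n = int d))"
    have "\<exists>d. D d"
    proof (cases "?l x0 n > 0")
      case True
      then show ?thesis using x0 unfolding D_def by (intro exI[of _ "nat (?l x0 n)"]) auto
    next
      case False
      then have "?l (- x0) n = int (nat (- ?l x0 n))" "0 < nat (- ?l x0 n)" using x0 by auto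
      then show ?thesis using minus[OF x0(1)] unfolding D_def by blast
    qed
    define d where "d = (LEAST d. D d)"
    have "D d" unfolding d_def using \<open>\<exists>d. D d\<close> by (rule LeastI_ex)
    then obtain b where b: "b \<in> V" "?l b n = int d" and d: "d > 0" unfolding D_def by blast
    have dvd: "int d dvd ?l x n" if x: "x \<in> V" for x
    proof (rule ccontr)
      assume "\<not> int d dvd ?l x n"
      then have "?l x n mod int d \<noteq> 0" by (simp add: dvd_eq_mod_eq_0)
      then have pos: "?l x n mod int d > 0" using d pos_mod_sign[of "int d" "?l x n"] by linarith
      have "x - frag_cmul (?l x n div int d) b \<in> V" using x cmul[OF b(1)] Suc.prems(3) by blast
      moreover have "?l (x - frag_cmul (?l x n div int d) b) n = int (nat (?l x n mod int d))"
        using pos by (simp add: lookup_minus b(2) minus_div_mult_eq_mod)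
      ultimately have "D (nat (?l x n mod int d))" unfolding D_def using pos by auto
      then have "d \<le> nat (?l x n mod int d)" unfolding d_def by (rule Least_le)
      then show False using d pos pos_mod_bound[of "int d" "?l x n"] by linarith
    qed
    \<comment> \<open>\<open>V\<close> is the direct sum of this kernel and the multiples of
      \<open>b\<close>.\<close>
    define W where "W = {x \<in> V. ?l x n = 0}"
    have W: "W \<subseteq> {c. Poly_Mapping.keys c \<subseteq> {..<n}}" "0 \<in> W" "\<And>x y. x \<in> W \<Longrightarrow> y \<in> W \<Longrightarrow> x - y \<in> W"
      "\<And>x y. x \<in> W \<Longrightarrow> y \<in> W \<Longrightarrow> \<chi> (\<beta> x y) = \<chi> (\<beta> y x)"
      using V_n Suc.prems(2-4) by (auto simp: W_def lookup_minus)
    obtain r \<theta> \<delta> where "coordinates W r \<theta> \<delta>"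
      using Suc.IH[OF W] by blast
    then have \<theta>_add: "\<And>x y. \<theta> (x + y) = \<theta> x + \<theta> y"
      and \<theta>_inj: "inj_on \<theta> {c. Poly_Mapping.keys c \<subseteq> {..<r}}"
      and \<theta>_img: "\<theta> ` {c. Poly_Mapping.keys c \<subseteq> {..<r}} = W"
      and \<delta>: "\<And>x y. Poly_Mapping.keys x \<subseteq> {..<r} \<Longrightarrow> Poly_Mapping.keys y \<subseteq> {..<r} \<Longrightarrow>
        \<chi> (\<delta> (x + y)) = \<chi> (\<delta> x + \<delta> y + \<beta> (\<theta> x) (\<theta> y))"
      by (simp_all add: coordinates_def)
    define \<tau> where "\<tau> x = x - frag_cmul (?l x r) (frag_of r)" for x :: "nat \<Rightarrow>\<^sub>0 int"
    define \<theta>' where "\<theta>' x = \<theta> (\<tau> x) + frag_cmul (?l x r) b" for x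
    \<comment> \<open>With \<open>k\<close> the exponent of \<open>b\<close> and
      \<open>s = \<theta> (\<tau> x)\<close>, the \<open>k\<close>-th power of \<open>u_b\<close> is
      \<open>\<chi> (\<beta> b b k (k - 1) / 2)\<close> times the monomial of degree
      \<open>k b\<close>, also for negative \<open>k\<close>. Multiplying it on the left by
      \<open>u_s\<close> contributes \<open>k \<beta> s b\<close>. The exponents are added
      up.\<close>
    define \<delta>' where "\<delta>' x = \<delta> (\<tau> x) + \<beta> b b * (?l x r * (?l x r - 1) div 2) + ?l x r * \<beta> (\<theta> (\<tau> x)) b" for x
    have \<tau>_add: "\<tau> (x + y) = \<tau> x + \<tau> y" for x y
      by (simp add: \<tau>_def lookup_add frag_cmul_distrib)
    have \<tau>_keys: "Poly_Mapping.keys (\<tau> x) \<subseteq> {..<r}" if "Poly_Mapping.keys x \<subseteq> {..<Suc r}" for x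
      using that unfolding keys_subset_lessThan_iff
      by (auto simp: \<tau>_def lookup_minus lookup_single when_def)
    have \<tau>_eq: "x = \<tau> x + frag_cmul (?l x r) (frag_of r)" for x by (simp add: \<tau>_def)
    have \<theta>W: "\<theta> (\<tau> x) \<in> W" if "Poly_Mapping.keys x \<subseteq> {..<Suc r}" for x
      using \<theta>_img \<tau>_keys[OF that] by blast
    have l_\<theta>': "?l (\<theta>' x) n = ?l x r * int d" if "Poly_Mapping.keys x \<subseteq> {..<Suc r}" for x
      using \<theta>W[OF that] by (simp add: \<theta>'_def lookup_add b(2) W_def)
    show ?thesis
      unfolding coordinates_def
    proof (intro exI[of _ "Suc r"] exI[of _ \<theta>'] exI[of _ \<delta>'] conjI allI impI)
      show "\<theta>' (x + y) = \<theta>' x + \<theta>' y" for x y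
        by (simp add: \<theta>'_def \<tau>_add \<theta>_add lookup_add frag_cmul_distrib)
      show "inj_on \<theta>' {c. Poly_Mapping.keys c \<subseteq> {..<Suc r}}"
      proof (rule inj_onI, clarsimp)
        fix x y :: "nat \<Rightarrow>\<^sub>0 int"
        assume xy: "Poly_Mapping.keys x \<subseteq> {..<Suc r}" "Poly_Mapping.keys y \<subseteq> {..<Suc r}" "\<theta>' x = \<theta>' y"
        have l: "?l x r = ?l y r" using l_\<theta>'[OF xy(1)] l_\<theta>'[OF xy(2)] xy(3) d by simp
        then have "\<theta> (\<tau> x) = \<theta> (\<tau> y)" using xy(3) by (simp add: \<theta>'_def)
        then have "\<tau> x = \<tau> y" using inj_onD[OF \<theta>_inj] \<tau>_keys xy by blast
        then show "x = y" using \<tau>_eq[of x] \<tau>_eq[of y] l by simp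
      qed
      show "\<theta>' ` {c. Poly_Mapping.keys c \<subseteq> {..<Suc r}} = V"
      proof (intro equalityI subsetI)
        fix v assume "v \<in> \<theta>' ` {c. Poly_Mapping.keys c \<subseteq> {..<Suc r}}"
        then obtain x where "Poly_Mapping.keys x \<subseteq> {..<Suc r}" "v = \<theta>' x" by auto
        then show "v \<in> V" using \<theta>W[of x] plus cmul[OF b(1)] by (simp add: \<theta>'_def W_def)
      next
        fix v assume v: "v \<in> V"
        then obtain k where k: "?l v n = int d * k" using dvd by (auto elim: dvdE)
        have "v - frag_cmul k b \<in> W"
          unfolding W_def using Suc.prems(3)[OF v cmul[OF b(1)]] by (simp add: lookup_minus k b(2))
        then obtain t where t: "Poly_Mapping.keys t \<subseteq> {..<r}" "\<theta> t = v - frag_cmul k b" using \<theta>_img by auto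
        define x where "x = t + frag_cmul k (frag_of r)"
        have lt: "?l t r = 0" using t(1) unfolding keys_subset_lessThan_iff by simp
        have lx: "?l x r = k" by (simp add: x_def lookup_add lt)
        then have "\<tau> x = t" unfolding \<tau>_def by (simp add: x_def)
        then have "v = \<theta>' x" by (simp add: \<theta>'_def lx t(2))
        moreover have "Poly_Mapping.keys x \<subseteq> {..<Suc r}"
          using t(1) unfolding keys_subset_lessThan_iff
          by (auto simp: x_def lookup_add lookup_single when_def)
        ultimately show "v \<in> \<theta>' ` {c. Poly_Mapping.keys c \<subseteq> {..<Suc r}}" by blast
      qed
      fix x y :: "nat \<Rightarrow>\<^sub>0 int"
      assume xy: "Poly_Mapping.keys x \<subseteq> {..<Suc r}" "Poly_Mapping.keys y \<subseteq> {..<Suc r}"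
      define k l s t where "k = ?l x r" and "l = ?l y r" and "s = \<theta> (\<tau> x)" and "t = \<theta> (\<tau> y)"
      have "even (k * (k - 1))" by auto
      then obtain k' where k': "k * (k - 1) = 2 * k'" by (rule evenE)
      have "even (l * (l - 1))" by auto
      then obtain l' where l': "l * (l - 1) = 2 * l'" by (rule evenE)
      have "(k + l) * (k + l - 1) = 2 * (k' + l' + k * l)" using k' l' by (simp add: algebra_simps)
      then have tri: "(k + l) * (k + l - 1) div 2 = k' + l' + k * l" "k * (k - 1) div 2 = k'" "l * (l - 1) div 2 = l'"
        using k' l' by simp_all
      have eq: "\<delta>' (x + y) = \<delta> (\<tau> x + \<tau> y) + \<beta> b b * (k' + l' + k * l) + (k + l) * (\<beta> s b + \<beta> t b)"
        "\<delta>' x = \<delta> (\<tau> x) + \<beta> b b * k' + k * \<beta> s b" "\<delta>' y = \<delta> (\<tau> y) + \<beta> b b * l' + l * \<beta> t b"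
        "\<theta>' x = s + frag_cmul k b" "\<theta>' y = t + frag_cmul l b"
        unfolding \<delta>'_def \<theta>'_def lookup_add \<tau>_add \<theta>_add k_def[symmetric] l_def[symmetric] s_def[symmetric]
          t_def[symmetric] tri \<beta>_add_left by (rule refl)+
      have "\<chi> (\<delta>' (x + y)) = \<chi> (\<delta> (\<tau> x) + \<delta> (\<tau> y) + \<beta> s t + \<beta> b b * (k' + l' + k * l) + (k + l) * (\<beta> s b + \<beta> t b))"
        unfolding eq s_def t_def by (rule \<chi>_cong[OF \<delta>[OF \<tau>_keys[OF xy(1)] \<tau>_keys[OF xy(2)]]]) simp
      \<comment> \<open>The two exponents differ by \<open>k (\<beta> t b - \<beta> b t)\<close>,
        which vanishes after \<open>\<chi>\<close> because \<open>t\<close> and \<open>k b\<close>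
        lie in \<open>V\<close>.\<close>
      also have "\<dots> = \<chi> (\<delta>' x + \<delta>' y + \<beta> (\<theta>' x) (\<theta>' y))"
        unfolding eq
        by (rule \<chi>_cong[OF Suc.prems(4)[OF _ cmul[OF b(1)], of t k]])
          (use \<theta>W[OF xy(2)] in \<open>simp_all add: W_def t_def[symmetric] \<beta>_simps \<beta>_frag_cmul algebra_simps\<close>)
      finally show "\<chi> (\<delta>' (x + y)) = \<chi> (\<delta>' x + \<delta>' y + \<beta> (\<theta>' x) (\<theta>' y))" .
    qed
  qed
qed

text \<open>The central lattice \<open>?V\<close> commutes with \<open>F\<close> and consists of
  differences of elements of \<open>F\<close>, so its members commute with each other. This is the
  symmetry required for coordinates.\<close>

lemma stratum_homeomorphic_laurent_ring:
  assumes S: "S \<subseteq> {c. Poly_Mapping.keys c \<subseteq> {..<n}}" and F: "face F"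
  shows "\<exists>r::nat. subtopology (zariski A) {P \<in> Spec A. \<forall>s\<in>S. mon s \<in> P \<longleftrightarrow> s \<notin> F}
    homeomorphic_space zariski (monoid_ring K (free_Abelian_group {..<r}))"
proof -
  let ?V = "{g. (\<exists>a\<in>F. \<exists>b\<in>F. g = a - b) \<and> (\<forall>h\<in>F. \<chi> (\<beta> h g) = \<chi> (\<beta> g h))}"
  have inv: "\<chi> (- k) = \<chi> (- l)" if "\<chi> k = \<chi> l" for k l by (rule \<chi>_cong[OF that[symmetric]]) simp
  have "?V \<subseteq> {c. Poly_Mapping.keys c \<subseteq> {..<n}}"
    using faceD(1)[OF F] S keys_diff by fast
  moreover have "0 \<in> ?V" using faceD(2)[OF F] by force
  moreover have "x - y \<in> ?V" if xy: "x \<in> ?V" "y \<in> ?V" for x y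
  proof -
    obtain a b c d where *: "a \<in> F" "b \<in> F" "c \<in> F" "d \<in> F" "x = a - b" "y = c - d" using xy by blast
    then have "x - y = (a + d) - (b + c)" "a + d \<in> F" "b + c \<in> F" using faceD(3)[OF F] by simp_all
    then have "\<exists>a\<in>F. \<exists>b\<in>F. x - y = a - b" by blast
    moreover have "\<chi> (\<beta> h (x - y)) = \<chi> (\<beta> (x - y) h)" if "h \<in> F" for h
    proof -
      have hx: "\<chi> (\<beta> h x) = \<chi> (\<beta> x h)" and hy: "\<chi> (\<beta> h y) = \<chi> (\<beta> y h)" using xy that by blast+
      have "\<chi> (\<beta> h x - \<beta> h y) = \<chi> (\<beta> x h - \<beta> h y)" by (rule \<chi>_cong[OF hx]) simp
      also have "\<dots> = \<chi> (\<beta> x h - \<beta> y h)" by (rule \<chi>_cong[OF hy[symmetric]]) simp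
      finally show ?thesis by (simp add: \<beta>_diff)
    qed
    ultimately show ?thesis by blast
  qed
  moreover have "\<chi> (\<beta> x y) = \<chi> (\<beta> y x)" if xy: "x \<in> ?V" "y \<in> ?V" for x y
  proof -
    obtain a b where *: "a \<in> F" "b \<in> F" "x = a - b" using xy by blast
    have a: "\<chi> (\<beta> a y) = \<chi> (\<beta> y a)" and b: "\<chi> (\<beta> b y) = \<chi> (\<beta> y b)" using xy * by blast+
    have "\<chi> (\<beta> a y - \<beta> b y) = \<chi> (\<beta> y a - \<beta> b y)" by (rule \<chi>_cong[OF a]) simp
    also have "\<dots> = \<chi> (\<beta> y a - \<beta> y b)" by (rule \<chi>_cong[OF b[symmetric]]) simp
    finally show ?thesis by (simp add: \<beta>_diff *)
  qed
  ultimately obtain r \<theta> \<delta> where "coordinates ?V r \<theta> \<delta>"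
    using sublattice_coordinates[of ?V n] by blast
  then interpret st: twisted_stratum K \<chi> \<beta> S F r \<theta> \<delta>
    by unfold_locales (simp_all add: coordinates_def F)
  show ?thesis using st.stratum_homeomorphic_laurent unfolding st.stratum_def by (intro exI[of _ r])
qed

end

text \<open>The extension field in the theorem has type \<^typ>\<open>'a ring\<close>, hence the fields by which \<open>K\<close> may
  extend the ring record are dropped.\<close>

definition plain_ring :: "('a, 'b) ring_scheme \<Rightarrow> 'a ring" where
  "plain_ring K = \<lparr>carrier = carrier K, monoid.mult = monoid.mult K, one = monoid.one K,
     ring.zero = ring.zero K, ring.add = ring.add K\<rparr>"

lemma plain_ring_simps [simp]:
  "carrier (plain_ring K) = carrier K" "x \<otimes>\<^bsub>plain_ring K\<^esub> y = x \<otimes>\<^bsub>K\<^esub> y" "\<one>\<^bsub>plain_ring K\<^esub> = \<one>\<^bsub>K\<^esub>"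
  "\<zero>\<^bsub>plain_ring K\<^esub> = \<zero>\<^bsub>K\<^esub>" "x \<oplus>\<^bsub>plain_ring K\<^esub> y = x \<oplus>\<^bsub>K\<^esub> y"
  by (simp_all add: plain_ring_def)

lemma finsum_plain_ring: "finsum (plain_ring K) f T = finsum K f T"
  by (simp add: finsum_def finprod_def plain_ring_def)

lemma laurent_plain_ring: "laurent_ring (plain_ring K) r = monoid_ring K (free_Abelian_group {..<r})"
  by (simp add: laurent_ring_def monoid_ring_def monomial_def finsum_plain_ring cong: if_cong)

lemma algebraic_field_extension_plain_ring:
  assumes "field K" shows "algebraic_field_extension K (plain_ring K) id"
proof -
  interpret K: field K by fact
  have "id \<in> ring_iso K (plain_ring K)"
    by (rule ring_iso_memI) auto
  \<comment> \<open>The resulting field carries an update of its zero to the image of zero, which is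
    the zero already present.\<close>
  from K.ring_iso_imp_img_field[OF this]
  have "field (plain_ring K \<lparr>zero := \<zero>\<^bsub>K\<^esub>\<rparr>)" by (simp only: id_apply)
  moreover have "plain_ring K \<lparr>zero := \<zero>\<^bsub>K\<^esub>\<rparr> = plain_ring K"
    by (simp add: plain_ring_def)
  ultimately have L: "field (plain_ring K)" by (simp only:)
  have "ring.algebraic (plain_ring K) (id ` carrier K) x" if "x \<in> carrier K" for x
    using domain.algebraic_self[OF field.axioms(1)[OF L] ring.carrier_is_subring[OF cring.axioms(1)[OF domain.axioms(1)[OF field.axioms(1)[OF L]]]], of x] that
    by (simp add: over_def)
  moreover have "id \<in> ring_hom K (plain_ring K)"
    by (rule ring_hom_memI) auto
  ultimately show ?thesis using assms L by (simp add: algebraic_field_extension_def over_def)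
qed

section \<open>The monoid of row and column degrees\<close>

lemma (in field) finite_roots_of_unity:
  assumes "d > 0" shows "finite {x \<in> carrier R. x [^] (d::nat) = \<one>}"
proof -
  \<comment> \<open>Coefficient lists start with the leading coefficient.
    \<open>monom \<one> (d - 1)\<close> has length \<open>d\<close>, and appending the constant term
    raises its degree by one, so \<open>?p\<close> is the polynomial \<open>X^d - 1\<close>.\<close>
  let ?p = "monom \<one> (d - 1) @ [\<ominus> \<one>]"
  have "?p \<in> carrier (poly_ring R)"
    unfolding univ_poly_def polynomial_def monom_def by auto
  then have "finite {x. is_root ?p x}" by (rule finite_number_of_roots)
  moreover have "eval ?p x = \<zero>" if x: "x \<in> carrier R" "x [^] d = \<one>" for x
  proof -
    have "eval ?p x = \<one> \<otimes> x [^] (d - 1) \<otimes> x [^] length [\<ominus> \<one>] \<oplus> eval [\<ominus> \<one>] x"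
      using x by (subst eval_append) (auto simp: eval_monom monom_in_carrier)
    also have "\<dots> = x [^] Suc (d - 1) \<oplus> \<ominus> \<one>" using x by simp
    also have "\<dots> = \<zero>" using x assms by (simp add: r_neg del: nat_pow_Suc)
    finally show ?thesis .
  qed
  then have "{x \<in> carrier R. x [^] d = \<one>} \<subseteq> {x. is_root ?p x}"
    by (auto simp: is_root_def)
  ultimately show ?thesis by (rule rev_finite_subset)
qed

text \<open>Otherwise all nonzero elements would be roots of unity of one fixed order, of which
  there are only finitely many.\<close>

lemma (in field) exists_unit_pow_neq:
  assumes "infinite (carrier R)" "a \<noteq> b" shows "\<exists>x\<in>Units R. x [^] (a::nat) \<noteq> x [^] b"
proof -
  have *: "\<exists>x\<in>Units R. x [^] a \<noteq> x [^] b" if "a < b" for a b :: nat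
  proof (rule ccontr)
    assume eq: "\<not> ?thesis"
    have "x [^] (b - a) = \<one>" if "x \<in> carrier R - {\<zero>}" for x
    proof -
      have x: "x \<in> Units R" using that by (simp add: field_Units)
      have "x [^] a \<in> Units R" using x by (rule Units_pow_closed)
      then have u: "x [^] a \<in> carrier R" "x [^] a \<noteq> \<zero>" by (auto simp: field_Units)
      have "x [^] a \<otimes> x [^] (b - a) = x [^] b" using that \<open>a < b\<close> by (simp add: nat_pow_mult)
      also have "\<dots> = x [^] a \<otimes> \<one>" using eq x that by auto
      finally show ?thesis using m_lcancel[OF u(2,1) nat_pow_closed one_closed] that by blast
    qed
    then have "carrier R - {\<zero>} \<subseteq> {x \<in> carrier R. x [^] (b - a) = \<one>}" by blast
    then have "finite (carrier R - {\<zero>})"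
      by (rule finite_subset[OF _ finite_roots_of_unity]) (use \<open>a < b\<close> in simp)
    then show False using assms(1) by simp
  qed
  show ?thesis using *[of a b] *[of b a] assms(2) by (metis nat_neq_iff)
qed

section \<open>The bicharacter and the degree monoid of quantum matrices\<close>

locale quantum_setup = field K
  for K :: "('a, 'b) ring_scheme" (structure) +
  fixes q :: 'a and m n :: nat
  assumes infinite_K: "infinite (carrier K)" and q_unit: "q \<in> Units K"
begin

definition \<chi> :: "int \<Rightarrow> 'a" where "\<chi> k = q [^]\<^bsub>units_of K\<^esub> k"

text \<open>The condition selects pairs \<open>i < l\<close> that are both rows or both columns. So
  \<open>y_i y_l = q y_l y_i\<close> for \<open>i < l\<close> among the rows, likewise among the
  columns, and rows commute with columns: the two commuting quantum affine spaces.\<close>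

definition \<beta> :: "(nat \<Rightarrow>\<^sub>0 int) \<Rightarrow> (nat \<Rightarrow>\<^sub>0 int) \<Rightarrow> int" where
  "\<beta> s t = (\<Sum>i=1..m + n. \<Sum>l=1..m + n. if i < l \<and> (l \<le> m \<or> m < i)
     then Poly_Mapping.lookup s i * Poly_Mapping.lookup t l else 0)"

text \<open>Coordinates \<open>1, \<dots>, m\<close> are row degrees and \<open>m + 1, \<dots>, m + n\<close> are column degrees.\<close>

definition S :: "(nat \<Rightarrow>\<^sub>0 int) set" where
  "S = {s. Poly_Mapping.keys s \<subseteq> {1..m + n} \<and> (\<forall>i. 0 \<le> Poly_Mapping.lookup s i) \<and>
     (\<Sum>i=1..m. Poly_Mapping.lookup s i) = (\<Sum>j=m + 1..m + n. Poly_Mapping.lookup s j)}"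

definition gen :: "nat \<times> nat \<Rightarrow> nat \<Rightarrow>\<^sub>0 int" where
  "gen x = frag_of (fst x) + frag_of (m + snd x)"

definition entry :: "(nat \<Rightarrow> 'a) \<times> (nat \<Rightarrow> 'a) \<Rightarrow> nat \<Rightarrow> 'a" where
  "entry h i = (if i \<le> m then fst h i else snd h (i - m))"

text \<open>The exponents are truncated to natural numbers, which loses nothing on \<open>S\<close>,
  where all coordinates are nonnegative.\<close>

definition char :: "(nat \<Rightarrow> 'a) \<times> (nat \<Rightarrow> 'a) \<Rightarrow> (nat \<Rightarrow>\<^sub>0 int) \<Rightarrow> 'a" where
  "char h s = finprod K (\<lambda>i. entry h i [^] nat (Poly_Mapping.lookup s i)) {1..m + n}"

abbreviation letters :: "(nat \<times> nat) set" where "letters \<equiv> {1..m} \<times> {1..n}"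

lemma group_units: "group (units_of K)"
  by (rule units_group)

lemma q_in_units_of: "q \<in> carrier (units_of K)"
  using q_unit by (simp add: units_of_carrier)

lemma \<chi>_add: "\<chi> (k + l) = \<chi> k \<otimes> \<chi> l"
  using group.int_pow_mult[OF group_units q_in_units_of] by (simp add: \<chi>_def units_of_mult)

lemma \<chi>_closed: "\<chi> k \<in> carrier K"
  using group.int_pow_closed[OF group_units q_in_units_of, of k]
  by (simp add: \<chi>_def units_of_carrier Units_closed)

lemma \<chi>_0: "\<chi> 0 = \<one>"
  by (simp add: \<chi>_def units_of_one)

lemma \<chi>_1: "\<chi> 1 = q"
  using group.int_pow_1[OF group_units q_in_units_of] by (simp add: \<chi>_def)

lemma \<chi>_minus_1: "\<chi> (- 1) = inv q"
proof (rule comm_inv_char[symmetric])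
  show "q \<otimes> \<chi> (- 1) = \<one>" using \<chi>_add[of 1 "- 1"] by (simp add: \<chi>_1 \<chi>_0)
qed (use q_unit \<chi>_closed in auto)

lemma \<beta>_add_left: "\<beta> (s + t) r = \<beta> s r + \<beta> t r"
  and \<beta>_add_right: "\<beta> r (s + t) = \<beta> r s + \<beta> r t"
proof -
  have *: "(if P then a + b else 0) = (if P then a else 0) + (if P then b else 0)" for P and a b :: int
    by simp
  show "\<beta> (s + t) r = \<beta> s r + \<beta> t r" "\<beta> r (s + t) = \<beta> r s + \<beta> r t"
    unfolding \<beta>_def sum.distrib[symmetric] lookup_add distrib_right distrib_left by (intro sum.cong refl *)+
qed

lemma \<beta>_frag_of:
  assumes "i \<in> {1..m + n}" "l \<in> {1..m + n}"
  shows "\<beta> (frag_of i) (frag_of l) = (if i < l \<and> (l \<le> m \<or> m < i) then 1 else 0)"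
proof -
  have "\<beta> (frag_of i) (frag_of l) = (\<Sum>i'=1..m + n. \<Sum>l'=1..m + n.
      if i' = i then if l' = l then if i < l \<and> (l \<le> m \<or> m < i) then 1 else 0 else 0 else 0)"
    unfolding \<beta>_def by (intro sum.cong refl) (auto simp: lookup_single when_def)
  also have "\<dots> = (\<Sum>i'=1..m + n. if i' = i then if i < l \<and> (l \<le> m \<or> m < i) then 1 else 0 else 0)"
    using assms by (intro sum.cong refl) simp
  finally show ?thesis using assms by simp
qed

lemma \<beta>_gen:
  assumes "x \<in> letters" "y \<in> letters"
  shows "\<beta> (gen x) (gen y) = (if fst x < fst y then 1 else 0) + (if snd x < snd y then 1 else 0)"
proof -
  have "fst x \<in> {1..m}" "snd x \<in> {1..n}" "fst y \<in> {1..m}" "snd y \<in> {1..n}" using assms by auto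
  then show ?thesis by (simp add: gen_def \<beta>_add_left \<beta>_add_right \<beta>_frag_of)
qed

lemma zero_in_S: "0 \<in> S"
  by (simp add: S_def)

lemma add_in_S: "s \<in> S \<Longrightarrow> t \<in> S \<Longrightarrow> s + t \<in> S"
  using keys_add[of s t] by (auto simp: S_def lookup_add sum.distrib)

lemma gen_lookup: "Poly_Mapping.lookup (gen x) i = (if i = fst x then 1 else 0) + (if i = m + snd x then 1 else 0)"
  by (simp add: gen_def lookup_add lookup_single when_def eq_commute)

lemma gen_in_S: "x \<in> letters \<Longrightarrow> gen x \<in> S"
proof -
  assume x: "x \<in> letters"
  then have l: "fst x \<in> {1..m}" "snd x \<in> {1..n}" by auto
  have "Poly_Mapping.keys (gen x) \<subseteq> {1..m + n}"
    using l by (auto simp: in_keys_iff gen_lookup split: if_splits)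
  moreover have "(\<Sum>i=1..m. Poly_Mapping.lookup (gen x) i) = 1"
  proof -
    have "(\<Sum>i=1..m. Poly_Mapping.lookup (gen x) i) = (\<Sum>i=1..m. if i = fst x then 1 else 0)"
      using l by (intro sum.cong refl) (auto simp: gen_lookup)
    then show ?thesis using l by simp
  qed
  moreover have "(\<Sum>j=m + 1..m + n. Poly_Mapping.lookup (gen x) j) = 1"
  proof -
    have "(\<Sum>j=m + 1..m + n. Poly_Mapping.lookup (gen x) j) = (\<Sum>j=m + 1..m + n. if j = m + snd x then 1 else 0)"
      using l by (intro sum.cong refl) (auto simp: gen_lookup)
    then show ?thesis using l by simp
  qed
  ultimately show ?thesis by (simp add: S_def gen_lookup)
qed

lemma S_nonneg: "s \<in> S \<Longrightarrow> 0 \<le> Poly_Mapping.lookup s i"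
  by (simp add: S_def)

lemma S_keys: "s \<in> S \<Longrightarrow> Poly_Mapping.lookup s i \<noteq> 0 \<Longrightarrow> i \<in> {1..m + n}"
  unfolding S_def by (auto simp: in_keys_iff subset_iff)

text \<open>Row sum and column sum agree and all coordinates are nonnegative, so if one side
  vanishes identically, the other does too.\<close>

lemma S_row_col:
  assumes s: "s \<in> S"
  shows "i \<in> {1..m} \<Longrightarrow> Poly_Mapping.lookup s i \<noteq> 0 \<Longrightarrow> \<exists>j\<in>{1..n}. Poly_Mapping.lookup s (m + j) \<noteq> 0"
    and "j \<in> {1..n} \<Longrightarrow> Poly_Mapping.lookup s (m + j) \<noteq> 0 \<Longrightarrow> \<exists>i\<in>{1..m}. Poly_Mapping.lookup s i \<noteq> 0"
proof -
  let ?l = "Poly_Mapping.lookup s"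
  have eq: "(\<Sum>i=1..m. ?l i) = (\<Sum>j=m + 1..m + n. ?l j)" using s by (simp add: S_def)
  show "\<exists>j\<in>{1..n}. ?l (m + j) \<noteq> 0" if i: "i \<in> {1..m}" "?l i \<noteq> 0"
  proof (rule ccontr)
    assume "\<not> ?thesis"
    then have z: "?l (m + j) = 0" if "j \<in> {1..n}" for j using that by blast
    have "?l j = 0" if "j \<in> {m + 1..m + n}" for j
    proof -
      have "j - m \<in> {1..n}" "m + (j - m) = j" using that by auto
      then show ?thesis using z by metis
    qed
    then have "(\<Sum>i=1..m. ?l i) = 0" unfolding eq by (intro sum.neutral) auto
    then show False using i S_nonneg[OF s] by (auto simp: sum_nonneg_eq_0_iff)
  qed
  show "\<exists>i\<in>{1..m}. ?l i \<noteq> 0" if j: "j \<in> {1..n}" "?l (m + j) \<noteq> 0"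
  proof (rule ccontr)
    assume "\<not> ?thesis"
    then have "(\<Sum>j=m + 1..m + n. ?l j) = 0" unfolding eq[symmetric] by (intro sum.neutral) auto
    then show False using j S_nonneg[OF s] by (auto simp: sum_nonneg_eq_0_iff)
  qed
qed

lemma S_minus_gen:
  assumes s: "s \<in> S" and x: "x \<in> letters"
    and nz: "Poly_Mapping.lookup s (fst x) \<noteq> 0" "Poly_Mapping.lookup s (m + snd x) \<noteq> 0"
  shows "s - gen x \<in> S"
proof -
  have l: "fst x \<in> {1..m}" "snd x \<in> {1..n}" using x by auto
  have "Poly_Mapping.keys (s - gen x) \<subseteq> {1..m + n}"
    using s gen_in_S[OF x] keys_diff[of s "gen x"] by (auto simp: S_def)
  moreover have "0 \<le> Poly_Mapping.lookup (s - gen x) i" for i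
    using S_nonneg[OF s, of i] nz l by (auto simp: lookup_minus gen_lookup)
  moreover have "(\<Sum>i=1..m. Poly_Mapping.lookup (s - gen x) i) = (\<Sum>j=m + 1..m + n. Poly_Mapping.lookup (s - gen x) j)"
    using s gen_in_S[OF x] by (simp add: S_def lookup_minus sum_subtractf)
  ultimately show ?thesis by (simp add: S_def)
qed

text \<open>A nonzero element of \<open>S\<close> involves some row and some column. Subtracting the
  generator of that pair stays in \<open>S\<close> and lowers the row sum by one. So
  \<open>S\<close> is generated by the degrees of the matrix entries.\<close>

lemma S_induct [consumes 1, case_names zero add]:
  assumes "s \<in> S" and "P 0"
    and step: "\<And>s x. s \<in> S \<Longrightarrow> x \<in> letters \<Longrightarrow> P s \<Longrightarrow> P (gen x + s)"
  shows "P s"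
  using assms(1)
proof (induction "nat (\<Sum>i=1..m. Poly_Mapping.lookup s i)" arbitrary: s rule: less_induct)
  case less
  show ?case
  proof (cases "s = 0")
    case False
    then obtain i where i: "Poly_Mapping.lookup s i \<noteq> 0" by (metis lookup_zero poly_mapping_eqI)
    have "\<exists>a\<in>{1..m}. \<exists>b\<in>{1..n}. Poly_Mapping.lookup s a \<noteq> 0 \<and> Poly_Mapping.lookup s (m + b) \<noteq> 0"
    proof (cases "i \<le> m")
      case True
      then show ?thesis using S_row_col(1)[OF less.prems, of i] i S_keys[OF less.prems i] by auto
    next
      case False
      then have "m + (i - m) = i" "i - m \<in> {1..n}" using S_keys[OF less.prems i] by auto
      then show ?thesis using S_row_col(2)[OF less.prems, of "i - m"] i by metis
    qed
    then obtain x where x: "x \<in> letters" "Poly_Mapping.lookup s (fst x) \<noteq> 0" "Poly_Mapping.lookup s (m + snd x) \<noteq> 0"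
      by (auto intro: that[of "(a, b)" for a b])
    let ?s = "s - gen x"
    have S: "?s \<in> S" by (rule S_minus_gen[OF less.prems x])
    have "(\<Sum>i=1..m. Poly_Mapping.lookup (gen x) i) = (\<Sum>i=1..m. if i = fst x then 1 else 0)"
      using x by (intro sum.cong refl) (auto simp: gen_lookup)
    also have "\<dots> = 1" using x by (auto simp: mem_Times_iff)
    finally have "(\<Sum>i=1..m. Poly_Mapping.lookup ?s i) = (\<Sum>i=1..m. Poly_Mapping.lookup s i) - 1"
      by (simp add: lookup_minus sum_subtractf)
    moreover have "(\<Sum>i=1..m. Poly_Mapping.lookup ?s i) \<ge> 0" by (intro sum_nonneg S_nonneg[OF S])
    ultimately have "P ?s" by (intro less.hyps S) simp
    then show ?thesis using step[OF S x(1)] by simp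
  qed (use assms(2) in simp)
qed

sublocale twisted_lattice_algebra K \<chi> \<beta> S
  by unfold_locales (auto simp: \<chi>_closed \<chi>_add \<chi>_0 \<beta>_add_left \<beta>_add_right zero_in_S add_in_S)

subsection \<open>The torus\<close>

lemma entry_in_Units:
  assumes "h \<in> carrier (torus K m n)" "i \<in> {1..m + n}"
  shows "entry h i \<in> Units K"
proof -
  have "fst h \<in> (\<Pi>\<^sub>E i\<in>{1..m}. Units K)" "snd h \<in> (\<Pi>\<^sub>E j\<in>{1..n}. Units K)"
    using assms(1) by (auto simp: torus_def units_of_carrier)
  moreover have "i - m \<in> {1..n}" if "\<not> i \<le> m" using that assms(2) by auto
  ultimately show ?thesis using assms(2) by (auto simp: PiE_mem entry_def)
qed

lemma entry_closed: "h \<in> carrier (torus K m n) \<Longrightarrow> i \<in> {1..m + n} \<Longrightarrow> entry h i \<in> carrier K"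
  using entry_in_Units Units_closed by blast

lemma group_torus: "group (torus K m n)"
  unfolding torus_def by (intro DirProd_group product_group group_units)

lemma char_closed: "h \<in> carrier (torus K m n) \<Longrightarrow> char h s \<in> carrier K"
  unfolding char_def by (intro finprod_closed Pi_I nat_pow_closed entry_closed)

lemma char_mult:
  assumes "h \<in> carrier (torus K m n)" "h' \<in> carrier (torus K m n)"
  shows "char (h \<otimes>\<^bsub>torus K m n\<^esub> h') s = char h s \<otimes> char h' s"
proof -
  note c = entry_closed[OF assms(1)] entry_closed[OF assms(2)]
  have e: "entry (h \<otimes>\<^bsub>torus K m n\<^esub> h') i = entry h i \<otimes> entry h' i" if "i \<in> {1..m + n}" for i
    using that by (auto simp: torus_def mult_DirProd' product_group_def units_of_mult entry_def)
  have "char (h \<otimes>\<^bsub>torus K m n\<^esub> h') s = finprod K (\<lambda>i. (entry h i [^] nat (Poly_Mapping.lookup s i)) \<otimes> (entry h' i [^] nat (Poly_Mapping.lookup s i))) {1..m + n}"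
    unfolding char_def
  proof (rule finprod_cong'[OF refl])
    show "entry (h \<otimes>\<^bsub>torus K m n\<^esub> h') i [^] nat (Poly_Mapping.lookup s i) =
       (entry h i [^] nat (Poly_Mapping.lookup s i)) \<otimes> (entry h' i [^] nat (Poly_Mapping.lookup s i))" if "i \<in> {1..m + n}" for i
      unfolding e[OF that] by (rule nat_pow_distrib[OF c(1)[OF that] c(2)[OF that]])
  qed (intro Pi_I m_closed nat_pow_closed c)
  also have "\<dots> = char h s \<otimes> char h' s"
    unfolding char_def by (intro finprod_multf Pi_I nat_pow_closed c)
  finally show ?thesis .
qed

lemma char_one: "char \<one>\<^bsub>torus K m n\<^esub> s = \<one>"
  unfolding char_def torus_def entry_def
  by (intro finprod_one_eqI) (auto simp: product_group_def units_of_one)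

lemma char_add:
  assumes h: "h \<in> carrier (torus K m n)" and s: "s \<in> S" and t: "t \<in> S"
  shows "char h (s + t) = char h s \<otimes> char h t"
proof -
  note c = entry_closed[OF h]
  have "char h (s + t) = finprod K (\<lambda>i. (entry h i [^] nat (Poly_Mapping.lookup s i)) \<otimes> (entry h i [^] nat (Poly_Mapping.lookup t i))) {1..m + n}"
    unfolding char_def
  proof (rule finprod_cong'[OF refl])
    show "entry h i [^] nat (Poly_Mapping.lookup (s + t) i) =
       (entry h i [^] nat (Poly_Mapping.lookup s i)) \<otimes> (entry h i [^] nat (Poly_Mapping.lookup t i))" if "i \<in> {1..m + n}" for i
      unfolding nat_pow_mult[OF c[OF that]] lookup_add nat_add_distrib[OF S_nonneg[OF s] S_nonneg[OF t]] ..
  qed (intro Pi_I m_closed nat_pow_closed c)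
  also have "\<dots> = char h s \<otimes> char h t"
    unfolding char_def by (intro finprod_multf Pi_I nat_pow_closed c)
  finally show ?thesis .
qed

lemma char_gen:
  assumes h: "h \<in> carrier (torus K m n)" and x: "x \<in> letters"
  shows "char h (gen x) = fst h (fst x) \<otimes> snd h (snd x)"
proof -
  have l: "fst x \<in> {1..m}" "snd x \<in> {1..n}" using x by auto
  then have l': "fst x \<in> {1..m + n}" "m + snd x \<in> {1..m + n}" "fst x \<noteq> m + snd x" by auto
  note c = entry_closed[OF h]
  have "char h (gen x) = finprod K (\<lambda>i. (if i = fst x then entry h i else \<one>) \<otimes> (if i = m + snd x then entry h i else \<one>)) {1..m + n}"
    unfolding char_def
  proof (rule finprod_cong'[OF refl])
    fix i assume "i \<in> {1..m + n}"
    then show "entry h i [^] nat (Poly_Mapping.lookup (gen x) i) =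
      (if i = fst x then entry h i else \<one>) \<otimes> (if i = m + snd x then entry h i else \<one>)"
      using c[of i] l'(3) by (cases "i = fst x"; cases "i = m + snd x") (simp_all add: gen_lookup del: pow_nat)
  qed (use c in auto)
  also have "\<dots> = finprod K (\<lambda>i. if i = fst x then entry h i else \<one>) {1..m + n} \<otimes> finprod K (\<lambda>i. if i = m + snd x then entry h i else \<one>) {1..m + n}"
    using c by (intro finprod_multf) auto
  also have "finprod K (\<lambda>i. if i = fst x then entry h i else \<one>) {1..m + n} = entry h (fst x)"
    using c l' by (intro finprod_singleton_swap[of _ _ "entry h"]) auto
  also have "finprod K (\<lambda>i. if i = m + snd x then entry h i else \<one>) {1..m + n} = entry h (m + snd x)"
    using c l' by (intro finprod_singleton_swap[of _ _ "entry h"]) auto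
  finally show ?thesis using l by (auto simp: entry_def)
qed

lemma char_separates:
  assumes s: "s \<in> S" and t: "t \<in> S" and "s \<noteq> t"
  shows "\<exists>h\<in>carrier (torus K m n). char h s \<noteq> char h t"
proof -
  obtain k where k: "Poly_Mapping.lookup s k \<noteq> Poly_Mapping.lookup t k" using assms(3) by (metis poly_mapping_eqI)
  then have "Poly_Mapping.lookup s k \<noteq> 0 \<or> Poly_Mapping.lookup t k \<noteq> 0" by auto
  then have kI: "k \<in> {1..m + n}" using S_keys[OF s] S_keys[OF t] by blast
  have "nat (Poly_Mapping.lookup s k) \<noteq> nat (Poly_Mapping.lookup t k)"
    using k S_nonneg[OF s, of k] S_nonneg[OF t, of k] by simp
  then obtain x where x: "x \<in> Units K" "x [^] nat (Poly_Mapping.lookup s k) \<noteq> x [^] nat (Poly_Mapping.lookup t k)"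
    using exists_unit_pow_neq[OF infinite_K] by blast
  \<comment> \<open>Only the coordinate \<open>k\<close>, in which \<open>s\<close> and
    \<open>t\<close> differ, is moved, so the character reduces to a power of
    \<open>x\<close>.\<close>
  define h where "h = (\<lambda>i\<in>{1..m}. if i = k then x else \<one>, \<lambda>j\<in>{1..n}. if m + j = k then x else \<one>)"
  have h: "h \<in> carrier (torus K m n)" using x by (auto simp: h_def torus_def units_of_carrier)
  have entry: "entry h i = (if i = k then x else \<one>)" if "i \<in> {1..m + n}" for i
    using that by (auto simp: entry_def h_def)
  have char: "char h u = x [^] nat (Poly_Mapping.lookup u k)" for u
  proof -
    have "char h u = finprod K (\<lambda>i. if i = k then x [^] nat (Poly_Mapping.lookup u i) else \<one>) {1..m + n}"
      unfolding char_def using Units_closed[OF x(1)] by (intro finprod_cong'[OF refl]) (auto simp: entry)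
    also have "\<dots> = x [^] nat (Poly_Mapping.lookup u k)"
      using kI Units_closed[OF x(1)] by (intro finprod_singleton_swap) auto
    finally show ?thesis .
  qed
  show ?thesis using x(2) h unfolding char[symmetric] by blast
qed

sublocale twisted_algebra_torus K \<chi> \<beta> S "torus K m n" char
proof unfold_locales
  interpret T: group "torus K m n" by (rule group_torus)
  fix h assume h: "h \<in> carrier (torus K m n)"
  have "char (inv\<^bsub>torus K m n\<^esub> h) s \<otimes> char h s = \<one>" for s
    using char_mult[OF T.inv_closed[OF h] h, of s] char_one h by simp
  then show "\<exists>h'\<in>carrier (torus K m n). \<forall>s\<in>S. char h' s \<otimes> char h s = \<one>" using h T.inv_closed by blast
  fix h' assume "h' \<in> carrier (torus K m n)"
  then show "\<exists>h''\<in>carrier (torus K m n). \<forall>s\<in>S. char h'' s = char h s \<otimes> char h' s"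
    using char_mult[OF h] T.m_closed[OF h] by blast
next
  show "carrier (torus K m n) \<noteq> {}" using group.is_monoid[OF group_torus] monoid.one_closed by blast
qed (use char_closed char_separates in auto)

subsection \<open>The faces\<close>

text \<open>Nonzero faces correspond to pairs of nonempty sets of rows and columns, here encoded as
  \<open>U = R \<union> (m + C)\<close>.\<close>

definition face_of :: "nat set \<Rightarrow> (nat \<Rightarrow>\<^sub>0 int) set" where
  "face_of U = {s \<in> S. Poly_Mapping.keys s \<subseteq> U}"

definition face_sets :: "nat set set" where
  "face_sets = insert {} ((\<lambda>(R, C). R \<union> (+) m ` C) ` ((Pow {1..m} - {{}}) \<times> (Pow {1..n} - {{}})))"

lemma keys_add_S:
  assumes "s \<in> S" "t \<in> S" shows "Poly_Mapping.keys (s + t) = Poly_Mapping.keys s \<union> Poly_Mapping.keys t"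
proof -
  have "Poly_Mapping.lookup (s + t) i \<noteq> 0 \<longleftrightarrow> Poly_Mapping.lookup s i \<noteq> 0 \<or> Poly_Mapping.lookup t i \<noteq> 0" for i
    using S_nonneg[OF assms(1), of i] S_nonneg[OF assms(2), of i] by (auto simp: lookup_add)
  then show ?thesis by (auto simp: in_keys_iff)
qed

lemma face_face_of: "face (face_of U)"
  unfolding face_def face_of_def using keys_add_S add_in_S by auto

lemma keys_gen: "x \<in> letters \<Longrightarrow> Poly_Mapping.keys (gen x) = {fst x, m + snd x}"
  by (auto simp: in_keys_iff gen_lookup split: if_splits)

text \<open>Two opposite corners of a rectangle of matrix positions have the same total degree as
  the other two. Since \<open>F\<close> is a face, the positions whose generators lie in
  \<open>F\<close> therefore form a product of a set of rows and a set of columns.\<close>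

lemma face_eq_face_of:
  assumes F: "face F" shows "\<exists>U\<in>face_sets. F = face_of U"
proof -
  define E where "E = {x \<in> letters. gen x \<in> F}"
  define R where "R = fst ` E"
  define C where "C = snd ` E"
  have cross: "(fst x, snd y) \<in> E" if "x \<in> E" "y \<in> E" for x y
  proof -
    have "gen x + gen y \<in> F" using that faceD(3)[OF F] by (simp add: E_def)
    moreover have "gen x + gen y = gen (fst x, snd y) + gen (fst y, snd x)" by (simp add: gen_def ac_simps)
    moreover have "(fst x, snd y) \<in> letters" "(fst y, snd x) \<in> letters" using that by (auto simp: E_def)
    ultimately show ?thesis using faceD(4)[OF F, of "gen (fst x, snd y)" "gen (fst y, snd x)"] gen_in_S by (simp add: E_def)
  qed
  have "F = face_of (R \<union> (+) m ` C)"
  proof (intro equalityI subsetI)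
    fix s assume s: "s \<in> F"
    then have "s \<in> S" by (rule faceD(1)[OF F])
    then show "s \<in> face_of (R \<union> (+) m ` C)" using s
    proof (induction s rule: S_induct)
      case zero
      then show ?case by (simp add: face_of_def)
    next
      case (add s x)
      have gs: "gen x \<in> F" "s \<in> F"
        using faceD(4,5)[OF F gen_in_S[OF add(2)] add(1)] add(4) by blast+
      then have "x \<in> E" using add by (simp add: E_def)
      then have "Poly_Mapping.keys (gen x) \<subseteq> R \<union> (+) m ` C"
        using keys_gen[OF add(2)] by (auto simp: R_def C_def)
      then show ?case
        using add.IH[OF gs(2)] keys_add_S[OF gen_in_S[OF add(2)] add(1)] add_in_S[OF gen_in_S[OF add(2)] add(1)]
        by (simp add: face_of_def)
    qed
  next
    fix s assume s: "s \<in> face_of (R \<union> (+) m ` C)"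
    then have "s \<in> S" by (simp add: face_of_def)
    then show "s \<in> F" using s
    proof (induction s rule: S_induct)
      case zero
      then show ?case using faceD(2)[OF F] by simp
    next
      case (add s x)
      have k: "Poly_Mapping.keys (gen x) \<subseteq> R \<union> (+) m ` C" "Poly_Mapping.keys s \<subseteq> R \<union> (+) m ` C"
        using add(4) keys_add_S[OF gen_in_S[OF add(2)] add(1)] by (auto simp: face_of_def)
      have l: "fst x \<in> {1..m}" "snd x \<in> {1..n}" using add(2) by auto
      have "R \<subseteq> {1..m}" "C \<subseteq> {1..n}" by (auto simp: R_def C_def E_def)
      then have "fst x \<in> R" "snd x \<in> C" using k(1) l unfolding keys_gen[OF add(2)] by force+
      then obtain y z where "y \<in> E" "z \<in> E" "fst x = fst y" "snd x = snd z" unfolding R_def C_def by auto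
      then have "x \<in> E" using cross[of y z] by (metis prod.collapse)
      moreover have "s \<in> F" using add.IH add(1) k(2) by (simp add: face_of_def)
      ultimately show ?case using faceD(3)[OF F] by (simp add: E_def)
    qed
  qed
  moreover have "R \<union> (+) m ` C \<in> face_sets"
  proof (cases "E = {}")
    case True
    then show ?thesis by (simp add: face_sets_def R_def C_def)
  next
    case False
    have "(R, C) \<in> (Pow {1..m} - {{}}) \<times> (Pow {1..n} - {{}})"
      using False by (auto simp: R_def C_def E_def)
    then show ?thesis unfolding face_sets_def by (intro insertI2) (rule image_eqI[rotated], auto)
  qed
  ultimately show ?thesis by blast
qed

text \<open>\<open>U\<close> is recovered as the union of the supports of the elements of its face.
  A row of \<open>U\<close> occurs there only in company of a column and conversely, which is why
  both sets must be nonempty.\<close>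

lemma inj_on_face_of: "inj_on face_of face_sets"
proof -
  have "(\<Union>s\<in>face_of U. Poly_Mapping.keys s) = U" if U: "U \<in> face_sets" for U
  proof
    show "(\<Union>s\<in>face_of U. Poly_Mapping.keys s) \<subseteq> U" by (auto simp: face_of_def)
    show "U \<subseteq> (\<Union>s\<in>face_of U. Poly_Mapping.keys s)"
    proof (cases "U = {}")
      case False
      then obtain R C where RC: "R \<subseteq> {1..m}" "R \<noteq> {}" "C \<subseteq> {1..n}" "C \<noteq> {}" "U = R \<union> (+) m ` C"
        using U by (auto simp: face_sets_def)
      obtain i0 j0 where ij: "i0 \<in> R" "j0 \<in> C" using RC by blast
      have g: "{i, m + j} \<subseteq> (\<Union>s\<in>face_of U. Poly_Mapping.keys s)" if "i \<in> R" "j \<in> C" for i j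
      proof -
        have x: "(i, j) \<in> letters" using that RC by auto
        have "gen (i, j) \<in> face_of U"
          using gen_in_S[OF x] keys_gen[OF x] that RC(5) by (simp add: face_of_def)
        then show ?thesis using keys_gen[OF x] by (metis UN_upper fst_conv snd_conv)
      qed
      show ?thesis
      proof
        fix u assume "u \<in> U"
        then consider "u \<in> R" | j where "j \<in> C" "u = m + j" using RC(5) by blast
        then show "u \<in> (\<Union>s\<in>face_of U. Poly_Mapping.keys s)" using g ij by cases blast+
      qed
    qed simp
  qed
  then show ?thesis by (rule inj_on_inverseI)
qed

lemma card_face_sets: "card face_sets = (2 ^ m - 1) * (2 ^ n - 1) + 1"
proof -
  let ?P = "(Pow {1..m} - {{}}) \<times> (Pow {1..n} - {{}})"
  let ?f = "\<lambda>(R, C). R \<union> (+) m ` C"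
  have "inj_on ?f ?P"
  \<comment> \<open>Rows and shifted columns occupy disjoint ranges, so both sets can be read off
    their union.\<close>
  proof (rule inj_on_inverseI[where g = "\<lambda>U. (U \<inter> {1..m}, {j \<in> {1..n}. m + j \<in> U})"])
    fix p assume "p \<in> ?P"
    then obtain R C where p: "p = (R, C)" "R \<subseteq> {1..m}" "C \<subseteq> {1..n}" by auto
    have "(R \<union> (+) m ` C) \<inter> {1..m} = R" using p by auto
    moreover have "{j \<in> {1..n}. m + j \<in> R \<union> (+) m ` C} = C" using p by auto
    ultimately show "((?f p) \<inter> {1..m}, {j \<in> {1..n}. m + j \<in> ?f p}) = p" by (simp add: p(1))
  qed
  then have "card (?f ` ?P) = card ?P" by (rule card_image)
  also have "\<dots> = (2 ^ m - 1) * (2 ^ n - 1)"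
    by (simp add: card_cartesian_product card_Diff_singleton card_Pow)
  finally have c: "card (?f ` ?P) = (2 ^ m - 1) * (2 ^ n - 1)" .
  have "{} \<notin> ?f ` ?P" by auto
  then show ?thesis unfolding face_sets_def using c by (subst card_insert_disjoint) auto
qed

lemma card_faces: "card {F. face F} = (2 ^ m - 1) * (2 ^ n - 1) + 1"
proof -
  have "{F. face F} = face_of ` face_sets" using face_eq_face_of face_face_of by blast
  then show ?thesis using card_image[OF inj_on_face_of] card_face_sets by simp
qed

lemma twisted_algebra_H_spectrum:
  "card {P. H_prime (torus K m n) act A P} = (2 ^ m - 1) * (2 ^ n - 1) + 1"
  "H_prime (torus K m n) act A P \<Longrightarrow> completely_prime A P"
  "H_prime (torus K m n) act A P \<Longrightarrow> \<exists>r. subtopology (zariski A) (H_stratum (torus K m n) act A P)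
     homeomorphic_space zariski (laurent_ring (plain_ring K) r)"
proof -
  show "card {P. H_prime (torus K m n) act A P} = (2 ^ m - 1) * (2 ^ n - 1) + 1"
    by (simp add: card_H_primes card_faces)
  assume "H_prime (torus K m n) act A P"
  then obtain F where F: "face F" "P = face_ideal F" using H_primes_eq by blast
  show "completely_prime A P" unfolding F(2) by (rule completely_prime_face_ideal[OF F(1)])
  have "S \<subseteq> {c. Poly_Mapping.keys c \<subseteq> {..<Suc (m + n)}}" by (auto simp: S_def)
  then show "\<exists>r. subtopology (zariski A) (H_stratum (torus K m n) act A P)
     homeomorphic_space zariski (laurent_ring (plain_ring K) r)"
    using stratum_homeomorphic_laurent_ring[OF _ F(1)] unfolding F(2) H_stratum_face_ideal[OF F(1)] laurent_plain_ring
    by blast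
qed

end

section \<open>The quotient by the quantum minors as a twisted monoid algebra\<close>

lemma carrier_FactRing: "carrier (R Quot I) = (\<lambda>x. I +>\<^bsub>R\<^esub> x) ` carrier R"
  by (auto simp: FactRing_def A_RCOSETS_def')

lemma zero_FactRing: "\<zero>\<^bsub>R Quot I\<^esub> = I"
  by (simp add: FactRing_def)

text \<open>Since \<open>h\<close> kills \<open>I\<close>, the image of a coset is a singleton, and
  \<open>the_elem\<close> picks its only member.\<close>

lemma quotient_hom:
  assumes h: "ring_hom_ring R S h" and I: "ideal I R" and zero: "\<And>x. x \<in> I \<Longrightarrow> h x = \<zero>\<^bsub>S\<^esub>"
  shows "x \<in> carrier R \<Longrightarrow> the_elem (h ` (I +>\<^bsub>R\<^esub> x)) = h x"
    and "ring_hom_ring (R Quot I) S (\<lambda>C. the_elem (h ` C))"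
proof -
  interpret h: ring_hom_ring R S h by (rule h)
  interpret I: ideal I R by (rule I)
  have carr: "i \<in> carrier R" if "i \<in> I" for i using that by (rule I.Icarr)
  have val: "the_elem (h ` (I +>\<^bsub>R\<^esub> x)) = h x" if x: "x \<in> carrier R" for x
  proof -
    have "h ` (I +>\<^bsub>R\<^esub> x) = {h x}"
    proof
      show "h ` (I +>\<^bsub>R\<^esub> x) \<subseteq> {h x}" using x zero carr by (auto simp: a_r_coset_def')
      show "{h x} \<subseteq> h ` (I +>\<^bsub>R\<^esub> x)" using I.a_rcos_self[OF x] by blast
    qed
    then show ?thesis by simp
  qed
  then show "x \<in> carrier R \<Longrightarrow> the_elem (h ` (I +>\<^bsub>R\<^esub> x)) = h x" .
  interpret p: ring_hom_ring R "R Quot I" "(+>\<^bsub>R\<^esub>) I" by (rule I.rcos_ring_hom_ring)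
  have rep: "\<exists>x\<in>carrier R. C = I +>\<^bsub>R\<^esub> x" if "C \<in> carrier (R Quot I)" for C
    using that unfolding carrier_FactRing by (rule imageE) blast
  show "ring_hom_ring (R Quot I) S (\<lambda>C. the_elem (h ` C))"
  proof (rule ring_hom_ringI)
    show "ring (R Quot I)" by (rule I.quotient_is_ring)
    show "ring S" by (rule h.S.ring_axioms)
  next
    fix C assume "C \<in> carrier (R Quot I)"
    then obtain x where "x \<in> carrier R" "C = I +>\<^bsub>R\<^esub> x" using rep by blast
    then show "the_elem (h ` C) \<in> carrier S" using val by simp
  next
    fix C D assume "C \<in> carrier (R Quot I)" "D \<in> carrier (R Quot I)"
    then obtain x y where "x \<in> carrier R" "C = I +>\<^bsub>R\<^esub> x" "y \<in> carrier R" "D = I +>\<^bsub>R\<^esub> y" using rep by blast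
    then show "the_elem (h ` (C \<otimes>\<^bsub>R Quot I\<^esub> D)) = the_elem (h ` C) \<otimes>\<^bsub>S\<^esub> the_elem (h ` D)"
      "the_elem (h ` (C \<oplus>\<^bsub>R Quot I\<^esub> D)) = the_elem (h ` C) \<oplus>\<^bsub>S\<^esub> the_elem (h ` D)"
      by (simp_all add: val flip: p.hom_mult p.hom_add)
  next
    show "the_elem (h ` \<one>\<^bsub>R Quot I\<^esub>) = \<one>\<^bsub>S\<^esub>" using val[of "\<one>\<^bsub>R\<^esub>"] p.hom_one by simp
  qed
qed

lemma image_coset:
  assumes "ring R" "ideal I R" "x \<in> carrier R" "g ` I = I"
    and add: "\<And>a b. a \<in> carrier R \<Longrightarrow> b \<in> carrier R \<Longrightarrow> g (a \<oplus>\<^bsub>R\<^esub> b) = g a \<oplus>\<^bsub>R\<^esub> g b"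
  shows "g ` (I +>\<^bsub>R\<^esub> x) = I +>\<^bsub>R\<^esub> g x"
proof -
  have carr: "i \<in> carrier R" if "i \<in> I" for i using that ideal.Icarr[OF assms(2)] by blast
  have "g ` (I +>\<^bsub>R\<^esub> x) = (\<lambda>i. i \<oplus>\<^bsub>R\<^esub> g x) ` (g ` I)"
    unfolding a_r_coset_def' image_image
    using add[OF carr assms(3)] by (auto simp: image_iff)
  then show ?thesis using assms(4) by (auto simp: a_r_coset_def')
qed

context quantum_setup
begin

abbreviation "Fr \<equiv> qmat_free K m n"

lemma monoid_free: "monoid (free_monoid T)"
  by unfold_locales (auto simp: free_monoid_def)

lemma free_monoid_simps [simp]:
  "carrier (free_monoid T) = lists T" "v \<otimes>\<^bsub>free_monoid T\<^esub> w = v @ w" "\<one>\<^bsub>free_monoid T\<^esub> = []"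
  by (simp_all add: free_monoid_def)

sublocale Fr: twisted_product K "free_monoid letters" "\<lambda>_ _ a b. a \<otimes> b"
  rewrites "twisted_monoid_ring K (free_monoid letters) (\<lambda>_ _ a b. a \<otimes> b) = Fr"
  by (intro twisted_product.intro twisted_product_axioms.intro)
    (auto simp: ring_axioms l_distr r_distr m_assoc monoid_free monoid_ring_eq_twisted qmat_free_def free_algebra_def
      simp del: free_monoid_simps)

definition deg :: "(nat \<times> nat) list \<Rightarrow> nat \<Rightarrow>\<^sub>0 int" where "deg w = sum_list (map gen w)"

text \<open>The scalar \<open>\<chi> (weight w)\<close> is the one by which the product of the images of the letters of \<open>w\<close>
  differs from \<open>u\<^bsub>deg w\<^esub>\<close>.\<close>

primrec weight :: "(nat \<times> nat) list \<Rightarrow> int" where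
  "weight [] = 0"
| "weight (x # w) = \<beta> (gen x) (deg w) + weight w"

definition \<Phi> :: "((nat \<times> nat) list \<Rightarrow> 'a) \<Rightarrow> (nat \<Rightarrow>\<^sub>0 int) \<Rightarrow> 'a" where
  "\<Phi> f = (\<lambda>s. \<Oplus>w\<in>{w. f w \<noteq> \<zero> \<and> deg w = s}. \<chi> (weight w) \<otimes> f w)"

lemma deg_simps [simp]: "deg [] = 0" "deg (x # w) = gen x + deg w" "deg (v @ w) = deg v + deg w"
  by (simp_all add: deg_def)

text \<open>Bilinearity of \<open>\<beta>\<close> makes the weights of words additive up to the
  twist; this is what makes \<open>\<Phi>\<close> multiplicative.\<close>

lemma weight_append: "weight (v @ w) = weight v + weight w + \<beta> (deg v) (deg w)"
  by (induction v) (simp_all add: \<beta>_simps)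

lemma deg_in_S: "w \<in> lists letters \<Longrightarrow> deg w \<in> S"
  by (induction w) (auto simp: zero_in_S intro!: add_in_S gen_in_S)

lemma \<Phi>_eq:
  assumes f: "f \<in> carrier Fr" and W: "finite W" "Fr.supp f \<subseteq> W"
  shows "\<Phi> f s = (\<Oplus>w\<in>W. if deg w = s then \<chi> (weight w) \<otimes> f w else \<zero>)"
  unfolding \<Phi>_def
  by (rule add.finprod_mono_neutral_cong_left) (use W Fr.coeff_closed[OF f] in auto)

lemma \<Phi>_monomial:
  assumes "a \<in> carrier K" "w \<in> lists letters"
  shows "\<Phi> (monomial K a w) = monomial K (\<chi> (weight w) \<otimes> a) (deg w)"
proof
  fix s
  have "\<Phi> (monomial K a w) s = (\<Oplus>v\<in>{w}. if deg v = s then \<chi> (weight v) \<otimes> monomial K a w v else \<zero>)"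
    by (rule \<Phi>_eq[OF Fr.monomial_closed]) (use assms in \<open>auto simp: monomial_def\<close>)
  then show "\<Phi> (monomial K a w) s = monomial K (\<chi> (weight w) \<otimes> a) (deg w) s"
    using assms by (auto simp: monomial_def)
qed

lemma \<Phi>_add:
  assumes f: "f \<in> carrier Fr" and g: "g \<in> carrier Fr"
  shows "\<Phi> (f \<oplus>\<^bsub>Fr\<^esub> g) = \<Phi> f \<oplus>\<^bsub>A\<^esub> \<Phi> g"
proof
  fix s
  let ?W = "Fr.supp f \<union> Fr.supp g"
  have W: "finite ?W" using Fr.finite_supp[OF f] Fr.finite_supp[OF g] by blast
  note K = Fr.coeff_closed[OF f] Fr.coeff_closed[OF g]
  have "\<Phi> (f \<oplus>\<^bsub>Fr\<^esub> g) s = (\<Oplus>w\<in>?W. if deg w = s then \<chi> (weight w) \<otimes> (f \<oplus>\<^bsub>Fr\<^esub> g) w else \<zero>)"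
    by (rule \<Phi>_eq[OF Fr.add_closed[OF f g] W]) (auto simp: Fr.add_eq)
  also have "\<dots> = (\<Oplus>w\<in>?W. (if deg w = s then \<chi> (weight w) \<otimes> f w else \<zero>) \<oplus> (if deg w = s then \<chi> (weight w) \<otimes> g w else \<zero>))"
    by (rule add.finprod_cong'[OF refl]) (use K in \<open>auto simp: Fr.add_eq r_distr\<close>)
  also have "\<dots> = (\<Oplus>w\<in>?W. if deg w = s then \<chi> (weight w) \<otimes> f w else \<zero>) \<oplus> (\<Oplus>w\<in>?W. if deg w = s then \<chi> (weight w) \<otimes> g w else \<zero>)"
    by (rule finsum_addf) (use K in auto)
  also have "\<dots> = \<Phi> f s \<oplus> \<Phi> g s"
    using \<Phi>_eq[OF f W] \<Phi>_eq[OF g W] by simp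
  finally show "\<Phi> (f \<oplus>\<^bsub>Fr\<^esub> g) s = (\<Phi> f \<oplus>\<^bsub>A\<^esub> \<Phi> g) s" by (simp add: add_eq)
qed

lemma \<Phi>_zero: "\<Phi> (\<lambda>_. \<zero>) = (\<lambda>_. \<zero>)"
  by (simp add: \<Phi>_def)

lemma \<Phi>_closed: "f \<in> carrier Fr \<Longrightarrow> \<Phi> f \<in> carrier A"
proof (induction f rule: Fr.carrier_induct)
  case (monomial a u)
  then show ?case using deg_in_S[of u] by (simp add: \<Phi>_monomial)
qed (simp_all add: \<Phi>_zero \<Phi>_add zero_in_A)

lemma \<Phi>_mult:
  assumes "f \<in> carrier Fr" "g \<in> carrier Fr"
  shows "\<Phi> (f \<otimes>\<^bsub>Fr\<^esub> g) = \<Phi> f \<otimes>\<^bsub>A\<^esub> \<Phi> g"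
  using assms
proof (induction f rule: Fr.carrier_induct)
  case zero
  then show ?case by (simp add: Fr.mult_zero_left \<Phi>_zero mult_zero_left \<Phi>_closed)
next
  case (add f f')
  then show ?case by (simp add: Fr.conv_l_distr \<Phi>_add Fr.mult_closed \<Phi>_closed A.l_distr)
next
  case a: (monomial a u)
  show ?case using a(3)
  proof (induction g rule: Fr.carrier_induct)
    case zero
    then show ?case using a by (simp add: Fr.mult_zero_right \<Phi>_zero mult_zero_right \<Phi>_closed)
  next
    case (add g g')
    then show ?case using a by (simp add: Fr.conv_r_distr \<Phi>_add Fr.mult_closed \<Phi>_closed A.r_distr)
  next
    case b: (monomial b v)
    have uv: "u \<in> lists letters" "v \<in> lists letters" "u @ v \<in> lists letters" using a b by auto
    have "\<chi> (weight (u @ v)) \<otimes> (a \<otimes> b) = \<chi> (\<beta> (deg u) (deg v)) \<otimes> ((\<chi> (weight u) \<otimes> a) \<otimes> (\<chi> (weight v) \<otimes> b))"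
      using a b by (simp add: weight_append \<chi>_add m_ac)
    then show ?case
      using a b uv deg_in_S[OF uv(1)] deg_in_S[OF uv(2)]
      by (simp add: Fr.mult_monomial_monomial \<Phi>_monomial mult_monomial_monomial)
  qed
qed

lemma \<Phi>_hom: "ring_hom_ring Fr A \<Phi>"
proof (rule ring_hom_ringI)
  show "\<Phi> \<one>\<^bsub>Fr\<^esub> = \<one>\<^bsub>A\<^esub>" by (simp add: Fr.one_eq one_eq \<Phi>_monomial)
qed (auto simp: Fr.ring_A ring_A \<Phi>_closed \<Phi>_mult \<Phi>_add)

lemma \<Phi>_surj: "\<Phi> ` carrier Fr = carrier A"
proof
  show "\<Phi> ` carrier Fr \<subseteq> carrier A" using \<Phi>_closed by blast
  show "carrier A \<subseteq> \<Phi> ` carrier Fr"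
  proof
    fix f assume "f \<in> carrier A"
    then show "f \<in> \<Phi> ` carrier Fr"
    proof (induction f rule: carrier_induct)
      case zero
      then show ?case using \<Phi>_zero Fr.zero_in_A by (metis image_eqI)
    next
      case (add f g)
      then obtain f' g' where "f' \<in> carrier Fr" "f = \<Phi> f'" "g' \<in> carrier Fr" "g = \<Phi> g'" by blast
      then show ?case using Fr.add_closed[of f' g'] \<Phi>_add[of f' g'] by (metis image_eqI)
    next
      case (monomial a s)
      then have "s \<in> S" by simp
      then have "\<exists>w\<in>lists letters. deg w = s"
      proof (induction s rule: S_induct)
        case zero
        show ?case by (rule bexI[of _ "[]"]) auto
      next
        case (add s x)
        then obtain w where w: "w \<in> lists letters" "deg w = s" by blast
        show ?case by (rule bexI[of _ "x # w"]) (use w add in auto)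
      qed
      then obtain w where w: "w \<in> lists letters" "deg w = s" by blast
      have "\<Phi> (monomial K (\<chi> (- weight w) \<otimes> a) w) = monomial K a s"
        using w monomial by (simp add: \<Phi>_monomial \<chi>_mult_mult)
      moreover have "monomial K (\<chi> (- weight w) \<otimes> a) w \<in> carrier Fr" using w monomial by simp
      ultimately show ?case by (metis image_eqI)
    qed
  qed
qed

subsection \<open>The relations\<close>

abbreviation word :: "'a \<Rightarrow> (nat \<times> nat) list \<Rightarrow> (nat \<times> nat) list \<Rightarrow> 'a" where
  "word a w \<equiv> monomial K a w"

definition commutation_relators :: "((nat \<times> nat) list \<Rightarrow> 'a) set" where
  "commutation_relators =
     {word \<one> [(i, j), (l, j)] \<ominus>\<^bsub>Fr\<^esub> word q [(l, j), (i, j)] | i l j.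
        1 \<le> i \<and> i < l \<and> l \<le> m \<and> 1 \<le> j \<and> j \<le> n}
   \<union> {word \<one> [(i, j), (i, t)] \<ominus>\<^bsub>Fr\<^esub> word q [(i, t), (i, j)] | i j t.
        1 \<le> i \<and> i \<le> m \<and> 1 \<le> j \<and> j < t \<and> t \<le> n}
   \<union> {word \<one> [(i, t), (l, j)] \<ominus>\<^bsub>Fr\<^esub> word \<one> [(l, j), (i, t)] | i l j t.
        1 \<le> i \<and> i < l \<and> l \<le> m \<and> 1 \<le> j \<and> j < t \<and> t \<le> n}
   \<union> {(word \<one> [(i, j), (l, t)] \<ominus>\<^bsub>Fr\<^esub> word \<one> [(l, t), (i, j)]) \<ominus>\<^bsub>Fr\<^esub> word (q \<ominus> inv q) [(i, t), (l, j)] | i l j t.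
        1 \<le> i \<and> i < l \<and> l \<le> m \<and> 1 \<le> j \<and> j < t \<and> t \<le> n}"

lemma q_closed [simp]: "q \<in> carrier K" "inv q \<in> carrier K" "q \<ominus> inv q \<in> carrier K"
  using q_unit by auto

lemma word_closed: "a \<in> carrier K \<Longrightarrow> w \<in> lists letters \<Longrightarrow> word a w \<in> carrier Fr"
  by simp

lemma word_mult: "a \<in> carrier K \<Longrightarrow> b \<in> carrier K \<Longrightarrow> v \<in> lists letters \<Longrightarrow> w \<in> lists letters \<Longrightarrow>
    word a v \<otimes>\<^bsub>Fr\<^esub> word b w = word (a \<otimes> b) (v @ w)"
  using Fr.mult_monomial_monomial[of a b v w] by simp

lemma qmat_relators_eq: "qmat_relators K q m n = commutation_relators"
proof -
  have 1: "word \<one> [x] \<otimes>\<^bsub>Fr\<^esub> word \<one> [y] = word \<one> [x, y]" if "x \<in> letters" "y \<in> letters" for x y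
    using that by (subst word_mult) auto
  have 2: "word c [] \<otimes>\<^bsub>Fr\<^esub> word \<one> [x] \<otimes>\<^bsub>Fr\<^esub> word \<one> [y] = word c [x, y]" if "c \<in> carrier K" "x \<in> letters" "y \<in> letters" for c x y
    using that by (subst word_mult, auto, subst word_mult, auto)
  show ?thesis
    unfolding qmat_relators_def commutation_relators_def Let_def
    by (intro arg_cong2[where f = "(\<union>)"] Collect_cong arg_cong[where f = Ex] ext rev_conj_cong refl) (auto simp: 1 2)
qed

lemma relators_closed: "commutation_relators \<subseteq> carrier Fr"
  unfolding commutation_relators_def by (auto intro!: Fr.A.minus_closed word_closed)

lemma \<Phi>_word2:
  assumes "a \<in> carrier K" "x \<in> letters" "y \<in> letters"
  shows "\<Phi> (word a [x, y]) = monomial K (\<chi> (\<beta> (gen x) (gen y)) \<otimes> a) (gen x + gen y)"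
  using assms by (subst \<Phi>_monomial) auto

lemma \<Phi>_minus: "f \<in> carrier Fr \<Longrightarrow> g \<in> carrier Fr \<Longrightarrow> \<Phi> (f \<ominus>\<^bsub>Fr\<^esub> g) = \<Phi> f \<ominus>\<^bsub>A\<^esub> \<Phi> g"
proof -
  assume fg: "f \<in> carrier Fr" "g \<in> carrier Fr"
  interpret h: ring_hom_ring Fr A \<Phi> by (rule \<Phi>_hom)
  show ?thesis using fg by (simp add: a_minus_def)
qed

lemma monomial_minus:
  assumes "a \<in> carrier K" "b \<in> carrier K" "s \<in> S"
  shows "monomial K a s \<ominus>\<^bsub>A\<^esub> monomial K b s = monomial K (a \<ominus> b) s"
proof -
  have "monomial K a s \<ominus>\<^bsub>A\<^esub> monomial K b s = (\<lambda>w. monomial K a s w \<ominus> monomial K b s w)"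
    using assms by (intro conv_minus_eq) auto
  also have "\<dots> = monomial K (a \<ominus> b) s"
    using assms by (auto simp: monomial_def a_minus_def r_neg)
  finally show ?thesis .
qed

lemma gen_cross: "gen (i, j) + gen (l, t) = gen (i, t) + gen (l, j)"
  by (simp add: gen_def ac_simps)

lemma \<chi>_scalars: "\<chi> 1 = q" "\<chi> 2 \<ominus> \<one> = q \<otimes> (q \<ominus> inv q)" "\<chi> 2 = q \<otimes> q"
proof -
  show 1: "\<chi> 1 = q" by (rule \<chi>_1)
  show 2: "\<chi> 2 = q \<otimes> q" using \<chi>_add[of 1 1] 1 by simp
  show "\<chi> 2 \<ominus> \<one> = q \<otimes> (q \<ominus> inv q)"
    using q_unit by (simp add: 2 a_minus_def r_distr r_minus)
qed

lemma \<Phi>_relators: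
  assumes "f \<in> commutation_relators" shows "\<Phi> f = \<zero>\<^bsub>A\<^esub>"
proof -
  have same: "monomial K a s \<ominus>\<^bsub>A\<^esub> monomial K a s = \<zero>\<^bsub>A\<^esub>" if "a \<in> carrier K" "s \<in> S" for a s
    using that by (simp add: a_minus_def A.r_neg)
  consider
      (row) i l j where "f = word \<one> [(i, j), (l, j)] \<ominus>\<^bsub>Fr\<^esub> word q [(l, j), (i, j)]" "1 \<le> i" "i < l" "l \<le> m" "1 \<le> j" "j \<le> n"
    | (col) i j t where "f = word \<one> [(i, j), (i, t)] \<ominus>\<^bsub>Fr\<^esub> word q [(i, t), (i, j)]" "1 \<le> i" "i \<le> m" "1 \<le> j" "j < t" "t \<le> n"
    | (anti) i l j t where "f = word \<one> [(i, t), (l, j)] \<ominus>\<^bsub>Fr\<^esub> word \<one> [(l, j), (i, t)]" "1 \<le> i" "i < l" "l \<le> m" "1 \<le> j" "j < t" "t \<le> n"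
    | (diag) i l j t where "f = (word \<one> [(i, j), (l, t)] \<ominus>\<^bsub>Fr\<^esub> word \<one> [(l, t), (i, j)]) \<ominus>\<^bsub>Fr\<^esub> word (q \<ominus> inv q) [(i, t), (l, j)]" "1 \<le> i" "i < l" "l \<le> m" "1 \<le> j" "j < t" "t \<le> n"
    using assms unfolding commutation_relators_def by blast
  then show ?thesis
  proof cases
    case row
    then have l: "(i, j) \<in> letters" "(l, j) \<in> letters" by auto
    show ?thesis using row l gen_in_S add_in_S
      by (simp add: \<Phi>_minus \<Phi>_word2 \<beta>_gen \<chi>_scalars add.commute[of "gen (l, j)"] same)
  next
    case col
    then have l: "(i, j) \<in> letters" "(i, t) \<in> letters" by auto
    show ?thesis using col l gen_in_S add_in_S
      by (simp add: \<Phi>_minus \<Phi>_word2 \<beta>_gen \<chi>_scalars add.commute[of "gen (i, t)"] same)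
  next
    case anti
    then have l: "(i, t) \<in> letters" "(l, j) \<in> letters" by auto
    show ?thesis using anti l gen_in_S add_in_S
      by (simp add: \<Phi>_minus \<Phi>_word2 \<beta>_gen \<chi>_scalars add.commute[of "gen (l, j)"] same)
  next
    case diag
    then have l: "(i, j) \<in> letters" "(l, t) \<in> letters" "(i, t) \<in> letters" "(l, j) \<in> letters" by auto
    let ?s = "gen (i, t) + gen (l, j)"
    \<comment> \<open>The three words have the same degree and are sent to its monomial with factors
      \<open>q \<otimes> q\<close>, \<open>\<one>\<close> and \<open>q\<close>. The relation thus
      becomes the scalar identity for \<open>\<chi> 2 \<ominus> \<one>\<close>.\<close>
    have "\<Phi> f = (monomial K (\<chi> 2) ?s \<ominus>\<^bsub>A\<^esub> monomial K \<one> ?s) \<ominus>\<^bsub>A\<^esub> monomial K (q \<otimes> (q \<ominus> inv q)) ?s"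
      using diag l by (simp add: \<Phi>_minus \<Phi>_word2 \<beta>_gen \<chi>_scalars(1) add.commute[of "gen (l, t)"] gen_cross[of i j])
    also have "\<dots> = \<zero>\<^bsub>A\<^esub>"
    proof -
      have s: "?s \<in> S" by (rule add_in_S[OF gen_in_S[OF l(3)] gen_in_S[OF l(4)]])
      have "monomial K (\<chi> 2) ?s \<ominus>\<^bsub>A\<^esub> monomial K \<one> ?s = monomial K (\<chi> 2 \<ominus> \<one>) ?s"
        using s by (intro monomial_minus) auto
      then show ?thesis unfolding \<chi>_scalars(2)[symmetric] using s by (simp only: same \<chi>_closed one_closed minus_closed)
    qed
    finally show ?thesis .
  qed
qed

abbreviation "I_rel \<equiv> qmat_rel_ideal K q m n"

lemma I_rel_ideal: "ideal I_rel Fr"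
  unfolding qmat_rel_ideal_def qmat_relators_eq by (rule Fr.A.genideal_ideal[OF relators_closed])

lemma \<Phi>_I_rel: "f \<in> I_rel \<Longrightarrow> \<Phi> f = \<zero>\<^bsub>A\<^esub>"
proof -
  interpret h: ring_hom_ring Fr A \<Phi> by (rule \<Phi>_hom)
  have "I_rel \<subseteq> a_kernel Fr A \<Phi>"
    unfolding qmat_rel_ideal_def qmat_relators_eq
  proof (rule Fr.A.genideal_minimal[OF h.kernel_is_ideal], rule subsetI)
    fix f assume f: "f \<in> commutation_relators"
    show "f \<in> a_kernel Fr A \<Phi>"
      unfolding a_kernel_def' using \<Phi>_relators[OF f] subsetD[OF relators_closed f] by blast
  qed
  then show "f \<in> I_rel \<Longrightarrow> \<Phi> f = \<zero>\<^bsub>A\<^esub>" unfolding a_kernel_def' by blast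
qed

abbreviation "Q \<equiv> qmat K q m n"

definition \<Phi>2 :: "((nat \<times> nat) list \<Rightarrow> 'a) set \<Rightarrow> (nat \<Rightarrow>\<^sub>0 int) \<Rightarrow> 'a" where
  "\<Phi>2 C = the_elem (\<Phi> ` C)"

lemma \<Phi>2_hom: "ring_hom_ring Q A \<Phi>2"
  and \<Phi>2_coset: "f \<in> carrier Fr \<Longrightarrow> \<Phi>2 (I_rel +>\<^bsub>Fr\<^esub> f) = \<Phi> f"
  using quotient_hom[OF \<Phi>_hom I_rel_ideal \<Phi>_I_rel] unfolding \<Phi>2_def qmat_def by auto

abbreviation p1 :: "((nat \<times> nat) list \<Rightarrow> 'a) \<Rightarrow> ((nat \<times> nat) list \<Rightarrow> 'a) set" where
  "p1 f \<equiv> I_rel +>\<^bsub>Fr\<^esub> f"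

lemma p1_hom: "ring_hom_ring Fr Q p1"
  unfolding qmat_def by (rule ideal.rcos_ring_hom_ring[OF I_rel_ideal])

lemma p1_surj: "C \<in> carrier Q \<Longrightarrow> \<exists>f\<in>carrier Fr. C = p1 f"
  unfolding qmat_def carrier_FactRing by (simp only: image_iff)

sublocale Q: ring Q
  unfolding qmat_def by (rule ideal.quotient_is_ring[OF I_rel_ideal])

lemma quantum_minors_eq: "quantum_minors K q m n =
   {p1 (word \<one> [(i, j), (l, t)] \<ominus>\<^bsub>Fr\<^esub> word q [(i, t), (l, j)]) | i l j t.
      1 \<le> i \<and> i < l \<and> l \<le> m \<and> 1 \<le> j \<and> j < t \<and> t \<le> n}"
proof -
  interpret p: ring_hom_ring Fr Q p1 by (rule p1_hom)
  have "qmat_gen K q m n i j \<otimes>\<^bsub>Q\<^esub> qmat_gen K q m n l t \<ominus>\<^bsub>Q\<^esub> qmat_scalar K q m n q \<otimes>\<^bsub>Q\<^esub> qmat_gen K q m n i t \<otimes>\<^bsub>Q\<^esub> qmat_gen K q m n l j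
    = p1 (word \<one> [(i, j), (l, t)] \<ominus>\<^bsub>Fr\<^esub> word q [(i, t), (l, j)])"
    if "1 \<le> i \<and> i < l \<and> l \<le> m \<and> 1 \<le> j \<and> j < t \<and> t \<le> n" for i l j t
  proof -
    have l: "(i, j) \<in> letters" "(l, t) \<in> letters" "(i, t) \<in> letters" "(l, j) \<in> letters" using that by auto
    have 1: "word \<one> [(i, j), (l, t)] = word \<one> [(i, j)] \<otimes>\<^bsub>Fr\<^esub> word \<one> [(l, t)]"
      using l by (subst word_mult) auto
    have 2: "word q [(i, t), (l, j)] = word q [] \<otimes>\<^bsub>Fr\<^esub> word \<one> [(i, t)] \<otimes>\<^bsub>Fr\<^esub> word \<one> [(l, j)]"
      using l by (subst word_mult, simp_all, subst word_mult, simp_all)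
    have c: "word \<one> [(i, j)] \<in> carrier Fr" "word \<one> [(l, t)] \<in> carrier Fr" "word q [] \<in> carrier Fr"
      "word \<one> [(i, t)] \<in> carrier Fr" "word \<one> [(l, j)] \<in> carrier Fr"
      using l by (auto intro!: word_closed)
    show ?thesis unfolding 1 2 qmat_gen_def qmat_scalar_def using c by (simp add: a_minus_def)
  qed
  then show ?thesis unfolding quantum_minors_def Let_def
    by (intro Collect_cong arg_cong[where f = Ex] ext rev_conj_cong refl) auto
qed

abbreviation "J_min \<equiv> Idl\<^bsub>Q\<^esub> (quantum_minors K q m n)"

lemma minors_closed: "quantum_minors K q m n \<subseteq> carrier Q"
proof -
  interpret p: ring_hom_ring Fr Q p1 by (rule p1_hom)
  show ?thesis unfolding quantum_minors_eq by (auto intro!: p.hom_closed Fr.A.minus_closed word_closed)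
qed

lemma J_min_ideal: "ideal J_min Q"
  by (rule Q.genideal_ideal[OF minors_closed])

lemma \<Phi>2_J_min: "C \<in> J_min \<Longrightarrow> \<Phi>2 C = \<zero>\<^bsub>A\<^esub>"
proof -
  interpret h: ring_hom_ring Q A \<Phi>2 by (rule \<Phi>2_hom)
  have minor: "\<Phi>2 C = \<zero>\<^bsub>A\<^esub>" if C: "C \<in> quantum_minors K q m n" for C
  proof -
    obtain i l j t where C: "C = p1 (word \<one> [(i, j), (l, t)] \<ominus>\<^bsub>Fr\<^esub> word q [(i, t), (l, j)])"
      and *: "1 \<le> i" "i < l" "l \<le> m" "1 \<le> j" "j < t" "t \<le> n"
      using C unfolding quantum_minors_eq by blast
    have l: "(i, j) \<in> letters" "(l, t) \<in> letters" "(i, t) \<in> letters" "(l, j) \<in> letters" using * by auto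
    have "\<Phi>2 C = \<Phi> (word \<one> [(i, j), (l, t)] \<ominus>\<^bsub>Fr\<^esub> word q [(i, t), (l, j)])"
      unfolding C by (rule \<Phi>2_coset) (use l in \<open>auto intro!: Fr.A.minus_closed word_closed\<close>)
    also have "\<dots> = monomial K (q \<otimes> q) (gen (i, t) + gen (l, j)) \<ominus>\<^bsub>A\<^esub> monomial K (q \<otimes> q) (gen (i, t) + gen (l, j))"
      using * l by (simp add: \<Phi>_minus \<Phi>_word2 \<beta>_gen \<chi>_scalars(1,3) gen_cross[of i j])
    also have "\<dots> = \<zero>\<^bsub>A\<^esub>"
      using add_in_S[OF gen_in_S[OF l(3)] gen_in_S[OF l(4)]] by (simp add: a_minus_def A.r_neg)
    finally show ?thesis .
  qed
  have "J_min \<subseteq> a_kernel Q A \<Phi>2"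
  proof (rule Q.genideal_minimal[OF h.kernel_is_ideal], rule subsetI)
    fix C assume C: "C \<in> quantum_minors K q m n"
    show "C \<in> a_kernel Q A \<Phi>2"
      unfolding a_kernel_def' using minor[OF C] subsetD[OF minors_closed C] by blast
  qed
  then show "C \<in> J_min \<Longrightarrow> \<Phi>2 C = \<zero>\<^bsub>A\<^esub>" unfolding a_kernel_def' by blast
qed

abbreviation "R \<equiv> qmat_mod_minors K q m n"

definition \<Phi>3 :: "((nat \<times> nat) list \<Rightarrow> 'a) set set \<Rightarrow> (nat \<Rightarrow>\<^sub>0 int) \<Rightarrow> 'a" where
  "\<Phi>3 C = the_elem (\<Phi>2 ` C)"

abbreviation p2 :: "((nat \<times> nat) list \<Rightarrow> 'a) set \<Rightarrow> ((nat \<times> nat) list \<Rightarrow> 'a) set set" where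
  "p2 C \<equiv> J_min +>\<^bsub>Q\<^esub> C"

lemma \<Phi>3_hom: "ring_hom_ring R A \<Phi>3"
  and \<Phi>3_coset: "C \<in> carrier Q \<Longrightarrow> \<Phi>3 (p2 C) = \<Phi>2 C"
  using quotient_hom[OF \<Phi>2_hom J_min_ideal \<Phi>2_J_min] unfolding \<Phi>3_def qmat_mod_minors_def by auto

lemma p2_hom: "ring_hom_ring Q R p2"
  unfolding qmat_mod_minors_def by (rule ideal.rcos_ring_hom_ring[OF J_min_ideal])

lemma p2_surj: "C \<in> carrier R \<Longrightarrow> \<exists>f\<in>carrier Q. C = p2 f"
  unfolding qmat_mod_minors_def carrier_FactRing by (simp only: image_iff)

sublocale R: ring R
  unfolding qmat_mod_minors_def by (rule ideal.quotient_is_ring[OF J_min_ideal])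

definition cls :: "((nat \<times> nat) list \<Rightarrow> 'a) \<Rightarrow> ((nat \<times> nat) list \<Rightarrow> 'a) set set" where
  "cls f = p2 (p1 f)"

lemma cls_hom: "ring_hom_ring Fr R cls"
proof -
  interpret p1: ring_hom_ring Fr Q p1 by (rule p1_hom)
  interpret p2: ring_hom_ring Q R p2 by (rule p2_hom)
  show ?thesis by (rule ring_hom_ringI) (auto simp: Fr.ring_A R.ring_axioms cls_def)
qed

lemma cls_surj: "C \<in> carrier R \<Longrightarrow> \<exists>f\<in>carrier Fr. C = cls f"
  using p1_surj p2_surj unfolding cls_def by metis

lemma \<Phi>3_cls: "f \<in> carrier Fr \<Longrightarrow> \<Phi>3 (cls f) = \<Phi> f"
proof -
  interpret p1: ring_hom_ring Fr Q p1 by (rule p1_hom)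
  show "f \<in> carrier Fr \<Longrightarrow> \<Phi>3 (cls f) = \<Phi> f"
    unfolding cls_def by (simp add: \<Phi>3_coset \<Phi>2_coset)
qed

subsection \<open>Words of equal degree\<close>

text \<open>Only the existence of an exponent is recorded. Its value is forced by the homomorphism
  \<open>\<Phi>\<close> and never has to be computed.\<close>

definition proportional :: "(nat \<times> nat) list \<Rightarrow> (nat \<times> nat) list \<Rightarrow> bool" where
  "proportional v w \<longleftrightarrow> v \<in> lists letters \<and> w \<in> lists letters \<and> (\<exists>k. cls (word \<one> v) = cls (word (\<chi> k) w))"

lemma cls_word_mult:
  assumes "a \<in> carrier K" "b \<in> carrier K" "v \<in> lists letters" "w \<in> lists letters"
  shows "cls (word (a \<otimes> b) (v @ w)) = cls (word a v) \<otimes>\<^bsub>R\<^esub> cls (word b w)"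
proof -
  interpret c: ring_hom_ring Fr R cls by (rule cls_hom)
  show ?thesis using assms word_mult[OF assms] by (simp flip: c.hom_mult)
qed

lemma cls_scale:
  assumes "cls (word \<one> v) = cls (word (\<chi> k) w)" "v \<in> lists letters" "w \<in> lists letters" "a \<in> carrier K"
  shows "cls (word a v) = cls (word (\<chi> k \<otimes> a) w)"
  using cls_word_mult[OF assms(4) one_closed _ assms(2), of "[]"] cls_word_mult[OF assms(4) \<chi>_closed _ assms(3), of "[]" k] assms
  by (simp add: m_comm)

lemma proportional_refl: "w \<in> lists letters \<Longrightarrow> proportional w w"
  unfolding proportional_def using \<chi>_0 by metis

lemma proportional_sym:
  assumes "proportional v w" shows "proportional w v"
proof -
  obtain k where k: "cls (word \<one> v) = cls (word (\<chi> k) w)" and l: "v \<in> lists letters" "w \<in> lists letters"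
    using assms by (auto simp: proportional_def)
  have "cls (word (\<chi> (- k)) v) = cls (word \<one> w)"
    using cls_scale[OF k l \<chi>_closed[of "- k"]] by (simp add: \<chi>_mult)
  then show ?thesis using l unfolding proportional_def by metis
qed

lemma proportional_trans [trans]:
  assumes "proportional u v" "proportional v w" shows "proportional u w"
proof -
  obtain k where k: "cls (word \<one> u) = cls (word (\<chi> k) v)" and u: "u \<in> lists letters"
    using assms(1) by (auto simp: proportional_def)
  obtain l where l: "cls (word \<one> v) = cls (word (\<chi> l) w)" and v: "v \<in> lists letters" and w: "w \<in> lists letters"
    using assms(2) by (auto simp: proportional_def)
  have "cls (word \<one> u) = cls (word (\<chi> (l + k)) w)"
    using k cls_scale[OF l v w \<chi>_closed[of k]] by (simp add: \<chi>_mult)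
  then show ?thesis using u w unfolding proportional_def by metis
qed

lemma proportional_append:
  assumes "proportional v w" "u \<in> lists letters" "u' \<in> lists letters"
  shows "proportional (u @ v @ u') (u @ w @ u')"
proof -
  obtain k where k: "cls (word \<one> v) = cls (word (\<chi> k) w)" and l: "v \<in> lists letters" "w \<in> lists letters"
    using assms(1) by (auto simp: proportional_def)
  have vu: "v @ u' \<in> lists letters" "w @ u' \<in> lists letters" using l assms by auto
  have "cls (word \<one> (u @ v @ u')) = cls (word \<one> u) \<otimes>\<^bsub>R\<^esub> (cls (word \<one> v) \<otimes>\<^bsub>R\<^esub> cls (word \<one> u'))"
    using cls_word_mult[OF one_closed one_closed assms(2) vu(1)] cls_word_mult[OF one_closed one_closed l(1) assms(3)] by simp
  also have "\<dots> = cls (word (\<chi> k) (u @ w @ u'))"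
    using cls_word_mult[OF one_closed \<chi>_closed assms(2) vu(2), of k] cls_word_mult[OF \<chi>_closed one_closed l(2) assms(3), of k] by (simp add: k)
  finally have "cls (word \<one> (u @ v @ u')) = cls (word (\<chi> k) (u @ w @ u'))" .
  moreover have "u @ v @ u' \<in> lists letters" "u @ w @ u' \<in> lists letters" using l assms by auto
  ultimately show ?thesis unfolding proportional_def by blast
qed

lemma proportional_front:
  "proportional [x, y] [x', y'] \<Longrightarrow> w \<in> lists letters \<Longrightarrow> proportional (x # y # w) (x' # y' # w)"
  using proportional_append[of "[x, y]" "[x', y']" "[]" w] by simp

lemma proportional_Cons: "proportional v w \<Longrightarrow> x \<in> letters \<Longrightarrow> proportional (x # v) (x # w)"
  using proportional_append[of v w "[x]" "[]"] by simp

lemma cls_eq_if_relator: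
  assumes "f \<ominus>\<^bsub>Fr\<^esub> g \<in> commutation_relators" "f \<in> carrier Fr" "g \<in> carrier Fr"
  shows "cls f = cls g"
proof -
  interpret p1: ring_hom_ring Fr Q p1 by (rule p1_hom)
  interpret I: ideal I_rel Fr by (rule I_rel_ideal)
  have "f \<ominus>\<^bsub>Fr\<^esub> g \<in> I_rel"
    unfolding qmat_rel_ideal_def qmat_relators_eq
    using Fr.A.genideal_self[OF relators_closed] assms(1) by blast
  then have "p1 (f \<ominus>\<^bsub>Fr\<^esub> g) = I_rel" by (rule I.a_rcos_const)
  moreover have "\<zero>\<^bsub>Q\<^esub> = I_rel" unfolding qmat_def by (rule zero_FactRing)
  moreover have "p1 (f \<ominus>\<^bsub>Fr\<^esub> g) = p1 f \<ominus>\<^bsub>Q\<^esub> p1 g" using assms by (simp add: a_minus_def)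
  ultimately have "p1 f \<ominus>\<^bsub>Q\<^esub> p1 g = \<zero>\<^bsub>Q\<^esub>" by simp
  then have "p1 f = p1 g" using assms(2,3) by simp
  then show ?thesis by (simp add: cls_def)
qed

lemma cls_eq_if_minor:
  assumes "p1 (f \<ominus>\<^bsub>Fr\<^esub> g) \<in> quantum_minors K q m n" "f \<in> carrier Fr" "g \<in> carrier Fr"
  shows "cls f = cls g"
proof -
  interpret p1: ring_hom_ring Fr Q p1 by (rule p1_hom)
  interpret c: ring_hom_ring Fr R cls by (rule cls_hom)
  interpret J: ideal J_min Q by (rule J_min_ideal)
  have "p1 (f \<ominus>\<^bsub>Fr\<^esub> g) \<in> J_min"
    using Q.genideal_self[OF minors_closed] assms(1) by blast
  then have "cls (f \<ominus>\<^bsub>Fr\<^esub> g) = J_min" unfolding cls_def by (rule J.a_rcos_const)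
  moreover have "\<zero>\<^bsub>R\<^esub> = J_min" unfolding qmat_mod_minors_def by (rule zero_FactRing)
  moreover have "cls (f \<ominus>\<^bsub>Fr\<^esub> g) = cls f \<ominus>\<^bsub>R\<^esub> cls g" using assms(2,3) by (simp add: a_minus_def)
  ultimately have "cls f \<ominus>\<^bsub>R\<^esub> cls g = \<zero>\<^bsub>R\<^esub>" by simp
  then show ?thesis using assms(2,3) by simp
qed

lemma proportional_wordI:
  assumes "cls (word \<one> [x, y]) = cls (word (\<chi> k) [x', y'])" "{x, y, x', y'} \<subseteq> letters"
  shows "proportional [x, y] [x', y']"
  using assms unfolding proportional_def by auto

text \<open>The minor expresses the diagonal product as \<open>q\<close> times the antidiagonal one.
  Inserted into the last commutation relation, it leaves the reversed diagonal product equal to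
  \<open>inv q\<close> times the antidiagonal one.\<close>

lemma proportional_square:
  assumes "1 \<le> i" "i < l" "l \<le> m" "1 \<le> j" "j < t" "t \<le> n"
  shows "proportional [(i, j), (l, t)] [(i, t), (l, j)]"
    and "proportional [(i, t), (l, j)] [(l, j), (i, t)]"
    and "proportional [(l, t), (i, j)] [(i, t), (l, j)]"
proof -
  let ?a = "[(i, j), (l, t)]" and ?b = "[(l, t), (i, j)]" and ?c = "[(i, t), (l, j)]" and ?d = "[(l, j), (i, t)]"
  have l: "?a \<in> lists letters" "?b \<in> lists letters" "?c \<in> lists letters" "?d \<in> lists letters" using assms by auto
  interpret c: ring_hom_ring Fr R cls by (rule cls_hom)
  have W: "word a w \<in> carrier Fr" if "a \<in> carrier K" "w \<in> {?a, ?b, ?c, ?d}" for a w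
    using that l by (intro word_closed) auto
  have ac: "cls (word \<one> ?a) = cls (word q ?c)"
    by (rule cls_eq_if_minor) (use assms W in \<open>auto simp: quantum_minors_eq\<close>)
  have cd: "cls (word \<one> ?c) = cls (word \<one> ?d)"
    by (rule cls_eq_if_relator) (use assms W in \<open>auto simp: commutation_relators_def\<close>)
  have "cls (word \<one> ?a \<ominus>\<^bsub>Fr\<^esub> word \<one> ?b) = cls (word (q \<ominus> inv q) ?c)"
  proof (rule cls_eq_if_relator)
    show "word \<one> ?a \<ominus>\<^bsub>Fr\<^esub> word \<one> ?b \<ominus>\<^bsub>Fr\<^esub> word (q \<ominus> inv q) ?c \<in> commutation_relators"
      using assms unfolding commutation_relators_def by blast
  qed (use W in auto)
  also have "word (q \<ominus> inv q) ?c = word q ?c \<ominus>\<^bsub>Fr\<^esub> word (inv q) ?c"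
    using W Fr.conv_minus_eq[of "word q ?c" "word (inv q) ?c"] q_unit
    by (simp add: monomial_def) (auto simp: a_minus_def r_neg)
  finally have "cls (word \<one> ?a) \<ominus>\<^bsub>R\<^esub> cls (word \<one> ?b) = cls (word \<one> ?a) \<ominus>\<^bsub>R\<^esub> cls (word (inv q) ?c)"
    using W by (simp add: a_minus_def ac)
  moreover have cl: "cls (word \<one> ?a) \<in> carrier R" "cls (word \<one> ?b) \<in> carrier R" "cls (word (inv q) ?c) \<in> carrier R"
    using W by simp_all
  ultimately have "\<ominus>\<^bsub>R\<^esub> cls (word \<one> ?b) = \<ominus>\<^bsub>R\<^esub> cls (word (inv q) ?c)"
    unfolding a_minus_def using R.add.l_cancel[OF _ R.a_inv_closed[OF cl(2)] R.a_inv_closed[OF cl(3)] cl(1)] by blast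
  then have bc: "cls (word \<one> ?b) = cls (word (inv q) ?c)"
    using R.minus_minus[OF cl(2)] R.minus_minus[OF cl(3)] by metis
  show "proportional ?a ?c" by (rule proportional_wordI[of _ _ 1]) (use ac l in \<open>auto simp: \<chi>_scalars(1)\<close>)
  show "proportional ?c ?d" by (rule proportional_wordI[of _ _ 0]) (use cd l in auto)
  show "proportional ?b ?c" by (rule proportional_wordI[of _ _ "- 1"]) (use bc l in \<open>auto simp: \<chi>_minus_1\<close>)
qed

lemma proportional_swap:
  assumes "x \<in> letters" "y \<in> letters"
  shows "proportional [x, y] [y, x]"
proof -
  obtain i j l t where xy: "x = (i, j)" "y = (l, t)" by fastforce
  have b: "1 \<le> i" "i \<le> m" "1 \<le> j" "j \<le> n" "1 \<le> l" "l \<le> m" "1 \<le> t" "t \<le> n" using assms xy by auto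
  have row: "proportional [(i, j), (l, j)] [(l, j), (i, j)]"
    if "1 \<le> i" "i < l" "l \<le> m" "1 \<le> j" "j \<le> n" for i j l
  proof (rule proportional_wordI[of _ _ 1])
    show "cls (word \<one> [(i, j), (l, j)]) = cls (word (\<chi> 1) [(l, j), (i, j)])"
      unfolding \<chi>_scalars(1)
      by (rule cls_eq_if_relator) (use that in \<open>auto simp: commutation_relators_def intro!: word_closed\<close>)
  qed (use that in auto)
  have col: "proportional [(i, j), (i, t)] [(i, t), (i, j)]"
    if "1 \<le> i" "i \<le> m" "1 \<le> j" "j < t" "t \<le> n" for i j t
  proof (rule proportional_wordI[of _ _ 1])
    show "cls (word \<one> [(i, j), (i, t)]) = cls (word (\<chi> 1) [(i, t), (i, j)])"
      unfolding \<chi>_scalars(1)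
      by (rule cls_eq_if_relator) (use that in \<open>auto simp: commutation_relators_def intro!: word_closed\<close>)
  qed (use that in auto)
  have diag: "proportional [(i, j), (l, t)] [(l, t), (i, j)]"
    if "1 \<le> i" "i < l" "l \<le> m" "1 \<le> j" "j < t" "t \<le> n" for i j l t
    using proportional_trans[OF proportional_square(1)[OF that] proportional_sym[OF proportional_square(3)[OF that]]] .
  consider "i = l" "j = t" | "i < l" "j = t" | "l < i" "j = t" | "i = l" "j < t" | "i = l" "t < j"
    | "i < l" "j < t" | "i < l" "t < j" | "l < i" "j < t" | "l < i" "t < j"
    using linorder_less_linear[of i l] linorder_less_linear[of j t] by blast
  then show ?thesis
    unfolding xy
  proof cases
    case 1
    then show "proportional [(i, j), (l, t)] [(l, t), (i, j)]" using proportional_refl[of "[x, x]"] assms(1) xy by simp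
  next
    case 2
    then show "proportional [(i, j), (l, t)] [(l, t), (i, j)]" using row b by simp
  next
    case 3
    then show "proportional [(i, j), (l, t)] [(l, t), (i, j)]" using row[of l i j, THEN proportional_sym] b by simp
  next
    case 4
    then show "proportional [(i, j), (l, t)] [(l, t), (i, j)]" using col b by simp
  next
    case 5
    then show "proportional [(i, j), (l, t)] [(l, t), (i, j)]" using col[of l t j, THEN proportional_sym] b by simp
  next
    case 6
    then show "proportional [(i, j), (l, t)] [(l, t), (i, j)]" using diag b by simp
  next
    case 7
    then show "proportional [(i, j), (l, t)] [(l, t), (i, j)]" using proportional_square(2)[of i l t j] b by simp
  next
    case 8
    then show "proportional [(i, j), (l, t)] [(l, t), (i, j)]" using proportional_square(2)[of l i j t, THEN proportional_sym] b by simp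
  next
    case 9
    then show "proportional [(i, j), (l, t)] [(l, t), (i, j)]" using diag[of l i t j, THEN proportional_sym] b by simp
  qed
qed

text \<open>Exchanging the columns of two letters is the minor relation if the rows are in
  increasing order; otherwise the letters are swapped before and after.\<close>

lemma proportional_exchange:
  assumes "(i, j) \<in> letters" "(l, t) \<in> letters"
  shows "proportional [(i, j), (l, t)] [(i, t), (l, j)]"
proof -
  have b: "1 \<le> i" "i \<le> m" "1 \<le> j" "j \<le> n" "1 \<le> l" "l \<le> m" "1 \<le> t" "t \<le> n" using assms by auto
  have less: "proportional [(i, j), (l, t)] [(i, t), (l, j)]"
    if "i < l" "1 \<le> i" "l \<le> m" "1 \<le> j" "j \<le> n" "1 \<le> t" "t \<le> n" for i j l t
  proof -
    consider "j = t" | "j < t" | "t < j" by linarith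
    then show ?thesis
    proof cases
      case 1
      then show ?thesis using that by (simp add: proportional_refl)
    next
      case 2
      then show ?thesis using proportional_square(1)[of i l j t] that by simp
    next
      case 3
      then show ?thesis using proportional_square(1)[of i l t j, THEN proportional_sym] that by simp
    qed
  qed
  consider "i = l" | "i < l" | "l < i" by linarith
  then show ?thesis
  proof cases
    case 1
    then show ?thesis using proportional_swap[OF assms] by simp
  next
    case 2
    then show ?thesis using less b by simp
  next
    case 3
    have "proportional [(i, j), (l, t)] [(l, t), (i, j)]" by (rule proportional_swap[OF assms])
    also have "proportional [(l, t), (i, j)] [(l, j), (i, t)]" using less[OF 3] b by simp
    also have "proportional [(l, j), (i, t)] [(i, t), (l, j)]" using b by (intro proportional_swap) auto
    finally show ?thesis .
  qed
qed

lemma proportional_to_front: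
  assumes "w \<in> lists letters" "x \<in> set w"
  shows "proportional w (x # remove1 x w)"
  using assms
proof (induction w rule: list.induct)
  case (Cons y w)
  show ?case
  proof (cases "x = y")
    case True
    then show ?thesis using Cons.prems by (simp add: proportional_refl)
  next
    case False
    then have x: "x \<in> set w" "w \<in> lists letters" "y \<in> letters" using Cons.prems by auto
    then have xl: "x \<in> letters" by auto
    have w': "remove1 x w \<in> lists letters" using x(2) notin_set_remove1 by (auto dest: in_set_remove1[THEN iffD1, rotated] set_remove1_subset[THEN subsetD])
    have "proportional (y # w) (y # x # remove1 x w)"
      using Cons.IH[OF x(2,1)] x(3) by (rule proportional_Cons)
    also have "proportional (y # x # remove1 x w) (x # y # remove1 x w)"
      using proportional_front[OF proportional_swap[OF x(3) xl] w'] .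
    finally show ?thesis using False by simp
  qed
qed simp

lemma deg_remove1: "x \<in> set w \<Longrightarrow> deg w = gen x + deg (remove1 x w)"
  by (induction w) (auto simp: ac_simps)

lemma deg_row:
  assumes "w \<in> lists letters" "i \<in> {1..m}" "Poly_Mapping.lookup (deg w) i \<noteq> 0"
  shows "\<exists>t. (i, t) \<in> set w"
  using assms
proof (induction w rule: list.induct)
  case (Cons x w)
  show ?case
  proof (cases "fst x = i")
    case True
    then have "x = (i, snd x)" by auto
    then show ?thesis by (metis list.set_intros(1))
  next
    case False
    then have "Poly_Mapping.lookup (deg w) i \<noteq> 0"
      using Cons.prems by (fastforce simp: lookup_add gen_lookup split: if_splits)
    then show ?thesis using Cons by auto
  qed
qed simp

lemma deg_col:
  assumes "w \<in> lists letters" "j \<in> {1..n}" "Poly_Mapping.lookup (deg w) (m + j) \<noteq> 0"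
  shows "\<exists>l. (l, j) \<in> set w"
  using assms
proof (induction w rule: list.induct)
  case (Cons x w)
  show ?case
  proof (cases "snd x = j")
    case True
    then have "x = (fst x, j)" by auto
    then show ?thesis by (metis list.set_intros(1))
  next
    case False
    then have "Poly_Mapping.lookup (deg w) (m + j) \<noteq> 0"
      using Cons.prems by (auto simp: lookup_add gen_lookup split: if_splits)
    then show ?thesis using Cons by auto
  qed
qed simp

lemma lookup_gen_deg_pos:
  assumes "x \<in> letters" "w \<in> lists letters"
  shows "Poly_Mapping.lookup (gen x + deg w) (fst x) \<noteq> 0" "Poly_Mapping.lookup (gen x + deg w) (m + snd x) \<noteq> 0"
  using S_nonneg[OF deg_in_S[OF assms(2)], of "fst x"] S_nonneg[OF deg_in_S[OF assms(2)], of "m + snd x"]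
  by (auto simp: lookup_add gen_lookup)

text \<open>Let \<open>(i, j)\<close> be the first letter of \<open>v\<close>. Equality of degrees
  provides a letter of \<open>w\<close> in row \<open>i\<close> and one in column \<open>j\<close>.
  Both are brought to the front, and exchanging their columns creates \<open>(i, j)\<close> there.
  What remains of \<open>w\<close> has the degree of the tail of \<open>v\<close>, so induction
  applies.\<close>

lemma proportional_if_deg_eq:
  assumes "v \<in> lists letters" "w \<in> lists letters" "deg v = deg w"
  shows "proportional v w"
  using assms
proof (induction v arbitrary: w rule: list.induct)
  case Nil
  have "w = []"
  proof (cases w)
    case (Cons x u)
    then show ?thesis using lookup_gen_deg_pos(1)[of x u] Nil by auto
  qed simp
  then show ?case by (simp add: proportional_refl)
next
  case (Cons x v)
  obtain i j where x: "x = (i, j)" by fastforce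
  have ij: "x \<in> letters" "i \<in> {1..m}" "j \<in> {1..n}" and v: "v \<in> lists letters" using Cons.prems(1) x by auto
  have rm: "remove1 y u \<in> lists letters" if "u \<in> lists letters" for y u
    using that set_remove1_subset[of y u] by auto
  have "\<exists>t. (i, t) \<in> set w" "\<exists>l. (l, j) \<in> set w"
    using deg_row[OF Cons.prems(2) ij(2)] deg_col[OF Cons.prems(2) ij(3)] lookup_gen_deg_pos[OF ij(1) v] Cons.prems(3)
    by (auto simp: x)
  then obtain t l where t: "(i, t) \<in> set w" and l: "(l, j) \<in> set w" by blast
  let ?w = "remove1 (i, t) w"
  have w': "?w \<in> lists letters" using rm Cons.prems(2) by blast
  have front: "proportional w ((i, t) # ?w)" by (rule proportional_to_front[OF Cons.prems(2) t])
  have dw: "deg w = gen (i, t) + deg ?w" by (rule deg_remove1[OF t])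
  show ?case
  proof (cases "t = j")
    case True
    then have "deg v = deg ?w" using dw Cons.prems(3) x by simp
    then have "proportional (x # v) (x # ?w)" using Cons.IH[OF v w'] ij(1) by (intro proportional_Cons)
    then show ?thesis using proportional_trans proportional_sym[OF front] True x by metis
  next
    case False
    then have l': "(l, j) \<in> set ?w" using l by (simp add: in_set_remove1)
    let ?u = "remove1 (l, j) ?w"
    have u: "?u \<in> lists letters" using rm w' by blast
    have lt: "(i, t) \<in> letters" "(l, j) \<in> letters" "(l, t) \<in> letters" using t l Cons.prems(2) by auto
    have "proportional w ((i, t) # (l, j) # ?u)"
      using proportional_trans[OF front proportional_Cons[OF proportional_to_front[OF w' l'] lt(1)]] .
    also have "proportional ((i, t) # (l, j) # ?u) ((i, j) # (l, t) # ?u)"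
      by (rule proportional_front[OF proportional_exchange[OF lt(1,2)] u])
    finally have w_eq: "proportional w (x # (l, t) # ?u)" by (simp add: x)
    have "deg w = gen (i, t) + (gen (l, j) + deg ?u)" using dw deg_remove1[OF l'] by simp
    also have "\<dots> = gen (i, j) + (gen (l, t) + deg ?u)" using gen_cross[of i t l j] by (simp add: add.assoc[symmetric])
    finally have "deg v = deg ((l, t) # ?u)" using Cons.prems(3) x by simp
    moreover have "(l, t) # ?u \<in> lists letters" using u lt by simp
    ultimately have "proportional (x # v) (x # (l, t) # ?u)" using Cons.IH[OF v] ij(1) by (intro proportional_Cons)
    then show ?thesis using proportional_trans proportional_sym[OF w_eq] by blast
  qed
qed

text \<open>A word of the support cannot be alone in its degree, since its image would be nonzero.
  Another word \<open>v\<close> of that degree is replaced by a multiple of \<open>w\<close>, which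
  shrinks the support. The correction \<open>d\<close> has class zero, hence image zero because
  \<open>\<Phi>\<close> factors through \<open>cls\<close>; so the scalars involved are never
  compared with weights.\<close>

lemma cls_zero_if_\<Phi>_zero:
  assumes "f \<in> carrier Fr" "\<Phi> f = (\<lambda>_. \<zero>)" shows "cls f = \<zero>\<^bsub>R\<^esub>"
  using assms
proof (induction "card (Fr.supp f)" arbitrary: f rule: less_induct)
  case less
  interpret c: ring_hom_ring Fr R cls by (rule cls_hom)
  note K = Fr.coeff_closed[OF less.prems(1)]
  note fin = Fr.finite_supp[OF less.prems(1)]
  have lists: "w \<in> lists letters" if "f w \<noteq> \<zero>" for w
    using Fr.supp_subset[OF less.prems(1) that] by simp
  show ?case
  proof (cases "f = (\<lambda>_. \<zero>)")
    case True
    then show ?thesis using c.hom_zero by (simp add: Fr.zero_eq)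
  next
    case False
    then obtain w where w: "f w \<noteq> \<zero>" by blast
    have "\<exists>v. v \<noteq> w \<and> f v \<noteq> \<zero> \<and> deg v = deg w"
    proof (rule ccontr)
      assume "\<not> ?thesis"
      then have "{v. f v \<noteq> \<zero> \<and> deg v = deg w} = {w}" using w by blast
      then have "\<Phi> f (deg w) = \<chi> (weight w) \<otimes> f w" using K by (simp add: \<Phi>_def)
      moreover have "\<Phi> f (deg w) = \<zero>" using fun_cong[OF less.prems(2)] .
      ultimately have "\<chi> (weight w) \<otimes> f w = \<zero>" by simp
      then show False using \<chi>_mult_eq_0_iff[OF K] w by blast
    qed
    then obtain v where v: "v \<noteq> w" "f v \<noteq> \<zero>" "deg v = deg w" by blast
    note l = lists[OF v(2)] lists[OF w]
    obtain k where k: "cls (word \<one> v) = cls (word (\<chi> k) w)"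
      using proportional_if_deg_eq[OF l v(3)] by (auto simp: proportional_def)
    define d where "d = word (f v) v \<ominus>\<^bsub>Fr\<^esub> word (\<chi> k \<otimes> f v) w"
    have W: "word (f v) v \<in> carrier Fr" "word (\<chi> k \<otimes> f v) w \<in> carrier Fr"
      using l K by (auto intro!: word_closed)
    have d: "d \<in> carrier Fr" "cls d = \<zero>\<^bsub>R\<^esub>"
      using W cls_scale[OF k l K] by (simp_all add: d_def a_minus_def R.r_neg)
    define g where "g = f \<ominus>\<^bsub>Fr\<^esub> d"
    have g: "g \<in> carrier Fr" using less.prems d by (simp add: g_def)
    have g_val: "g u = f u \<ominus> (word (f v) v u \<ominus> word (\<chi> k \<otimes> f v) w u)" for u
      unfolding g_def Fr.conv_minus_eq[OF less.prems(1) d(1)] unfolding d_def Fr.conv_minus_eq[OF W] ..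
    have "g v = \<zero>" using v K by (simp add: g_val monomial_def a_minus_def r_neg)
    moreover have "g u = \<zero>" if "f u = \<zero>" for u
    proof -
      have "u \<noteq> v" "u \<noteq> w" using that v w by auto
      then show ?thesis using that by (simp add: g_val monomial_def a_minus_def)
    qed
    ultimately have "Fr.supp g \<subset> Fr.supp f" using v by blast
    then have "card (Fr.supp g) < card (Fr.supp f)" using fin by (rule psubset_card_mono[rotated])
    moreover have "\<Phi> g = (\<lambda>_. \<zero>)"
    proof -
      interpret h: ring_hom_ring R A \<Phi>3 by (rule \<Phi>3_hom)
      have "\<Phi> d = \<zero>\<^bsub>A\<^esub>" using \<Phi>3_cls[OF d(1)] d(2) h.hom_zero by simp
      moreover have "\<Phi> g = \<Phi> f \<ominus>\<^bsub>A\<^esub> \<Phi> d" unfolding g_def by (rule \<Phi>_minus[OF less.prems(1) d(1)])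
      moreover have "\<Phi> f = \<zero>\<^bsub>A\<^esub>" using less.prems(2) by (simp add: zero_eq)
      ultimately have "\<Phi> g = \<zero>\<^bsub>A\<^esub>" by (simp add: a_minus_def)
      then show ?thesis by (simp add: zero_eq)
    qed
    ultimately have "cls g = \<zero>\<^bsub>R\<^esub>" using less.hyps[OF _ g] by blast
    moreover have "cls g = cls f"
      unfolding g_def using less.prems d by (simp add: a_minus_def)
    ultimately show ?thesis by simp
  qed
qed

lemma \<Phi>3_iso: "\<Phi>3 \<in> ring_iso R A"
proof -
  interpret h: ring_hom_ring R A \<Phi>3 by (rule \<Phi>3_hom)
  interpret c: ring_hom_ring Fr R cls by (rule cls_hom)
  have "a_kernel R A \<Phi>3 = {\<zero>\<^bsub>R\<^esub>}"
  proof (intro equalityI subsetI)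
    fix C assume "C \<in> a_kernel R A \<Phi>3"
    then have C: "C \<in> carrier R" "\<Phi>3 C = \<zero>\<^bsub>A\<^esub>" unfolding a_kernel_def' by blast+
    obtain f where f: "f \<in> carrier Fr" "C = cls f" using cls_surj[OF C(1)] by blast
    then have "\<Phi> f = (\<lambda>_. \<zero>)" using C(2) \<Phi>3_cls by (simp add: zero_eq)
    then show "C \<in> {\<zero>\<^bsub>R\<^esub>}" using cls_zero_if_\<Phi>_zero f by simp
  next
    fix C assume "C \<in> {\<zero>\<^bsub>R\<^esub>}"
    then show "C \<in> a_kernel R A \<Phi>3" unfolding a_kernel_def' using h.hom_zero by simp
  qed
  then have "inj_on \<Phi>3 (carrier R)" by (rule h.trivial_ker_imp_inj)
  moreover have "\<Phi>3 ` carrier R = carrier A"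
  proof
    show "\<Phi>3 ` carrier R \<subseteq> carrier A" by auto
    show "carrier A \<subseteq> \<Phi>3 ` carrier R"
    proof
      fix a assume "a \<in> carrier A"
      then obtain f where f: "f \<in> carrier Fr" "a = \<Phi> f" using \<Phi>_surj by blast
      then have "a = \<Phi>3 (cls f)" using \<Phi>3_cls by simp
      then show "a \<in> \<Phi>3 ` carrier R" using c.hom_closed[OF f(1)] by blast
    qed
  qed
  ultimately show ?thesis unfolding ring_iso_def bij_betw_def using h.homh by blast
qed

subsection \<open>Equivariance\<close>

abbreviation act_free :: "(nat \<Rightarrow> 'a) \<times> (nat \<Rightarrow> 'a) \<Rightarrow> ((nat \<times> nat) list \<Rightarrow> 'a) \<Rightarrow> (nat \<times> nat) list \<Rightarrow> 'a" where
  "act_free \<equiv> torus_act_free K"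

lemma char_zero: "char h 0 = \<one>"
  unfolding char_def by (intro finprod_one_eqI) simp

text \<open>Each word is an eigenvector, and its eigenvalue is the character of its degree because
  characters are multiplicative on \<open>S\<close>.\<close>

lemma act_free_eq:
  assumes h: "h \<in> carrier (torus K m n)" and f: "f \<in> carrier Fr"
  shows "act_free h f = (\<lambda>w. char h (deg w) \<otimes> f w)"
proof
  fix w
  have "foldr (\<lambda>(i, j) c. fst h i \<otimes> snd h j \<otimes> c) w \<one> = char h (deg w)" if "w \<in> lists letters"
    using that
  proof (induction w rule: list.induct)
    case (Cons x w)
    then show ?case
      using char_add[OF h gen_in_S[of x] deg_in_S[of w]] char_gen[OF h, of x] by (simp add: split_beta)
  qed (simp add: char_zero)
  then show "act_free h f w = char h (deg w) \<otimes> f w"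
    using Fr.supp_subset[OF f, of w] char_closed[OF h] by (auto simp: torus_act_free_def)
qed

lemma act_free_closed:
  assumes h: "h \<in> carrier (torus K m n)" and f: "f \<in> carrier Fr"
  shows "act_free h f \<in> carrier Fr"
  unfolding act_free_eq[OF h f]
proof (rule Fr.carrierI)
  show "Fr.supp f \<subseteq> carrier (free_monoid letters)" using Fr.supp_subset[OF f] by blast
qed (use Fr.coeff_closed[OF f] char_closed[OF h] Fr.finite_supp[OF f] in auto)

lemma act_free_inverse:
  assumes h: "h \<in> carrier (torus K m n)" and h': "h' \<in> carrier (torus K m n)" "\<forall>s\<in>S. char h' s \<otimes> char h s = \<one>"
    and f: "f \<in> carrier Fr"
  shows "act_free h (act_free h' f) = f"
  unfolding act_free_eq[OF h act_free_closed[OF h'(1) f]]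
  unfolding act_free_eq[OF h'(1) f]
proof
  fix w
  have "char h (deg w) \<otimes> (char h' (deg w) \<otimes> f w) = (char h' (deg w) \<otimes> char h (deg w)) \<otimes> f w"
    using char_closed[OF h] char_closed[OF h'(1)] Fr.coeff_closed[OF f] by (simp add: m_ac)
  also have "\<dots> = f w"
    using h'(2) deg_in_S[of w] Fr.supp_subset[OF f, of w] Fr.coeff_closed[OF f] char_closed[OF h] char_closed[OF h'(1)]
    by (cases "f w = \<zero>") auto
  finally show "char h (deg w) \<otimes> (char h' (deg w) \<otimes> f w) = f w" .
qed

lemma act_free_add:
  assumes h: "h \<in> carrier (torus K m n)" and f: "f \<in> carrier Fr" and g: "g \<in> carrier Fr"
  shows "act_free h (f \<oplus>\<^bsub>Fr\<^esub> g) = act_free h f \<oplus>\<^bsub>Fr\<^esub> act_free h g"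
  unfolding act_free_eq[OF h f] act_free_eq[OF h g] act_free_eq[OF h Fr.add_closed[OF f g]]
  using Fr.coeff_closed[OF f] Fr.coeff_closed[OF g] char_closed[OF h] by (auto simp: Fr.add_eq r_distr)

lemma act_free_monomial:
  assumes h: "h \<in> carrier (torus K m n)" and "a \<in> carrier K" "w \<in> lists letters"
  shows "act_free h (word a w) = word (char h (deg w) \<otimes> a) w"
  using act_free_eq[OF h word_closed[OF assms(2,3)]] char_closed[OF h] by (auto simp: monomial_def)

lemma act_free_zero: "h \<in> carrier (torus K m n) \<Longrightarrow> act_free h (\<lambda>_. \<zero>) = (\<lambda>_. \<zero>)"
  by (simp add: torus_act_free_def)

lemma act_free_mult:
  assumes h: "h \<in> carrier (torus K m n)" and "f \<in> carrier Fr" "g \<in> carrier Fr"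
  shows "act_free h (f \<otimes>\<^bsub>Fr\<^esub> g) = act_free h f \<otimes>\<^bsub>Fr\<^esub> act_free h g"
  using assms(2,3)
proof (induction f rule: Fr.carrier_induct)
  case zero
  then show ?case using h by (simp add: Fr.mult_zero_left act_free_zero act_free_closed)
next
  case (add f f')
  then show ?case using h by (simp add: Fr.conv_l_distr act_free_add Fr.mult_closed act_free_closed)
next
  case a: (monomial a u)
  show ?case using a(3)
  proof (induction g rule: Fr.carrier_induct)
    case zero
    then show ?case using a h by (simp add: Fr.mult_zero_right act_free_zero act_free_closed)
  next
    case (add g g')
    then show ?case using a h by (simp add: Fr.conv_r_distr act_free_add Fr.mult_closed act_free_closed)
  next
    case b: (monomial b v)
    have uv: "u \<in> lists letters" "v \<in> lists letters" "u @ v \<in> lists letters" using a b by auto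
    have "char h (deg (u @ v)) \<otimes> (a \<otimes> b) = (char h (deg u) \<otimes> a) \<otimes> (char h (deg v) \<otimes> b)"
      using a b char_closed[OF h] char_add[OF h deg_in_S[OF uv(1)] deg_in_S[OF uv(2)]] by (simp add: m_ac)
    then show ?case
      using a(1) b(1) uv char_closed[OF h] h by (simp add: word_mult act_free_monomial)
  qed
qed

lemma act_free_hom: "h \<in> carrier (torus K m n) \<Longrightarrow> ring_hom_ring Fr Fr (act_free h)"
  by (rule ring_hom_ringI)
    (auto simp: Fr.ring_A act_free_closed act_free_mult act_free_add Fr.one_eq act_free_monomial char_zero)

lemma \<Phi>_act:
  assumes h: "h \<in> carrier (torus K m n)" and f: "f \<in> carrier Fr"
  shows "\<Phi> (act_free h f) = act h (\<Phi> f)"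
  using f
proof (induction f rule: Fr.carrier_induct)
  case zero
  then show ?case using h char_closed[OF h] by (simp add: act_free_zero \<Phi>_zero)
next
  case (add f g)
  then show ?case
    using h char_closed[OF h] coeff_closed[OF \<Phi>_closed[OF add(1)]] coeff_closed[OF \<Phi>_closed[OF add(2)]]
    by (simp add: act_free_add \<Phi>_add act_free_closed) (simp add: add_eq r_distr)
next
  case (monomial a u)
  then show ?case
    using h char_closed[OF h] by (simp add: act_free_monomial \<Phi>_monomial) (auto simp: monomial_def m_lcomm)
qed

definition homogeneous :: "(nat \<Rightarrow>\<^sub>0 int) \<Rightarrow> ((nat \<times> nat) list \<Rightarrow> 'a) \<Rightarrow> bool" where
  "homogeneous s f \<longleftrightarrow> f \<in> carrier Fr \<and> (\<forall>w. f w \<noteq> \<zero> \<longrightarrow> deg w = s)"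

lemma homogeneous_word:
  "a \<in> carrier K \<Longrightarrow> w \<in> lists letters \<Longrightarrow> deg w = s \<Longrightarrow> homogeneous s (word a w)"
  using word_closed[of a w] by (auto simp: homogeneous_def, auto simp: monomial_def split: if_splits)

lemma homogeneous_minus:
  assumes "homogeneous s f" "homogeneous s g" shows "homogeneous s (f \<ominus>\<^bsub>Fr\<^esub> g)"
proof -
  have fg: "f \<in> carrier Fr" "g \<in> carrier Fr" using assms by (auto simp: homogeneous_def)
  have "deg w = s" if "(f \<ominus>\<^bsub>Fr\<^esub> g) w \<noteq> \<zero>" for w
  proof -
    have "f w \<noteq> \<zero> \<or> g w \<noteq> \<zero>"
      using that unfolding Fr.conv_minus_eq[OF fg] by (auto simp: a_minus_def)
    then show ?thesis using assms by (auto simp: homogeneous_def)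
  qed
  then show ?thesis using fg by (simp add: homogeneous_def)
qed

lemma relators_homogeneous:
  assumes "f \<in> commutation_relators" shows "\<exists>s. homogeneous s f"
proof -
  have two: "\<exists>s. homogeneous s (word a [x, y] \<ominus>\<^bsub>Fr\<^esub> word b [y, x])"
    if "a \<in> carrier K" "b \<in> carrier K" "x \<in> letters" "y \<in> letters" for a b x y
    by (intro exI[of _ "gen x + gen y"] homogeneous_minus homogeneous_word) (use that in \<open>auto simp: add.commute\<close>)
  have three: "\<exists>s. homogeneous s (word \<one> [(i, j), (l, t)] \<ominus>\<^bsub>Fr\<^esub> word \<one> [(l, t), (i, j)] \<ominus>\<^bsub>Fr\<^esub> word (q \<ominus> inv q) [(i, t), (l, j)])"
    if "(i, j) \<in> letters" "(l, t) \<in> letters" for i j l t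
    by (intro exI[of _ "gen (i, j) + gen (l, t)"] homogeneous_minus homogeneous_word)
      (use that in \<open>auto simp: add.commute gen_cross\<close>)
  consider
      i l j where "f = word \<one> [(i, j), (l, j)] \<ominus>\<^bsub>Fr\<^esub> word q [(l, j), (i, j)]" "1 \<le> i" "i < l" "l \<le> m" "1 \<le> j" "j \<le> n"
    | i j t where "f = word \<one> [(i, j), (i, t)] \<ominus>\<^bsub>Fr\<^esub> word q [(i, t), (i, j)]" "1 \<le> i" "i \<le> m" "1 \<le> j" "j < t" "t \<le> n"
    | i l j t where "f = word \<one> [(i, t), (l, j)] \<ominus>\<^bsub>Fr\<^esub> word \<one> [(l, j), (i, t)]" "1 \<le> i" "i < l" "l \<le> m" "1 \<le> j" "j < t" "t \<le> n"
    | i l j t where "f = (word \<one> [(i, j), (l, t)] \<ominus>\<^bsub>Fr\<^esub> word \<one> [(l, t), (i, j)]) \<ominus>\<^bsub>Fr\<^esub> word (q \<ominus> inv q) [(i, t), (l, j)]"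
        "1 \<le> i" "i < l" "l \<le> m" "1 \<le> j" "j < t" "t \<le> n"
    using assms unfolding commutation_relators_def by blast
  then show ?thesis
  proof cases
    case 1
    show ?thesis unfolding 1(1) using 1 by (intro two) auto
  next
    case 2
    show ?thesis unfolding 2(1) using 2 by (intro two) auto
  next
    case 3
    show ?thesis unfolding 3(1) using 3 by (intro two) auto
  next
    case 4
    show ?thesis unfolding 4(1) using 4 by (intro three) auto
  qed
qed

text \<open>On a homogeneous element the torus acts by a scalar. The relators are homogeneous, so
  each is sent into the ideal they generate.\<close>

lemma act_free_I_rel:
  assumes h: "h \<in> carrier (torus K m n)" shows "act_free h ` I_rel \<subseteq> I_rel"
proof -
  interpret I: ideal I_rel Fr by (rule I_rel_ideal)
  have "I_rel \<subseteq> {f \<in> carrier Fr. act_free h f \<in> I_rel}"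
  proof (subst (1) qmat_rel_ideal_def, unfold qmat_relators_eq,
      rule Fr.A.genideal_minimal[OF ring_hom_ring.ideal_vimage[OF act_free_hom[OF h] I_rel_ideal]], rule subsetI)
    fix f assume f: "f \<in> commutation_relators"
    then obtain s where s: "homogeneous s f" using relators_homogeneous by blast
    then have fF: "f \<in> carrier Fr" by (simp add: homogeneous_def)
    have fI: "f \<in> I_rel"
      unfolding qmat_rel_ideal_def qmat_relators_eq using Fr.A.genideal_self[OF relators_closed] f by blast
    have c: "char h s \<in> carrier K" by (rule char_closed[OF h])
    have "word (char h s) [] \<otimes>\<^bsub>Fr\<^esub> f = act_free h f"
    proof
      fix w
      show "(word (char h s) [] \<otimes>\<^bsub>Fr\<^esub> f) w = act_free h f w"
      proof (cases "w \<in> lists letters")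
        case True
        have "(word (char h s) [] \<otimes>\<^bsub>Fr\<^esub> f) ([] \<otimes>\<^bsub>free_monoid letters\<^esub> w) = char h s \<otimes> f w"
          using True fF c by (intro Fr.monomial_mult_cancel) auto
        then show ?thesis using s c char_closed[OF h]
          by (cases "f w = \<zero>") (simp_all add: act_free_eq[OF h fF] homogeneous_def)
      next
        case False
        have "word (char h s) [] \<otimes>\<^bsub>Fr\<^esub> f \<in> carrier Fr" using fF c by simp
        then have "(word (char h s) [] \<otimes>\<^bsub>Fr\<^esub> f) w = \<zero>" "act_free h f w = \<zero>"
          using False Fr.supp_subset[of _ w] act_free_closed[OF h fF] by auto
        then show ?thesis by simp
      qed
    qed
    moreover have "word (char h s) [] \<otimes>\<^bsub>Fr\<^esub> f \<in> I_rel" using fI c by (intro I.I_l_closed) auto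
    ultimately show "f \<in> {f \<in> carrier Fr. act_free h f \<in> I_rel}" using fF by simp
  qed
  then show ?thesis by blast
qed

lemma act_free_I_rel_eq:
  assumes h: "h \<in> carrier (torus K m n)" shows "act_free h ` I_rel = I_rel"
proof
  show "act_free h ` I_rel \<subseteq> I_rel" by (rule act_free_I_rel[OF h])
  show "I_rel \<subseteq> act_free h ` I_rel"
  proof
    fix f assume f: "f \<in> I_rel"
    then have fF: "f \<in> carrier Fr" using ideal_subset_carrier[OF I_rel_ideal] by blast
    obtain h' where h': "h' \<in> carrier (torus K m n)" "\<forall>s\<in>S. char h' s \<otimes> char h s = \<one>" using char_inverse[OF h] by blast
    have "act_free h (act_free h' f) = f" by (rule act_free_inverse[OF h h' fF])
    moreover have "act_free h' f \<in> I_rel" using act_free_I_rel[OF h'(1)] f by blast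
    ultimately show "f \<in> act_free h ` I_rel" by (metis image_eqI)
  qed
qed

lemma act_p1:
  assumes h: "h \<in> carrier (torus K m n)" and f: "f \<in> carrier Fr"
  shows "act_free h ` p1 f = p1 (act_free h f)"
  using image_coset[OF Fr.ring_A I_rel_ideal f act_free_I_rel_eq[OF h] act_free_add[OF h]] .

lemma act_Q_add:
  assumes h: "h \<in> carrier (torus K m n)" and "C \<in> carrier Q" "D \<in> carrier Q"
  shows "act_free h ` (C \<oplus>\<^bsub>Q\<^esub> D) = act_free h ` C \<oplus>\<^bsub>Q\<^esub> act_free h ` D"
proof -
  interpret p: ring_hom_ring Fr Q p1 by (rule p1_hom)
  obtain f g where fg: "f \<in> carrier Fr" "C = p1 f" "g \<in> carrier Fr" "D = p1 g"
    using p1_surj[OF assms(2)] p1_surj[OF assms(3)] by blast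
  have "act_free h ` (C \<oplus>\<^bsub>Q\<^esub> D) = p1 (act_free h (f \<oplus>\<^bsub>Fr\<^esub> g))"
    using act_p1[OF h, of "f \<oplus>\<^bsub>Fr\<^esub> g"] fg by simp
  then show ?thesis using fg act_free_closed[OF h] by (simp add: act_free_add[OF h] act_p1[OF h])
qed

text \<open>Injectivity of \<open>\<Phi>3\<close> identifies the ideal of the minors with the kernel
  of \<open>\<Phi>2\<close>. Its stability under the torus then follows from equivariance of
  \<open>\<Phi>2\<close>.\<close>

lemma J_min_eq: "J_min = {C \<in> carrier Q. \<Phi>2 C = \<zero>\<^bsub>A\<^esub>}"
proof (intro equalityI subsetI)
  fix C assume "C \<in> J_min"
  then show "C \<in> {C \<in> carrier Q. \<Phi>2 C = \<zero>\<^bsub>A\<^esub>}" using \<Phi>2_J_min ideal_subset_carrier[OF J_min_ideal] by blast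
next
  interpret J: ideal J_min Q by (rule J_min_ideal)
  interpret p2: ring_hom_ring Q R p2 by (rule p2_hom)
  interpret h: ring_hom_ring R A \<Phi>3 by (rule \<Phi>3_hom)
  fix C assume "C \<in> {C \<in> carrier Q. \<Phi>2 C = \<zero>\<^bsub>A\<^esub>}"
  then have C: "C \<in> carrier Q" "\<Phi>2 C = \<zero>\<^bsub>A\<^esub>" by blast+
  then have eq: "\<Phi>3 (p2 C) = \<Phi>3 \<zero>\<^bsub>R\<^esub>" using \<Phi>3_coset[OF C(1)] h.hom_zero by simp
  have "inj_on \<Phi>3 (carrier R)" using \<Phi>3_iso by (simp add: ring_iso_def bij_betw_def)
  then have "p2 C = \<zero>\<^bsub>R\<^esub>" by (rule inj_onD[OF _ eq p2.hom_closed[OF C(1)] R.zero_closed])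
  also have "\<zero>\<^bsub>R\<^esub> = J_min" unfolding qmat_mod_minors_def by (rule zero_FactRing)
  finally have "p2 C = J_min" .
  then show "C \<in> J_min" using J.a_rcos_self[OF C(1)] by simp
qed

lemma act_Q_closed: "h \<in> carrier (torus K m n) \<Longrightarrow> C \<in> carrier Q \<Longrightarrow> act_free h ` C \<in> carrier Q"
proof -
  assume h: "h \<in> carrier (torus K m n)" and "C \<in> carrier Q"
  interpret p: ring_hom_ring Fr Q p1 by (rule p1_hom)
  obtain f where "f \<in> carrier Fr" "C = p1 f" using p1_surj[OF \<open>C \<in> carrier Q\<close>] by blast
  then show ?thesis using act_p1[OF h] act_free_closed[OF h] by simp
qed

lemma \<Phi>2_act:
  assumes h: "h \<in> carrier (torus K m n)" and C: "C \<in> carrier Q"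
  shows "\<Phi>2 (act_free h ` C) = act h (\<Phi>2 C)"
proof -
  obtain f where "f \<in> carrier Fr" "C = p1 f" using p1_surj[OF C] by blast
  then show ?thesis using act_free_closed[OF h] by (simp add: act_p1[OF h] \<Phi>2_coset \<Phi>_act[OF h])
qed

lemma act_J_min:
  assumes h: "h \<in> carrier (torus K m n)" shows "image (act_free h) ` J_min = J_min"
proof
  have sub: "image (act_free h) ` J_min \<subseteq> J_min" if h: "h \<in> carrier (torus K m n)" for h
  proof
    fix D assume "D \<in> image (act_free h) ` J_min"
    then obtain C where C: "C \<in> carrier Q" "\<Phi>2 C = \<zero>\<^bsub>A\<^esub>" "D = act_free h ` C" unfolding J_min_eq by blast
    then have "\<Phi>2 D = \<zero>\<^bsub>A\<^esub>" using char_closed[OF h] by (simp add: \<Phi>2_act[OF h] zero_eq)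
    then show "D \<in> J_min" unfolding J_min_eq using act_Q_closed[OF h C(1)] C(3) by simp
  qed
  then show "image (act_free h) ` J_min \<subseteq> J_min" using h by blast
  show "J_min \<subseteq> image (act_free h) ` J_min"
  proof
    fix C assume C: "C \<in> J_min"
    then have CQ: "C \<in> carrier Q" using ideal_subset_carrier[OF J_min_ideal] by blast
    obtain f where f: "f \<in> carrier Fr" "C = p1 f" using p1_surj[OF CQ] by blast
    obtain h' where h': "h' \<in> carrier (torus K m n)" "\<forall>s\<in>S. char h' s \<otimes> char h s = \<one>" using char_inverse[OF h] by blast
    have "act_free h (act_free h' f) = f" by (rule act_free_inverse[OF h h' f(1)])
    then have "act_free h ` (act_free h' ` C) = C"
      using f act_free_closed[OF h'(1) f(1)] by (simp add: act_p1[OF h] act_p1[OF h'(1)])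
    moreover have "act_free h' ` C \<in> J_min" using sub[OF h'(1)] C by blast
    ultimately show "C \<in> image (act_free h) ` J_min" by (metis image_eqI)
  qed
qed

lemma act_cls:
  assumes h: "h \<in> carrier (torus K m n)" and f: "f \<in> carrier Fr"
  shows "torus_act K h (cls f) = cls (act_free h f)"
proof -
  interpret p: ring_hom_ring Fr Q p1 by (rule p1_hom)
  have "image (act_free h) ` p2 (p1 f) = p2 (act_free h ` p1 f)"
    by (rule image_coset[OF Q.ring_axioms J_min_ideal p.hom_closed[OF f] act_J_min[OF h] act_Q_add[OF h]])
  then show ?thesis by (simp add: torus_act_def cls_def act_p1[OF h f])
qed

sublocale iso: equivariant_ring_iso R A \<Phi>3 "torus K m n" "torus_act K" act
proof
  interpret c: ring_hom_ring Fr R cls by (rule cls_hom)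
  show "\<Phi>3 \<in> ring_iso R A" by (rule \<Phi>3_iso)
  fix h C assume h: "h \<in> carrier (torus K m n)" and C: "C \<in> carrier R"
  obtain f where f: "f \<in> carrier Fr" "C = cls f" using cls_surj[OF C] by blast
  show "torus_act K h C \<in> carrier R" using act_cls[OF h f(1)] act_free_closed[OF h f(1)] f(2) by simp
  show "\<Phi>3 (torus_act K h C) = act h (\<Phi>3 C)"
    using act_cls[OF h f(1)] act_free_closed[OF h f(1)] f by (simp add: \<Phi>3_cls \<Phi>_act[OF h])
qed

section \<open>Transfer of the results to the quotient by the quantum minors\<close>

lemma H_prime_card: "card {P. H_prime (torus K m n) (torus_act K) R P} = (2 ^ m - 1) * (2 ^ n - 1) + 1"
  using bij_betw_same_card[OF iso.bij_betw_H_prime] twisted_algebra_H_spectrum(1) by simp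

lemma H_prime_transfer:
  assumes "H_prime (torus K m n) (torus_act K) R P"
  shows "P \<subseteq> carrier R" "H_prime (torus K m n) act A (\<Phi>3 ` P)"
proof -
  show P: "P \<subseteq> carrier R" using assms by (simp add: H_prime_def ideal_subset_carrier)
  show "H_prime (torus K m n) act A (\<Phi>3 ` P)" using iso.H_prime_image_iff[OF P] assms by simp
qed

lemma H_prime_completely_prime:
  assumes "H_prime (torus K m n) (torus_act K) R P" shows "completely_prime R P"
  using twisted_algebra_H_spectrum(2)[OF H_prime_transfer(2)[OF assms]] iso.completely_prime_image_iff[OF H_prime_transfer(1)[OF assms]]
  by simp

lemma H_stratum_homeomorphic:
  assumes "H_prime (torus K m n) (torus_act K) R J"
  shows "\<exists>r. subtopology (zariski R) (H_stratum (torus K m n) (torus_act K) R J)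
    homeomorphic_space zariski (laurent_ring (plain_ring K) r)"
proof -
  note J = H_prime_transfer[OF assms]
  obtain r where r: "subtopology (zariski A) (H_stratum (torus K m n) act A (\<Phi>3 ` J))
    homeomorphic_space zariski (laurent_ring (plain_ring K) r)" using twisted_algebra_H_spectrum(3)[OF J(2)] by blast
  have "subtopology (zariski R) (H_stratum (torus K m n) (torus_act K) R J) homeomorphic_space
    subtopology (zariski A) ((`) \<Phi>3 ` H_stratum (torus K m n) (torus_act K) R J)"
    by (rule iso.homeomorphic_space_zariski_image) (auto simp: H_stratum_def)
  also have "(`) \<Phi>3 ` H_stratum (torus K m n) (torus_act K) R J = H_stratum (torus K m n) act A (\<Phi>3 ` J)"
    by (rule iso.H_stratum_image[OF J(1) H_nonempty])
  finally show ?thesis using r homeomorphic_space_trans by blast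
qed

end

theorem corollary3p5:
  fixes K :: "('a, 'b) ring_scheme" and q :: 'a and m n :: nat
  assumes "field K" and "infinite (carrier K)"
    and "q \<in> Units K"
    and "m \<ge> 1" and "n \<ge> 1"
  shows "card {P. H_prime (torus K m n) (torus_act K) (qmat_mod_minors K q m n) P}
           = (2 ^ m - 1) * (2 ^ n - 1) + 1
    \<and> (\<forall>P. H_prime (torus K m n) (torus_act K) (qmat_mod_minors K q m n) P
           \<longrightarrow> completely_prime (qmat_mod_minors K q m n) P)
    \<and> (\<forall>J. H_prime (torus K m n) (torus_act K) (qmat_mod_minors K q m n) J
           \<longrightarrow> (\<exists>(L :: 'a ring) \<iota> r. algebraic_field_extension K L \<iota> \<and>
                 subtopology (zariski (qmat_mod_minors K q m n))
                   (H_stratum (torus K m n) (torus_act K) (qmat_mod_minors K q m n) J)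
                 homeomorphic_space zariski (laurent_ring L r)))"
proof -
  interpret field K by fact
  interpret quantum_setup K q m n by unfold_locales fact+
  show ?thesis
    using H_prime_card H_prime_completely_prime H_stratum_homeomorphic
      algebraic_field_extension_plain_ring[OF assms(1)] by meson
qed

end
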